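(* Let $T>0$, let $\Omega\subset\mathbb{R}^d$ ($d=1,2,3$) be a bounded Lipschitz domain, $Q_T:=\Omega\times(0,T)$, and let $c\in L^\infty(\Omega)$ with $c(\boldsymbol{x})\ge c_0$ for some constant $c_0>0$. Let $V_{h_{\boldsymbol{x}}}^{p_{\boldsymbol{x}}}(\Omega)\subset H_0^1(\Omega)$ and $S_{h_t}^{p_t}(0,T)\subset H^2_{0,\bullet}(0,T)$ be finite dimensional subspaces, and let $Q_{\boldsymbol{h}}^{\boldsymbol{p}}(Q_T):=V_{h_{\boldsymbol{x}}}^{p_{\boldsymbol{x}}}(\Omega)\otimes S_{h_t}^{p_t}(0,T)$. Let $F\in L^2(Q_T)$. Then there exists a unique $U_{\boldsymbol{h}}\in Q_{\boldsymbol{h}}^{\boldsymbol{p}}(Q_T)$ such that $$\mathcal{A}(U_{\boldsymbol{h}},\mathcal{L}_TW_{\boldsymbol{h}})=(F,\partial_t\mathcal{L}_TW_{\boldsymbol{h}})_{L^2(Q_T)}\quad\text{for all }W_{\boldsymbol{h}}\in Q_{\boldsymbol{h}}^{\boldsymbol{p}}(Q_T),$$ and it satisfies $$\|U_{\boldsymbol{h}}\|_{\mathcal{V}(Q_T)}\le2eT\,\|F\|_{L^2(Q_T)}.$$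
   Context: $H^2_{0,\bullet}(0,T):=\{u\in H^2(0,T):u(0)=0\}$. The bilinear form is $$\mathcal{A}(U,W):=(\partial_t^2U,\partial_tW)_{L^2(Q_T)}+(\partial_tU(\cdot,0),\partial_tW(\cdot,0))_{L^2(\Omega)}+(c^2\nabla_{\boldsymbol{x}}U,\nabla_{\boldsymbol{x}}\partial_tW)_{L^2(Q_T)},$$ the operator $\mathcal{L}_T$ is $\mathcal{L}_TW(\boldsymbol{x},t):=\int_0^te^{-s/T}\partial_sW(\boldsymbol{x},s)\,\mathrm{d}s$, and $\|U\|_{\mathcal{V}(Q_T)}^2:=\|\partial_tU\|_{L^2(Q_T)}^2+\|c\nabla_{\boldsymbol{x}}U\|_{L^2(Q_T)}^2$. *)

theory Defs
  imports "HOL-Analysis.Analysis"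
begin

text \<open>
  Elements of Lebesgue and Sobolev spaces over an open set are represented by functions on the
  whole space whose values outside the set are irrelevant. Two functions represent the same
  element iff they agree almost everywhere on the set, so equality in these spaces (in
  particular uniqueness) always means equality almost everywhere. Representatives are taken
  Borel measurable; every Lebesgue measurable function has such a representative.
\<close>

abbreviation leb :: "'a::euclidean_space set \<Rightarrow> 'a measure" where
  "leb S \<equiv> restrict_space lborel S"

definition L2 :: "'a::euclidean_space set \<Rightarrow> ('a \<Rightarrow> 'b::euclidean_space) set" where
  "L2 S = {f \<in> borel_measurable (leb S). integrable (leb S) (\<lambda>x. (norm (f x))\<^sup>2)}"

definition l2_inner ::
    "'a::euclidean_space set \<Rightarrow> ('a \<Rightarrow> 'b::euclidean_space) \<Rightarrow> ('a \<Rightarrow> 'b) \<Rightarrow> real" where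
  "l2_inner S f g = (\<integral>x. f x \<bullet> g x \<partial>leb S)"

definition l2_norm :: "'a::euclidean_space set \<Rightarrow> ('a \<Rightarrow> 'b::euclidean_space) \<Rightarrow> real" where
  "l2_norm S f = sqrt (l2_inner S f f)"

definition Linf :: "'a::euclidean_space set \<Rightarrow> ('a \<Rightarrow> real) set" where
  "Linf S = {f \<in> borel_measurable (leb S). \<exists>K. AE x in leb S. \<bar>f x\<bar> \<le> K}"


subsection \<open>Weak derivatives and Sobolev spaces\<close>

primrec Ck :: "nat \<Rightarrow> ('a::euclidean_space \<Rightarrow> real) \<Rightarrow> bool" where
  "Ck 0 f \<longleftrightarrow> continuous_on UNIV f"
| "Ck (Suc k) f \<longleftrightarrow> (\<forall>x. f differentiable (at x)) \<and>
     (\<forall>b\<in>Basis. Ck k (\<lambda>x. frechet_derivative f (at x) b))"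

definition test_function :: "'a::euclidean_space set \<Rightarrow> ('a \<Rightarrow> real) \<Rightarrow> bool" where
  "test_function S \<phi> \<longleftrightarrow> (\<forall>k. Ck k \<phi>) \<and>
     compact (closure {x. \<phi> x \<noteq> 0}) \<and> closure {x. \<phi> x \<noteq> 0} \<subseteq> S"

definition locally_integrable :: "'a::euclidean_space set \<Rightarrow> ('a \<Rightarrow> real) \<Rightarrow> bool" where
  "locally_integrable S f \<longleftrightarrow> f \<in> borel_measurable (leb S) \<and>
     (\<forall>K. compact K \<and> K \<subseteq> S \<longrightarrow> set_integrable lborel K f)"

definition has_weak_deriv ::
    "'a::euclidean_space set \<Rightarrow> 'a \<Rightarrow> ('a \<Rightarrow> real) \<Rightarrow> ('a \<Rightarrow> real) \<Rightarrow> bool" where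
  "has_weak_deriv S v f g \<longleftrightarrow> locally_integrable S f \<and> locally_integrable S g \<and>
     (\<forall>\<phi>. test_function S \<phi> \<longrightarrow>
        (\<integral>x. f x * frechet_derivative \<phi> (at x) v \<partial>leb S) = - (\<integral>x. g x * \<phi> x \<partial>leb S))"

text \<open>Weak derivatives on an open set are unique almost everywhere, so the choice of a
  representative is immaterial.\<close>

definition weak_deriv ::
    "'a::euclidean_space set \<Rightarrow> 'a \<Rightarrow> ('a \<Rightarrow> real) \<Rightarrow> 'a \<Rightarrow> real" where
  "weak_deriv S v f = (SOME g. has_weak_deriv S v f g)"

definition weak_grad :: "'a::euclidean_space set \<Rightarrow> ('a \<Rightarrow> real) \<Rightarrow> 'a \<Rightarrow> 'a" where
  "weak_grad S u x = (\<Sum>b\<in>Basis. weak_deriv S b u x *\<^sub>R b)"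

primrec Hk :: "nat \<Rightarrow> 'a::euclidean_space set \<Rightarrow> ('a \<Rightarrow> real) set" where
  "Hk 0 S = L2 S"
| "Hk (Suc k) S = {u \<in> L2 S. \<forall>b\<in>Basis. \<exists>g\<in>Hk k S. has_weak_deriv S b u g}"

definition h1_norm :: "'a::euclidean_space set \<Rightarrow> ('a \<Rightarrow> real) \<Rightarrow> real" where
  "h1_norm S u = sqrt ((l2_norm S u)\<^sup>2 + (l2_norm S (weak_grad S u))\<^sup>2)"

definition H10 :: "'a::euclidean_space set \<Rightarrow> ('a \<Rightarrow> real) set" where
  "H10 S = {u \<in> Hk 1 S. \<exists>\<phi>. (\<forall>n. test_function S (\<phi> n)) \<and>
     (\<lambda>n. h1_norm S (\<lambda>x. \<phi> n x - u x)) \<longlonglongrightarrow> 0}"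

text \<open>The point value at 0 is the value of the representative that is continuous on
  \<open>[0, T]\<close>.\<close>

definition H20 :: "real \<Rightarrow> (real \<Rightarrow> real) set" where
  "H20 T = {u \<in> Hk 2 {0<..<T}. \<exists>w. continuous_on {0..T} w \<and>
     (AE t in leb {0<..<T}. u t = w t) \<and> w 0 = 0}"


subsection \<open>Finite dimensional subspaces and their tensor product\<close>

text \<open>A linear subspace of classes modulo a.e. equality is given by the set of all
  representatives of its elements, hence the closure under a.e. equality. Spanning is
  required only up to a.e. equality.\<close>

definition fin_dim_subspace :: "'a::euclidean_space set \<Rightarrow> ('a \<Rightarrow> real) set \<Rightarrow> bool" where
  "fin_dim_subspace S X \<longleftrightarrow>
     (\<lambda>_. 0) \<in> X \<and>
     (\<forall>f\<in>X. \<forall>g\<in>X. (\<lambda>x. f x + g x) \<in> X) \<and>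
     (\<forall>a. \<forall>f\<in>X. (\<lambda>x. a * f x) \<in> X) \<and>
     (\<forall>f\<in>X. \<forall>g\<in>borel_measurable (leb S). (AE x in leb S. f x = g x) \<longrightarrow> g \<in> X) \<and>
     (\<exists>B. finite B \<and> B \<subseteq> X \<and>
        (\<forall>f\<in>X. \<exists>a. AE x in leb S. f x = (\<Sum>b\<in>B. a b * b x)))"

abbreviation cyl :: "'a::euclidean_space set \<Rightarrow> real \<Rightarrow> ('a \<times> real) set" where
  "cyl \<Omega> T \<equiv> \<Omega> \<times> {0<..<T}"

definition tensor_space :: "'a::euclidean_space set \<Rightarrow> real \<Rightarrow>
    ('a \<Rightarrow> real) set \<Rightarrow> (real \<Rightarrow> real) set \<Rightarrow> ('a \<times> real \<Rightarrow> real) set" where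
  "tensor_space \<Omega> T V S = {U \<in> borel_measurable (leb (cyl \<Omega> T)).
     \<exists>(n::nat) v s. (\<forall>i<n. v i \<in> V \<and> s i \<in> S) \<and>
       (AE (x, t) in leb (cyl \<Omega> T). U (x, t) = (\<Sum>i<n. v i x * s i t))}"


subsection \<open>Lipschitz domains\<close>

text \<open>Near each boundary point \<open>p\<close>, in orthogonal coordinates with origin \<open>p\<close> and last axis
  \<open>e\<close>, the set is the strict epigraph of a Lipschitz function \<open>\<gamma>\<close> on the hyperplane
  orthogonal to \<open>e\<close>.\<close>

definition lipschitz_domain :: "'a::euclidean_space set \<Rightarrow> bool" where
  "lipschitz_domain \<Omega> \<longleftrightarrow> open \<Omega> \<and> connected \<Omega> \<and> \<Omega> \<noteq> {} \<and>
     (\<forall>p\<in>frontier \<Omega>. \<exists>e r h L (\<gamma> :: 'a \<Rightarrow> real).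
        norm e = 1 \<and> r > 0 \<and> h > 0 \<and>
        L-lipschitz_on {y. y \<bullet> e = 0 \<and> norm y < r} \<gamma> \<and>
        (\<forall>y. y \<bullet> e = 0 \<and> norm y < r \<longrightarrow> \<bar>\<gamma> y\<bar> < h) \<and>
        (\<forall>y s. y \<bullet> e = 0 \<and> norm y < r \<and> \<bar>s\<bar> < h \<longrightarrow>
           (p + y + s *\<^sub>R e \<in> \<Omega> \<longleftrightarrow> \<gamma> y < s)))"


subsection \<open>The bilinear form on the space-time cylinder\<close>

definition dt :: "'a::euclidean_space set \<Rightarrow> real \<Rightarrow> ('a \<times> real \<Rightarrow> real) \<Rightarrow> 'a \<times> real \<Rightarrow> real" where
  "dt \<Omega> T U = weak_deriv (cyl \<Omega> T) (0, 1) U"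

definition grad_x :: "'a::euclidean_space set \<Rightarrow> real \<Rightarrow> ('a \<times> real \<Rightarrow> real) \<Rightarrow> 'a \<times> real \<Rightarrow> 'a" where
  "grad_x \<Omega> T U z = (\<Sum>b\<in>Basis. weak_deriv (cyl \<Omega> T) (b, 0) U z *\<^sub>R b)"

text \<open>\<open>g\<close> is the value at time 0 of the representative of \<open>W\<close> in \<open>C([0,T]; L2(\<Omega>))\<close>;
  like weak derivatives, it is unique almost everywhere.\<close>

definition has_initial_trace :: "'a::euclidean_space set \<Rightarrow> real \<Rightarrow>
    ('a \<times> real \<Rightarrow> real) \<Rightarrow> ('a \<Rightarrow> real) \<Rightarrow> bool" where
  "has_initial_trace \<Omega> T W g \<longleftrightarrow> (\<exists>w. (\<forall>t\<in>{0..T}. w t \<in> L2 \<Omega>) \<and>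
     (\<forall>t\<in>{0..T}. ((\<lambda>s. l2_norm \<Omega> (\<lambda>x. w s x - w t x)) \<longlongrightarrow> 0) (at t within {0..T})) \<and>
     (AE (x, t) in leb (cyl \<Omega> T). W (x, t) = w t x) \<and> w 0 = g)"

definition initial_trace :: "'a::euclidean_space set \<Rightarrow> real \<Rightarrow>
    ('a \<times> real \<Rightarrow> real) \<Rightarrow> 'a \<Rightarrow> real" where
  "initial_trace \<Omega> T W = (SOME g. has_initial_trace \<Omega> T W g)"

definition bilin :: "'a::euclidean_space set \<Rightarrow> real \<Rightarrow> ('a \<Rightarrow> real) \<Rightarrow>
    ('a \<times> real \<Rightarrow> real) \<Rightarrow> ('a \<times> real \<Rightarrow> real) \<Rightarrow> real" where
  "bilin \<Omega> T c U W =
     l2_inner (cyl \<Omega> T) (dt \<Omega> T (dt \<Omega> T U)) (dt \<Omega> T W)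
   + l2_inner \<Omega> (initial_trace \<Omega> T (dt \<Omega> T U)) (initial_trace \<Omega> T (dt \<Omega> T W))
   + l2_inner (cyl \<Omega> T) (\<lambda>(x, t). (c x)\<^sup>2 *\<^sub>R grad_x \<Omega> T U (x, t)) (grad_x \<Omega> T (dt \<Omega> T W))"

definition LT :: "'a::euclidean_space set \<Rightarrow> real \<Rightarrow>
    ('a \<times> real \<Rightarrow> real) \<Rightarrow> 'a \<times> real \<Rightarrow> real" where
  "LT \<Omega> T W = (\<lambda>(x, t). LBINT s:{0<..<t}. exp (- s / T) * dt \<Omega> T W (x, s))"

definition V_norm :: "'a::euclidean_space set \<Rightarrow> real \<Rightarrow> ('a \<Rightarrow> real) \<Rightarrow>
    ('a \<times> real \<Rightarrow> real) \<Rightarrow> real" where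
  "V_norm \<Omega> T c U = sqrt ((l2_norm (cyl \<Omega> T) (dt \<Omega> T U))\<^sup>2
     + (l2_norm (cyl \<Omega> T) (\<lambda>(x, t). c x *\<^sub>R grad_x \<Omega> T U (x, t)))\<^sup>2)"

definition galerkin_solution :: "'a::euclidean_space set \<Rightarrow> real \<Rightarrow> ('a \<Rightarrow> real) \<Rightarrow>
    ('a \<times> real \<Rightarrow> real) set \<Rightarrow> ('a \<times> real \<Rightarrow> real) \<Rightarrow> ('a \<times> real \<Rightarrow> real) \<Rightarrow> bool" where
  "galerkin_solution \<Omega> T c Q F U \<longleftrightarrow> U \<in> Q \<and>
     (\<forall>W\<in>Q. bilin \<Omega> T c U (LT \<Omega> T W) = l2_inner (cyl \<Omega> T) F (dt \<Omega> T (LT \<Omega> T W)))"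

end

theory Submission
  imports Defs
begin

text \<open>
  Every element of the tensor product space is a finite sum of functions \<open>v(x) w(t)\<close> with
  \<open>w(t) = \<integral>\<^sub>0\<^sup>t r\<close> and \<open>r(t) = r(0) + \<integral>\<^sub>0\<^sup>t h\<close> (du Bois-Reymond), so all weak derivatives,
  traces and the operator \<open>L\<^sub>T\<close> act on it through explicit formulas, up to null sets. Integrating
  the derivative of \<open>e\<^bsup>-t/T\<^esup> (\<partial>\<^sub>t U)\<^sup>2\<close> and of \<open>e\<^bsup>-t/T\<^esup> |c \<nabla>U|\<^sup>2\<close> in time gives
  \<open>A(U, L\<^sub>T U) \<ge> \<parallel>U\<parallel>\<^sub>V\<^sup>2 / (2 e T)\<close>: the weight contributes \<open>1/(2T)\<close> times the weighted norm, the
  weight is at least \<open>1/e\<close>, the initial values of \<open>\<partial>\<^sub>t U\<close> are compensated by the second term of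
  \<open>A\<close>, and those of \<open>\<nabla>U\<close> vanish. In finite dimension this gives unique solvability, and testing
  with the solution itself gives the bound.
\<close>

section \<open>Test functions and uniqueness of weak derivatives\<close>

text \<open>The derivatives and the trace in the bilinear form are \<open>SOME\<close> choices, so
  nothing can be computed before uniqueness almost everywhere is known: the fundamental lemma of the
  calculus of variations gives it for weak derivatives, continuity in time gives it for the trace.
  Elements of the tensor space and their derivatives are themselves known only up to null sets; the
  formulas on the cylinder are therefore stated for any function that agrees almost everywhere with
  an explicit sum, and in this form they can be iterated. The spanning sets of the two factor spaces
  may be linearly dependent, so the coefficient matrix may be singular. Coercivity still forces the
  load vector to annihilate every coefficient vector whose quadratic form vanishes, which suffices
  for existence; two solutions then agree almost everywhere because their difference has zero time
  derivative and zero initial value. The right-hand side adds no constant to the bound: the time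
  derivative of L_T U is exp (- t / T) times that of U, and the weight is at most 1.\<close>

lemma Ck_const: "Ck k (\<lambda>x::'a::euclidean_space. a)"
  by (induction k arbitrary: a) simp_all

lemma Ck_Suc_D: "Ck (Suc k) f \<Longrightarrow> Ck k f"
proof (induction k arbitrary: f)
  case 0
  then show ?case
    by (auto simp: continuous_on_eq_continuous_within intro: differentiable_imp_continuous_within)
next
  case (Suc k)
  then show ?case by (metis Ck.simps(2))
qed

lemma Ck_continuous_on: "Ck k f \<Longrightarrow> continuous_on UNIV f"
  by (induction k) (simp, blast intro: Ck_Suc_D)

lemma Ck_add:
  fixes f g :: "'a::euclidean_space \<Rightarrow> real"
  shows "Ck k f \<Longrightarrow> Ck k g \<Longrightarrow> Ck k (\<lambda>x. f x + g x)"
proof (induction k arbitrary: f g)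
  case 0
  then show ?case by (simp add: continuous_on_add)
next
  case (Suc k)
  have "frechet_derivative (\<lambda>x. f x + g x) (at x) b
      = frechet_derivative f (at x) b + frechet_derivative g (at x) b" for x b
  proof -
    have "((\<lambda>x. f x + g x) has_derivative
        (\<lambda>b. frechet_derivative f (at x) b + frechet_derivative g (at x) b)) (at x)"
      using Suc.prems by (intro has_derivative_add) (auto simp flip: frechet_derivative_works)
    then show ?thesis by (metis frechet_derivative_at)
  qed
  then show ?case using Suc by simp
qed

lemma Ck_mult:
  fixes f g :: "'a::euclidean_space \<Rightarrow> real"
  shows "Ck k f \<Longrightarrow> Ck k g \<Longrightarrow> Ck k (\<lambda>x. f x * g x)"
proof (induction k arbitrary: f g)
  case 0
  then show ?case by (simp add: continuous_on_mult)
next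
  case (Suc k)
  have "frechet_derivative (\<lambda>x. f x * g x) (at x) b
      = f x * frechet_derivative g (at x) b + frechet_derivative f (at x) b * g x" for x b
  proof -
    have "((\<lambda>x. f x * g x) has_derivative
        (\<lambda>b. f x * frechet_derivative g (at x) b + frechet_derivative f (at x) b * g x)) (at x)"
      using Suc.prems by (intro has_derivative_mult) (auto simp flip: frechet_derivative_works)
    then show ?thesis by (simp flip: frechet_derivative_at)
  qed
  moreover have "Ck k (\<lambda>x. f x * frechet_derivative g (at x) b + frechet_derivative f (at x) b * g x)"
    if "b \<in> Basis" for b
    using Suc.prems that Ck_Suc_D[OF Suc.prems(1)] Ck_Suc_D[OF Suc.prems(2)]
    by (intro Ck_add Suc.IH) auto
  ultimately show ?case using Suc.prems by (simp add: differentiable_mult)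
qed

lemma Ck_diff:
  fixes f g :: "'a::euclidean_space \<Rightarrow> real"
  shows "Ck k f \<Longrightarrow> Ck k g \<Longrightarrow> Ck k (\<lambda>x. f x - g x)"
  using Ck_add[of k f "\<lambda>x. (- 1) * g x"] Ck_mult[OF Ck_const[of k "- 1"], of g] by simp

lemma Ck_prod:
  fixes f :: "'i \<Rightarrow> 'a::euclidean_space \<Rightarrow> real"
  assumes "\<And>i. i \<in> I \<Longrightarrow> Ck k (f i)"
  shows "Ck k (\<lambda>x. \<Prod>i\<in>I. f i x)"
  using assms
proof (induction I rule: infinite_finite_induct)
  case (insert i I)
  then show ?case by (simp add: Ck_mult)
qed (simp_all add: Ck_const)

text \<open>On the line the only basis vector is 1, so \<open>Ck\<close> reduces to the ordinary
  derivative. The equivalence is meant for bootstrapping: smoothness of a function is read off from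
  smoothness of its derivative.\<close>

lemma Ck_real_iff:
  fixes f :: "real \<Rightarrow> real"
  assumes "\<And>x. (f has_real_derivative f' x) (at x)"
  shows "Ck (Suc k) f \<longleftrightarrow> Ck k f'"
proof -
  have "frechet_derivative f (at x) = (*) (f' x)" for x
    using assms[of x] frechet_derivative_at unfolding has_field_derivative_def by metis
  moreover have "f differentiable at x" for x
    using assms[of x] real_differentiable_def by blast
  ultimately show ?thesis by simp
qed

lemma frechet_derivative_chain_affine:
  fixes g :: "'b::euclidean_space \<Rightarrow> real" and L :: "'a::euclidean_space \<Rightarrow> 'b"
  assumes "linear L" "g differentiable (at (p + L x))"
  shows "(\<lambda>x. g (p + L x)) differentiable (at x)"
    "frechet_derivative (\<lambda>x. g (p + L x)) (at x) b = frechet_derivative g (at (p + L x)) (L b)"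
proof -
  have "((\<lambda>x. p + L x) has_derivative L) (at x)"
    using assms(1) by (auto intro!: derivative_eq_intros linear_imp_has_derivative)
  from has_derivative_compose[OF this, of g "frechet_derivative g (at (p + L x))"]
  have d: "((\<lambda>x. g (p + L x)) has_derivative
      (\<lambda>b. frechet_derivative g (at (p + L x)) (L b))) (at x)"
    using assms(2) by (simp flip: frechet_derivative_works)
  show "(\<lambda>x. g (p + L x)) differentiable (at x)"
    using d by (rule differentiableI)
  show "frechet_derivative (\<lambda>x. g (p + L x)) (at x) b = frechet_derivative g (at (p + L x)) (L b)"
    using frechet_derivative_at[OF d] by metis
qed

lemma Ck_sum:
  fixes f :: "'i \<Rightarrow> 'a::euclidean_space \<Rightarrow> real"
  assumes "\<And>i. i \<in> I \<Longrightarrow> Ck k (f i)"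
  shows "Ck k (\<lambda>x. \<Sum>i\<in>I. f i x)"
  using assms
proof (induction I rule: infinite_finite_induct)
  case (insert i I)
  then show ?case by (simp add: Ck_add)
qed (simp_all add: Ck_const)

text \<open>\<open>Ck\<close> speaks of basis directions only. Linearity recovers all others, such
  as \<open>L b\<close> in the chain rule or the direction \<open>v\<close> of a weak
  derivative.\<close>

lemma frechet_derivative_Basis_sum:
  fixes g :: "'a::euclidean_space \<Rightarrow> real"
  assumes "g differentiable (at x)"
  shows "frechet_derivative g (at x) b = (\<Sum>i\<in>Basis. (b \<bullet> i) * frechet_derivative g (at x) i)"
proof -
  have lin: "linear (frechet_derivative g (at x))"
    using assms by (simp add: linear_frechet_derivative)
  have "frechet_derivative g (at x) b = frechet_derivative g (at x) (\<Sum>i\<in>Basis. (b \<bullet> i) *\<^sub>R i)"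
    by (simp add: euclidean_representation)
  also have "\<dots> = (\<Sum>i\<in>Basis. (b \<bullet> i) * frechet_derivative g (at x) i)"
    using lin by (simp add: linear_sum linear_cmul)
  finally show ?thesis .
qed

text \<open>By the chain rule the partial derivatives of the composition are constant combinations
  of those of \<open>g\<close>, composed with the same affine map, so the induction closes. It
  serves the factors of \<open>box_bump\<close> and the slices of test functions on a
  product.\<close>

lemma Ck_compose_affine:
  fixes g :: "'b::euclidean_space \<Rightarrow> real" and L :: "'a::euclidean_space \<Rightarrow> 'b"
  assumes "linear L"
  shows "Ck k g \<Longrightarrow> Ck k (\<lambda>x. g (p + L x))"
proof (induction k arbitrary: g)
  case 0
  have "continuous_on UNIV (\<lambda>x. p + L x)"
    using assms by (intro continuous_intros linear_continuous_on) (simp add: linear_conv_bounded_linear)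
  with 0 show ?case
    by (auto intro: continuous_on_compose2)
next
  case (Suc k)
  have "frechet_derivative (\<lambda>x. g (p + L x)) (at x) b
      = (\<Sum>i\<in>Basis. (L b \<bullet> i) * frechet_derivative g (at (p + L x)) i)" for x b
    using Suc.prems frechet_derivative_chain_affine(2)[OF assms]
      frechet_derivative_Basis_sum[of g "p + L x" "L b"] by simp
  moreover have "Ck k (\<lambda>x. \<Sum>i\<in>Basis. (L b \<bullet> i) * frechet_derivative g (at (p + L x)) i)" for b
    using Suc.prems by (intro Ck_sum Ck_mult Ck_const Suc.IH) auto
  ultimately show ?case
    using Suc.prems frechet_derivative_chain_affine(1)[OF assms] by simp
qed

text \<open>The family of all \<open>p(1/t) e\<^bsup>-1/t\<^esup>\<close> is closed under differentiation, which makes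
  smoothness a simple induction.\<close>

definition exp_bump :: "real poly \<Rightarrow> real \<Rightarrow> real" where
  "exp_bump p t = (if t > 0 then poly p (inverse t) * exp (- inverse t) else 0)"

lemma exp_bump_tendsto_0: "(exp_bump p \<longlongrightarrow> 0) (at_right 0)"
proof -
  have "((\<lambda>y. \<Sum>i\<le>degree p. coeff p i * (y ^ i / exp y)) \<longlongrightarrow> 0) at_top"
    by (intro tendsto_null_sum tendsto_mult_right_zero tendsto_power_div_exp_0)
  then have "((\<lambda>y. poly p y * exp (- y)) \<longlongrightarrow> 0) at_top"
    by (simp add: poly_altdef exp_minus sum_distrib_right divide_inverse mult.assoc)
  then have "((\<lambda>t. poly p (inverse t) * exp (- inverse t)) \<longlongrightarrow> 0) (at_right 0)"
    by (rule filterlim_compose[OF _ filterlim_inverse_at_top_right])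
  moreover have "\<forall>\<^sub>F t in at_right 0. exp_bump p t = poly p (inverse t) * exp (- inverse t)"
    by (auto simp: eventually_at_filter exp_bump_def)
  ultimately show ?thesis by (simp add: filterlim_cong)
qed

text \<open>With y = 1/t, differentiating p(y) exp(-y) in t gives y^2 (p(y) - p'(y)) exp(-y), and
  \<open>[:0, 0, 1:]\<close> is the polynomial y^2.\<close>

lemma exp_bump_has_derivative:
  "(exp_bump p has_real_derivative exp_bump ([:0, 0, 1:] * (p - pderiv p)) t) (at t)"
proof -
  consider "t > 0" | "t < 0" | "t = 0" by linarith
  then show ?thesis
  proof cases
    case 1
    have "((\<lambda>t. poly p (inverse t) * exp (- inverse t)) has_real_derivative
       exp_bump ([:0, 0, 1:] * (p - pderiv p)) t) (at t)"
      using 1 by (auto intro!: derivative_eq_intros poly_DERIV[THEN DERIV_chain2]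
          simp: exp_bump_def algebra_simps power2_eq_square)
    then show ?thesis
      by (rule has_field_derivative_transform_within_open[of _ _ _ "{0<..}"])
        (use 1 in \<open>auto simp: exp_bump_def\<close>)
  next
    case 2
    have "((\<lambda>t. 0) has_real_derivative exp_bump ([:0, 0, 1:] * (p - pderiv p)) t) (at t)"
      using 2 by (auto simp: exp_bump_def)
    then show ?thesis
      by (rule has_field_derivative_transform_within_open[of _ _ _ "{..<0}"])
        (use 2 in \<open>auto simp: exp_bump_def\<close>)
  next
    case 3
    \<comment> \<open>Dividing by h multiplies the polynomial by its variable 1/h, so for h > 0 the
      quotient is \<open>exp_bump (pCons 0 p) h\<close>.\<close>
    have "((\<lambda>h. (exp_bump p (0 + h) - exp_bump p 0) / h) \<longlongrightarrow> 0) (at_right 0)"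
      by (rule Lim_transform_eventually[OF exp_bump_tendsto_0[of "pCons 0 p"]])
        (auto simp: eventually_at_filter exp_bump_def field_simps)
    moreover have "((\<lambda>h. (exp_bump p (0 + h) - exp_bump p 0) / h) \<longlongrightarrow> 0) (at_left 0)"
      by (rule tendsto_eventually) (auto simp: eventually_at_filter exp_bump_def)
    ultimately show ?thesis
      using 3 by (simp add: DERIV_def filterlim_split_at exp_bump_def)
  qed
qed

lemma Ck_exp_bump: "Ck k (exp_bump p)"
proof (induction k arbitrary: p)
  case 0
  show ?case
    by (auto intro: continuous_at_imp_continuous_on DERIV_isCont exp_bump_has_derivative)
next
  case (Suc k)
  then show ?case by (simp only: Ck_real_iff[OF exp_bump_has_derivative])
qed

text \<open>As \<open>n\<close> grows, the factors \<open>e\<^bsup>-1/((n+1)s)\<^esup>\<close> increase to 1, so these test functions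
  converge to the indicator of the box, and no mollification is needed.\<close>

definition box_bump :: "nat \<Rightarrow> 'a::euclidean_space \<Rightarrow> 'a \<Rightarrow> 'a \<Rightarrow> real" where
  "box_bump n p q x = (\<Prod>i\<in>Basis. exp_bump 1 (real (Suc n) * ((x - p) \<bullet> i))
     * exp_bump 1 (real (Suc n) * ((q - x) \<bullet> i)))"

lemma Ck_box_bump: "Ck k (box_bump n p q)"
proof -
  have *: "Ck k (\<lambda>x::'a. exp_bump 1 (\<alpha> + x \<bullet> j))" for \<alpha> j
    by (rule Ck_compose_affine[OF _ Ck_exp_bump])
      (simp add: bounded_linear.linear bounded_linear_inner_left)
  \<comment> \<open>Each factor is put into the form
    \<open>exp_bump 1 (\<alpha> + x \<bullet> j)\<close>, with the scaling and the sign moved into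
    \<open>j\<close>.\<close>
  have "Ck k (\<lambda>x. \<Prod>i\<in>Basis. exp_bump 1 (- real (Suc n) * (p \<bullet> i) + x \<bullet> (real (Suc n) *\<^sub>R i))
      * exp_bump 1 (real (Suc n) * (q \<bullet> i) + x \<bullet> (- real (Suc n) *\<^sub>R i)))"
    by (intro Ck_prod Ck_mult *)
  then show ?thesis
    unfolding box_bump_def by (simp add: algebra_simps)
qed

lemma exp_bump_1: "0 \<le> exp_bump 1 t" "exp_bump 1 t \<le> 1" "exp_bump 1 t = 0 \<longleftrightarrow> t \<le> 0"
  by (auto simp: exp_bump_def)

lemma exp_bump_tendsto_indicator:
  "(\<lambda>n. exp_bump 1 (real (Suc n) * t)) \<longlonglongrightarrow> indicator {0<..} t"
proof (cases "t > 0")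
  case True
  have "(\<lambda>n. exp (- (inverse (real (Suc n)) * inverse t))) \<longlonglongrightarrow> exp (- (0 * inverse t))"
    by (intro tendsto_intros LIMSEQ_inverse_real_of_nat)
  with True show ?thesis by (simp add: exp_bump_def del: of_nat_Suc)
qed (auto simp: exp_bump_def zero_less_mult_iff simp del: of_nat_Suc)

lemma box_bump_bounds: "0 \<le> box_bump n p q x" "box_bump n p q x \<le> indicator (box p q) x"
proof -
  show "0 \<le> box_bump n p q x"
    unfolding box_bump_def by (intro prod_nonneg mult_nonneg_nonneg exp_bump_1)
  have "box_bump n p q x \<le> 1"
    unfolding box_bump_def by (intro prod_le_1 conjI mult_nonneg_nonneg mult_le_one exp_bump_1)
  moreover have "box_bump n p q x = 0" if "x \<notin> box p q"
    using that unfolding box_bump_def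
    by (force simp: mem_box exp_bump_1 inner_diff_left mult_le_0_iff not_less)
  ultimately show "box_bump n p q x \<le> indicator (box p q) x"
    by (auto simp: indicator_def)
qed

lemma box_bump_tendsto: "(\<lambda>n. box_bump n p q x) \<longlonglongrightarrow> indicator (box p q) x"
proof -
  have "(\<lambda>n. box_bump n p q x) \<longlonglongrightarrow>
      (\<Prod>i\<in>Basis. indicator {0<..} ((x - p) \<bullet> i) * indicator {0<..} ((q - x) \<bullet> i))"
    unfolding box_bump_def by (intro tendsto_prod tendsto_mult exp_bump_tendsto_indicator)
  also have "(\<Prod>i\<in>Basis. indicator {0<..} ((x - p) \<bullet> i) * indicator {0<..} ((q - x) \<bullet> i))
      = (indicator (box p q) x :: real)"
  proof (cases "x \<in> box p q")
    case True
    then show ?thesis by (auto simp: mem_box inner_diff_left intro!: prod.neutral)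
  next
    case False
    then show ?thesis
      by (auto simp: mem_box inner_diff_left not_less indicator_def intro!: prod_zero
          simp del: prod_zero_iff)
  qed
  finally show ?thesis .
qed

lemma test_function_box_bump:
  assumes "cbox p q \<subseteq> S"
  shows "test_function S (box_bump n p q)"
proof -
  have "{x. box_bump n p q x \<noteq> 0} \<subseteq> cbox p q"
  proof
    fix x assume "x \<in> {x. box_bump n p q x \<noteq> 0}"
    with box_bump_bounds[of n p q x] have "x \<in> box p q"
      by (cases "x \<in> box p q") (auto simp: indicator_def)
    then show "x \<in> cbox p q" using box_subset_cbox by blast
  qed
  then have "closure {x. box_bump n p q x \<noteq> 0} \<subseteq> cbox p q"
    by (rule closure_minimal) (rule closed_cbox)
  moreover from this have "compact (closure {x. box_bump n p q x \<noteq> 0})"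
    using bounded_subset[OF bounded_cbox] by (simp add: compact_eq_bounded_closed)
  ultimately show ?thesis
    using assms Ck_box_bump unfolding test_function_def by blast
qed

section \<open>Support and boundedness of test functions, and integrals against them\<close>

lemma test_function_continuous_on: "test_function S \<phi> \<Longrightarrow> continuous_on A \<phi>"
  using Ck_continuous_on continuous_on_subset unfolding test_function_def by blast

lemma test_function_eq_0: "test_function S \<phi> \<Longrightarrow> x \<notin> S \<Longrightarrow> \<phi> x = 0"
  using closure_subset[of "{x. \<phi> x \<noteq> 0}"] unfolding test_function_def by blast

lemma test_function_differentiable: "test_function S \<phi> \<Longrightarrow> \<phi> differentiable (at x)"
  unfolding test_function_def by (metis Ck.simps(2))

text \<open>In \<open>has_weak_deriv\<close> the function is paired with a derivative of \<phi>.
  Since that derivative is again a test function, one integrability lemma covers both sides of the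
  identity.\<close>

lemma test_function_frechet_derivative:
  assumes "test_function S \<phi>"
  shows "test_function S (\<lambda>x. frechet_derivative \<phi> (at x) v)"
proof -
  let ?D = "\<lambda>x. frechet_derivative \<phi> (at x) v"
  have "Ck k ?D" for k
  proof -
    have "Ck k (\<lambda>x. \<Sum>i\<in>Basis. (v \<bullet> i) * frechet_derivative \<phi> (at x) i)"
      using assms unfolding test_function_def by (intro Ck_sum Ck_mult Ck_const) (metis Ck.simps(2))
    then show ?thesis
      by (subst frechet_derivative_Basis_sum[OF test_function_differentiable[OF assms]])
  qed
  \<comment> \<open>Off the closed support \<phi> vanishes on an open set, and so does its
    derivative.\<close>
  moreover have "{x. ?D x \<noteq> 0} \<subseteq> closure {x. \<phi> x \<noteq> 0}"
  proof (rule subsetI, rule ccontr)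
    fix x assume x: "x \<in> {x. ?D x \<noteq> 0}" "x \<notin> closure {x. \<phi> x \<noteq> 0}"
    have "(\<phi> has_derivative (\<lambda>_. 0)) (at x)"
      by (rule has_derivative_transform_within_open[of "\<lambda>_. 0" _ _ _ "- closure {x. \<phi> x \<noteq> 0}"])
        (use x(2) closure_subset[of "{x. \<phi> x \<noteq> 0}"] in auto)
    then have "?D x = 0" by (metis frechet_derivative_at)
    with x(1) show False by simp
  qed
  then have sub: "closure {x. ?D x \<noteq> 0} \<subseteq> closure {x. \<phi> x \<noteq> 0}"
    by (rule closure_minimal) simp
  moreover from this have "compact (closure {x. ?D x \<noteq> 0})"
    using assms bounded_subset by (auto simp: compact_eq_bounded_closed test_function_def)
  ultimately show ?thesis
    using assms unfolding test_function_def by blast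
qed

lemma test_function_bounded:
  assumes "test_function S \<phi>"
  obtains K where "\<And>x. \<bar>\<phi> x\<bar> \<le> K"
proof -
  let ?C = "closure {x. \<phi> x \<noteq> 0}"
  have "compact (\<phi> ` ?C)"
    using assms unfolding test_function_def
    by (auto intro: compact_continuous_image test_function_continuous_on[OF assms])
  then obtain K where K: "\<forall>x\<in>?C. \<bar>\<phi> x\<bar> \<le> K"
    using compact_imp_bounded bounded_iff by (metis (no_types, lifting) image_eqI real_norm_def)
  have "\<bar>\<phi> x\<bar> \<le> max K 0" for x
  proof (cases "x \<in> ?C")
    case False
    then have "\<phi> x = 0" using closure_subset[of "{x. \<phi> x \<noteq> 0}"] by blast
    then show ?thesis by simp
  qed (use K in auto)
  then show ?thesis by (rule that)
qed

text \<open>A bounded factor multiplies a function that is integrable on the compact support. Linear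
  manipulations of these integrals depend on it, because a nonintegrable integrand has integral 0 by
  convention.\<close>

lemma integrable_locally_integrable_mult_test:
  assumes "open S" "locally_integrable S f" "test_function S \<phi>"
  shows "integrable (leb S) (\<lambda>x. f x * \<phi> x)"
proof -
  let ?C = "closure {x. \<phi> x \<noteq> 0}"
  have C: "compact ?C" "?C \<subseteq> S" using assms(3) by (auto simp: test_function_def)
  have S: "S \<in> sets lborel" using assms(1) by simp
  obtain K where K: "\<And>x. \<bar>\<phi> x\<bar> \<le> K" using test_function_bounded[OF assms(3)] by blast
  have K0: "0 \<le> K" using K[of undefined] by linarith
  have "set_integrable lborel ?C f"
    using assms(2) C by (simp add: locally_integrable_def)
  then have i: "integrable lborel (\<lambda>x. K * (indicator ?C x *\<^sub>R f x))"
    by (simp add: set_integrable_def)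
  have "f \<in> borel_measurable (leb S)" using assms(2) by (simp add: locally_integrable_def)
  then have m: "(\<lambda>x. indicator S x *\<^sub>R f x) \<in> borel_measurable lborel"
    using S by (simp add: borel_measurable_restrict_space_iff)
  have mp: "\<phi> \<in> borel_measurable lborel"
    using test_function_continuous_on[OF assms(3)] by (simp add: borel_measurable_continuous_onI)
  have "integrable lborel (\<lambda>x. indicator S x *\<^sub>R f x * \<phi> x)"
  proof (rule Bochner_Integration.integrable_bound[OF i])
    show "(\<lambda>x. indicator S x *\<^sub>R f x * \<phi> x) \<in> borel_measurable lborel"
      using m mp by measurable
    show "AE x in lborel. norm (indicator S x *\<^sub>R f x * \<phi> x) \<le> norm (K * (indicator ?C x *\<^sub>R f x))"
    proof (rule AE_I2)
      fix x
      show "norm (indicator S x *\<^sub>R f x * \<phi> x) \<le> norm (K * (indicator ?C x *\<^sub>R f x))"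
      proof (cases "\<phi> x = 0")
        case False
        then have "x \<in> ?C" using closure_subset[of "{x. \<phi> x \<noteq> 0}"] by blast
        then show ?thesis
          using C(2) K0 mult_right_mono[OF K[of x], of "\<bar>f x\<bar>"]
          by (auto simp: abs_mult mult.commute[of "\<bar>f x\<bar>"])
      qed simp
    qed
  qed
  then show ?thesis
    using S by (simp add: integrable_restrict_space mult.assoc)
qed

section \<open>The fundamental lemma of the calculus of variations and uniqueness of weak
  derivatives\<close>

lemma integral_box_bump_tendsto:
  assumes "open S" "locally_integrable S f" "cbox p q \<subseteq> S"
  shows "set_integrable lborel (box p q) f"
    and "(\<lambda>n. \<integral>x. f x * box_bump n p q x \<partial>leb S) \<longlonglongrightarrow> (LBINT x:box p q. f x)"
proof -
  have S: "S \<in> sets lborel" using assms(1) by simp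
  have "set_integrable lborel (cbox p q) f"
    using assms(2,3) by (simp add: locally_integrable_def)
  then show i: "set_integrable lborel (box p q) f"
    by (rule set_integrable_subset) (auto simp: box_subset_cbox)
  have bS: "box p q \<subseteq> S" using assms(3) box_subset_cbox by blast
  have "f \<in> borel_measurable (leb S)" using assms(2) by (simp add: locally_integrable_def)
  then have m: "(\<lambda>x. indicator S x *\<^sub>R f x) \<in> borel_measurable lborel"
    using S by (simp add: borel_measurable_restrict_space_iff)
  have mb: "box_bump n p q \<in> borel_measurable lborel" for n
    using test_function_continuous_on[OF test_function_box_bump[OF assms(3)]]
    by (simp add: borel_measurable_continuous_onI)
  have "(\<lambda>n. \<integral>x. indicator S x *\<^sub>R f x * box_bump n p q x \<partial>lborel)
      \<longlonglongrightarrow> (\<integral>x. indicator (box p q) x *\<^sub>R f x \<partial>lborel)"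
  \<comment> \<open>Every bump lies below the indicator of the box, so the absolute value of
    \<open>f\<close> on the box dominates.\<close>
  proof (rule integral_dominated_convergence[where w = "\<lambda>x. norm (indicator (box p q) x *\<^sub>R f x)"])
    show "(\<lambda>x. indicator (box p q) x *\<^sub>R f x) \<in> borel_measurable lborel"
      using i unfolding set_integrable_def by (rule borel_measurable_integrable)
    show "(\<lambda>x. indicator S x *\<^sub>R f x * box_bump n p q x) \<in> borel_measurable lborel" for n
      using m mb by measurable
    show "integrable lborel (\<lambda>x. norm (indicator (box p q) x *\<^sub>R f x))"
      using i unfolding set_integrable_def by (rule integrable_norm)
    show "AE x in lborel. (\<lambda>n. indicator S x *\<^sub>R f x * box_bump n p q x) \<longlonglongrightarrow> indicator (box p q) x *\<^sub>R f x"
    proof (rule AE_I2)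
      fix x
      have "(\<lambda>n. indicator S x *\<^sub>R f x * box_bump n p q x) \<longlonglongrightarrow> indicator S x *\<^sub>R f x * indicator (box p q) x"
        by (intro tendsto_intros box_bump_tendsto)
      then show "(\<lambda>n. indicator S x *\<^sub>R f x * box_bump n p q x) \<longlonglongrightarrow> indicator (box p q) x *\<^sub>R f x"
        using bS by (cases "x \<in> box p q") auto
    qed
    show "AE x in lborel. norm (indicator S x *\<^sub>R f x * box_bump n p q x)
        \<le> norm (indicator (box p q) x *\<^sub>R f x)" for n
    proof (rule AE_I2)
      fix x
      show "norm (indicator S x *\<^sub>R f x * box_bump n p q x) \<le> norm (indicator (box p q) x *\<^sub>R f x)"
        using box_bump_bounds[of n p q x] mult_left_le[of "box_bump n p q x" "\<bar>f x\<bar>"]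
        by (auto simp: abs_mult indicator_def split: if_splits)
    qed
  qed
  then show "(\<lambda>n. \<integral>x. f x * box_bump n p q x \<partial>leb S) \<longlonglongrightarrow> (LBINT x:box p q. f x)"
    using S by (simp add: integral_restrict_space set_lebesgue_integral_def mult.assoc)
qed

text \<open>Boxes are stable under intersection and generate the Borel sets, while the sets over
  which \<open>f\<close> integrates to 0 form a Dynkin system; closure under complements uses that
  the total integral is 0.\<close>

lemma AE_zero_if_box_integrals_zero:
  fixes f :: "'a::euclidean_space \<Rightarrow> real"
  assumes f: "integrable lborel f" "integral\<^sup>L lborel f = 0"
    and box: "\<And>p q. (LBINT x:box p q. f x) = 0"
  shows "AE x in lborel. f x = 0"
proof (rule sigma_finite_measure.density_zero[OF lborel.sigma_finite_measure_axioms f(1)])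
  let ?G = "range (\<lambda>(a, b). box a b :: 'a set)"
  have si: "set_integrable lborel A f" if "A \<in> sets borel" for A
    unfolding set_integrable_def using integrable_mult_indicator[OF _ f(1)] that by simp
  have sets: "sigma_sets UNIV ?G = sets borel"
    by (subst borel_eq_box) simp
  fix A :: "'a set" assume "A \<in> sets lborel"
  then have A: "A \<in> sigma_sets UNIV ?G" using sets by simp
  have "Int_stable ?G"
    by (force simp: Int_stable_def box_Int_box)
  moreover have "?G \<subseteq> Pow UNIV" by simp
  ultimately show "(LBINT x:A. f x) = 0"
    using A
  proof (induction rule: sigma_sets_induct_disjoint)
    case (basic A)
    then show ?case using box by auto
  next
    case empty
    then show ?case by (simp add: set_lebesgue_integral_def)
  next
    case (compl A)
    then have A: "A \<in> sets borel" "UNIV - A \<in> sets borel" using sets by auto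
    have "(LBINT x:A \<union> (UNIV - A). f x) = (LBINT x:A. f x) + (LBINT x:UNIV - A. f x)"
      by (rule set_integral_Un) (auto intro: si A)
    then show ?case using compl f(2) by (simp add: set_lebesgue_integral_def)
  next
    case (union A)
    then have "(LBINT x:(\<Union>i. A i). f x) = (\<Sum>i. (LBINT x:(A i). f x))"
      using sets by (intro lebesgue_integral_countable_add) (auto simp: disjoint_family_on_def intro!: si)
    then show ?case using union by simp
  qed
qed

text \<open>The bumps give vanishing integrals over all boxes whose closed box lies in
  \<open>S\<close>. As \<open>f\<close> is only locally integrable, the measure argument runs inside
  one such box at a time, and countably many of them cover \<open>S\<close>.\<close>

lemma AE_zero_if_test_integrals_zero:
  fixes f :: "'a::euclidean_space \<Rightarrow> real"
  assumes S: "open S" and f: "locally_integrable S f"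
    and test: "\<And>\<phi>. test_function S \<phi> \<Longrightarrow> (\<integral>x. f x * \<phi> x \<partial>leb S) = 0"
  shows "AE x in leb S. f x = 0"
proof -
  have box0: "(LBINT x:box p q. f x) = 0" if "cbox p q \<subseteq> S" for p q
    using integral_box_bump_tendsto(2)[OF S f that] test[OF test_function_box_bump[OF that]]
    by (simp add: LIMSEQ_const_iff)
  have local0: "AE x in lborel. x \<in> box p q \<longrightarrow> f x = 0" if pq: "cbox p q \<subseteq> S" for p q
  proof -
    let ?g = "\<lambda>x. indicator (box p q) x *\<^sub>R f x"
    have "AE x in lborel. ?g x = 0"
    proof (rule AE_zero_if_box_integrals_zero)
      show "integrable lborel ?g"
        using integral_box_bump_tendsto(1)[OF S f pq] by (simp add: set_integrable_def)
      show "integral\<^sup>L lborel ?g = 0"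
        using box0[OF pq] by (simp add: set_lebesgue_integral_def)
      fix a b
      \<comment> \<open>After cutting \<open>f\<close> off to \<open>box p q\<close>, an integral
        over an arbitrary box is one over a sub-box, where \<open>box0\<close> applies.\<close>
      obtain c d where cd: "box a b \<inter> box p q = box c d"
        by (simp add: box_Int_box)
      have "(LBINT x:box a b. ?g x) = (LBINT x:box c d. f x)"
        unfolding set_lebesgue_integral_def by (simp flip: cd add: indicator_inter_arith mult.assoc)
      also have "\<dots> = 0"
      proof (cases "box c d = {}")
        case False
        then have "cbox c d \<subseteq> cbox p q"
          using cd by (metis closure_box closure_mono box_subset_cbox closed_cbox closure_minimal inf_le2 subset_trans)
        then show ?thesis using box0 pq by blast
      qed (simp add: set_lebesgue_integral_def)
      finally show "(LBINT x:box a b. ?g x) = 0" .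
    qed
    then show ?thesis by eventually_elim (auto split: split_indicator_asm)
  qed
  \<comment> \<open>A countable subcover keeps the union of the exceptional sets null.\<close>
  obtain \<D> where D: "\<D> \<subseteq> {box p q |p q. cbox p q \<subseteq> S}" "countable \<D>"
      "\<Union>\<D> = \<Union>{box p q |p q. cbox p q \<subseteq> S}"
    using Lindelof[of "{box p q |p q. cbox p q \<subseteq> S}"] by (auto simp: open_box)
  have cover: "S \<subseteq> \<Union>\<D>"
  proof
    fix x assume "x \<in> S"
    from open_contains_cbox[OF S this] obtain p q where "cbox p q \<subseteq> S" "x \<in> box p q"
      by metis
    then show "x \<in> \<Union>\<D>" unfolding D(3) by blast
  qed
  have "AE x in lborel. x \<in> X \<longrightarrow> f x = 0" if "X \<in> \<D>" for X
    using that D(1) local0 by auto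
  then have "AE x in lborel. \<forall>X\<in>\<D>. x \<in> X \<longrightarrow> f x = 0"
    unfolding AE_ball_countable[OF D(2)] by blast
  then have "AE x in lborel. x \<in> S \<longrightarrow> f x = 0"
    by eventually_elim (use cover in blast)
  then show ?thesis using S by (simp add: AE_restrict_space_iff)
qed

lemma locally_integrable_diff:
  assumes "locally_integrable S f" "locally_integrable S g"
  shows "locally_integrable S (\<lambda>x. f x - g x)"
  using assms unfolding locally_integrable_def
  by (blast intro: set_integral_diff(1) borel_measurable_diff)

text \<open>This makes the \<open>SOME\<close> in \<open>weak_deriv\<close> harmless: the chosen
  function agrees almost everywhere with any weak derivative exhibited by hand.\<close>

lemma has_weak_deriv_unique:
  assumes S: "open S" and "has_weak_deriv S v f g" "has_weak_deriv S v f h"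
  shows "AE x in leb S. g x = h x"
proof -
  have li: "locally_integrable S g" "locally_integrable S h"
    using assms by (auto simp: has_weak_deriv_def)
  have "AE x in leb S. g x - h x = 0"
  proof (rule AE_zero_if_test_integrals_zero[OF S])
    fix \<phi> :: "'a \<Rightarrow> real" assume t: "test_function S \<phi>"
    have "(\<integral>x. g x * \<phi> x \<partial>leb S) = (\<integral>x. h x * \<phi> x \<partial>leb S)"
      using assms(2,3) t unfolding has_weak_deriv_def by (metis minus_equation_iff)
    moreover have "(\<integral>x. (g x - h x) * \<phi> x \<partial>leb S)
        = (\<integral>x. g x * \<phi> x \<partial>leb S) - (\<integral>x. h x * \<phi> x \<partial>leb S)"
      unfolding left_diff_distrib
      by (intro Bochner_Integration.integral_diff integrable_locally_integrable_mult_test S li t)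
    ultimately show "(\<integral>x. (g x - h x) * \<phi> x \<partial>leb S) = 0" by simp
  qed (intro locally_integrable_diff li)
  then show ?thesis by eventually_elim simp
qed

lemma weak_deriv_works:
  "has_weak_deriv S v f g \<Longrightarrow> has_weak_deriv S v f (weak_deriv S v f)"
  by (simp only: weak_deriv_def someI[of "has_weak_deriv S v f"])

lemma weak_deriv_AE:
  "open S \<Longrightarrow> has_weak_deriv S v f g \<Longrightarrow> AE x in leb S. weak_deriv S v f x = g x"
  by (rule has_weak_deriv_unique[OF _ weak_deriv_works])

lemma weak_deriv_measurable:
  "has_weak_deriv S v f g \<Longrightarrow> weak_deriv S v f \<in> borel_measurable (leb S)"
  by (drule weak_deriv_works) (simp only: has_weak_deriv_def locally_integrable_def)

lemma locally_integrable_cong_AE: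
  assumes S: "open S" and f: "locally_integrable S f" and g: "g \<in> borel_measurable (leb S)"
    and eq: "AE x in leb S. f x = g x"
  shows "locally_integrable S g"
  unfolding locally_integrable_def
proof (intro conjI allI impI g)
  fix K assume K: "compact K \<and> K \<subseteq> S"
  have S': "S \<in> sets lborel" using S by simp
  have gm: "(\<lambda>x. indicator S x *\<^sub>R g x) \<in> borel_measurable lborel"
    using g S' by (simp add: borel_measurable_restrict_space_iff)
  have "(\<lambda>x. indicator K x *\<^sub>R (indicator S x *\<^sub>R g x)) \<in> borel_measurable lborel"
    by (rule borel_measurable_scaleR[OF _ gm])
      (use K in \<open>auto intro: borel_measurable_indicator borel_closed compact_imp_closed\<close>)
  moreover have "(\<lambda>x. indicator K x *\<^sub>R (indicator S x *\<^sub>R g x)) = (\<lambda>x. indicator K x *\<^sub>R g x)"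
    using K by (auto simp: fun_eq_iff split: split_indicator)
  ultimately have gm': "(\<lambda>x. indicator K x *\<^sub>R g x) \<in> borel_measurable lborel" by simp
  have "set_integrable lborel K f" using f K by (simp add: locally_integrable_def)
  moreover have "AE x in lborel. indicator K x *\<^sub>R f x = indicator K x *\<^sub>R g x"
    using eq S' K by (auto simp: AE_restrict_space_iff indicator_def elim!: eventually_mono)
  ultimately show "set_integrable lborel K g"
    unfolding set_integrable_def using gm' by (subst integrable_cong_AE[symmetric]) auto
qed

text \<open>Elements of the tensor space and the outputs of \<open>dt\<close> and \<open>LT\<close>
  equal explicit sums only almost everywhere, so weak derivatives have to pass between
  representatives of a class.\<close>

lemma has_weak_deriv_cong_AE:
  assumes S: "open S" and "has_weak_deriv S v f h" and g: "g \<in> borel_measurable (leb S)"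
    and eq: "AE x in leb S. f x = g x"
  shows "has_weak_deriv S v g h"
proof -
  have fl: "locally_integrable S f" using assms(2) by (simp add: has_weak_deriv_def)
  then have gl: "locally_integrable S g" using locally_integrable_cong_AE assms by blast
  have "(\<integral>x. f x * frechet_derivative \<phi> (at x) v \<partial>leb S)
      = (\<integral>x. g x * frechet_derivative \<phi> (at x) v \<partial>leb S)" if "test_function S \<phi>" for \<phi>
  proof (rule integral_cong_AE)
    note t = integrable_locally_integrable_mult_test[OF S _ test_function_frechet_derivative[OF that], of _ v]
    show "(\<lambda>x. f x * frechet_derivative \<phi> (at x) v) \<in> borel_measurable (leb S)"
      "(\<lambda>x. g x * frechet_derivative \<phi> (at x) v) \<in> borel_measurable (leb S)"
      using t fl gl by auto
    show "AE x in leb S. f x * frechet_derivative \<phi> (at x) v = g x * frechet_derivative \<phi> (at x) v"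
      using eq by eventually_elim simp
  qed
  then show ?thesis using assms(2) gl by (simp add: has_weak_deriv_def)
qed

lemma has_weak_deriv_sum:
  assumes S: "open S" and d: "\<And>i. i \<in> I \<Longrightarrow> has_weak_deriv S v (f i) (g i)"
  shows "has_weak_deriv S v (\<lambda>x. \<Sum>i\<in>I. a i * f i x) (\<lambda>x. \<Sum>i\<in>I. a i * g i x)"
proof -
  have li: "locally_integrable S (f i)" "locally_integrable S (g i)" if "i \<in> I" for i
    using d[OF that] by (auto simp: has_weak_deriv_def)
  have sum: "locally_integrable S (\<lambda>x. \<Sum>i\<in>I. a i * h i x)"
    if "\<And>i. i \<in> I \<Longrightarrow> locally_integrable S (h i)" for h
  proof -
    have "set_integrable lborel K (\<lambda>x. \<Sum>i\<in>I. a i * h i x)" if "compact K" "K \<subseteq> S" for K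
      using \<open>\<And>i. i \<in> I \<Longrightarrow> locally_integrable S (h i)\<close> that
      unfolding locally_integrable_def set_integrable_def scaleR_sum_right
      by (intro Bochner_Integration.integrable_sum) (auto simp: mult.left_commute)
    then show ?thesis
      using that unfolding locally_integrable_def by (auto intro!: borel_measurable_sum borel_measurable_times)
  qed
  have "(\<integral>x. (\<Sum>i\<in>I. a i * f i x) * frechet_derivative \<phi> (at x) v \<partial>leb S)
      = - (\<integral>x. (\<Sum>i\<in>I. a i * g i x) * \<phi> x \<partial>leb S)" if t: "test_function S \<phi>" for \<phi>
  proof -
    have "(\<integral>x. (\<Sum>i\<in>I. a i * f i x) * frechet_derivative \<phi> (at x) v \<partial>leb S)
        = (\<Sum>i\<in>I. a i * (\<integral>x. f i x * frechet_derivative \<phi> (at x) v \<partial>leb S))"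
      using integrable_locally_integrable_mult_test[OF S li(1) test_function_frechet_derivative[OF t], of _ v]
      by (simp add: sum_distrib_right mult.assoc Bochner_Integration.integral_sum)
    also have "\<dots> = - (\<Sum>i\<in>I. a i * (\<integral>x. g i x * \<phi> x \<partial>leb S))"
      using d t by (simp add: has_weak_deriv_def sum_negf)
    also have "(\<Sum>i\<in>I. a i * (\<integral>x. g i x * \<phi> x \<partial>leb S)) = (\<integral>x. (\<Sum>i\<in>I. a i * g i x) * \<phi> x \<partial>leb S)"
      using integrable_locally_integrable_mult_test[OF S li(2) t]
      by (simp add: sum_distrib_right mult.assoc Bochner_Integration.integral_sum)
    finally show ?thesis .
  qed
  then show ?thesis
    unfolding has_weak_deriv_def using sum li by blast
qed

section \<open>Square integrable functions\<close>

text \<open>Opens the cylinder to Fubini arguments. The factors are sigma-finite, so agreement on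
  measurable rectangles determines the product measure.\<close>

lemma leb_Times:
  fixes A :: "'a::euclidean_space set" and B :: "'b::euclidean_space set"
  assumes "A \<in> sets borel" "B \<in> sets borel"
  shows "leb (A \<times> B) = leb A \<Otimes>\<^sub>M leb B"
proof (rule pair_measure_eqI[THEN sym])
  show "sigma_finite_measure (leb A)" "sigma_finite_measure (leb B)"
    using assms by (auto intro!: sigma_finite_measure_restrict_space lborel.sigma_finite_measure_axioms)
  show "sets (leb A \<Otimes>\<^sub>M leb B) = sets (leb (A \<times> B))"
  proof (rule equalityI[rotated])
    have m: "(\<lambda>z. (fst z, snd z)) \<in> leb A \<Otimes>\<^sub>M leb B \<rightarrow>\<^sub>M borel \<Otimes>\<^sub>M borel"
    proof (rule measurable_Pair)
      show "fst \<in> leb A \<Otimes>\<^sub>M leb B \<rightarrow>\<^sub>M borel"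
        by (rule measurable_compose[OF measurable_fst]) (auto intro: measurable_restrict_space1)
      show "snd \<in> leb A \<Otimes>\<^sub>M leb B \<rightarrow>\<^sub>M borel"
        by (rule measurable_compose[OF measurable_snd]) (auto intro: measurable_restrict_space1)
    qed
    show "sets (leb (A \<times> B)) \<subseteq> sets (leb A \<Otimes>\<^sub>M leb B)"
    proof
      fix X assume "X \<in> sets (leb (A \<times> B))"
      then obtain Y where Y: "Y \<in> sets (borel \<Otimes>\<^sub>M borel)" "X = (A \<times> B) \<inter> Y"
        unfolding sets_restrict_space borel_prod sets_lborel by blast
      have "X = (\<lambda>z. (fst z, snd z)) -` Y \<inter> space (leb A \<Otimes>\<^sub>M leb B)"
        using Y by (auto simp: space_pair_measure space_restrict_space)
      then show "X \<in> sets (leb A \<Otimes>\<^sub>M leb B)"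
        using measurable_sets[OF m Y(1)] by simp
    qed
    show "sets (leb A \<Otimes>\<^sub>M leb B) \<subseteq> sets (leb (A \<times> B))"
      by (rule sets_pair_in_sets) (use assms in \<open>auto simp: sets_restrict_space_iff borel_Times\<close>)
  qed
  fix X Y assume X: "X \<in> sets (leb A)" "Y \<in> sets (leb B)"
  then have XY: "X \<in> sets borel" "Y \<in> sets borel" "X \<subseteq> A" "Y \<subseteq> B"
    using assms by (auto simp: sets_restrict_space_iff)
  then have "emeasure (leb (A \<times> B)) (X \<times> Y) = emeasure (lborel \<Otimes>\<^sub>M lborel) (X \<times> Y)"
    using assms by (subst emeasure_restrict_space) (auto simp: lborel_prod borel_Times)
  also have "\<dots> = emeasure (leb A) X * emeasure (leb B) Y"
    using assms XY by (simp add: lborel.emeasure_pair_measure_Times emeasure_restrict_space)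
  finally show "emeasure (leb A) X * emeasure (leb B) Y = emeasure (leb (A \<times> B)) (X \<times> Y)" by simp
qed

lemma L2_measurable: "f \<in> L2 S \<Longrightarrow> f \<in> borel_measurable (leb S)"
  by (simp add: L2_def)

lemma L2_integrable_inner:
  assumes "f \<in> L2 S" "g \<in> L2 S"
  shows "integrable (leb S) (\<lambda>x. f x \<bullet> g x)"
proof (rule Bochner_Integration.integrable_bound)
  show "integrable (leb S) (\<lambda>x. (norm (f x))\<^sup>2 + (norm (g x))\<^sup>2)"
    using assms by (simp add: L2_def)
  show "(\<lambda>x. f x \<bullet> g x) \<in> borel_measurable (leb S)"
    using assms by (intro borel_measurable_inner) (simp_all add: L2_def)
  have "\<bar>f x \<bullet> g x\<bar> \<le> \<bar>(norm (f x))\<^sup>2 + (norm (g x))\<^sup>2\<bar>" for x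
  proof -
    have "\<bar>f x \<bullet> g x\<bar> \<le> norm (f x) * norm (g x)" by (rule Cauchy_Schwarz_ineq2)
    also have "\<dots> \<le> (norm (f x))\<^sup>2 + (norm (g x))\<^sup>2"
      using sum_squares_bound[of "norm (f x)" "norm (g x)"]
        mult_nonneg_nonneg[OF norm_ge_zero[of "f x"] norm_ge_zero[of "g x"]]
      by linarith
    finally show ?thesis by simp
  qed
  then show "AE x in leb S. norm (f x \<bullet> g x) \<le> norm ((norm (f x))\<^sup>2 + (norm (g x))\<^sup>2)"
    by simp
qed

lemma L2_iff: "f \<in> L2 S \<longleftrightarrow> f \<in> borel_measurable (leb S) \<and> integrable (leb S) (\<lambda>x. f x \<bullet> f x)"
  by (simp add: L2_def power2_norm_eq_inner)

lemma L2_add: "f \<in> L2 S \<Longrightarrow> g \<in> L2 S \<Longrightarrow> (\<lambda>x. f x + g x) \<in> L2 S"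
  using L2_integrable_inner[of f S f] L2_integrable_inner[of f S g]
    L2_integrable_inner[of g S f] L2_integrable_inner[of g S g]
  by (simp add: L2_iff inner_add_left inner_add_right borel_measurable_add)

lemma L2_scale: "f \<in> L2 S \<Longrightarrow> (\<lambda>x. a *\<^sub>R f x) \<in> L2 S"
  by (auto simp: L2_iff intro: borel_measurable_scaleR)

lemma L2_zero: "(\<lambda>x. 0) \<in> L2 S"
  by (simp add: L2_iff)

lemma L2_sum:
  assumes "\<And>i. i \<in> I \<Longrightarrow> f i \<in> L2 S"
  shows "(\<lambda>x. \<Sum>i\<in>I. a i *\<^sub>R f i x) \<in> L2 S"
  using assms
  by (induction I rule: infinite_finite_induct)
    (simp_all add: L2_zero L2_add[OF L2_scale])

lemma L2_diff: "f \<in> L2 S \<Longrightarrow> g \<in> L2 S \<Longrightarrow> (\<lambda>x. f x - g x) \<in> L2 S"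
  using L2_add[OF _ L2_scale[of g S "- 1"], of f] by simp

text \<open>The source of the Galerkin matrix: inner products of finite sums become bilinear forms
  in the coefficients.\<close>

lemma l2_inner_sum:
  assumes "\<And>i. i \<in> I \<Longrightarrow> f i \<in> L2 S" "\<And>j. j \<in> J \<Longrightarrow> g j \<in> L2 S"
  shows "l2_inner S (\<lambda>x. \<Sum>i\<in>I. a i *\<^sub>R f i x) (\<lambda>x. \<Sum>j\<in>J. b j *\<^sub>R g j x)
    = (\<Sum>i\<in>I. \<Sum>j\<in>J. a i * b j * l2_inner S (f i) (g j))"
proof -
  have "l2_inner S (\<lambda>x. \<Sum>i\<in>I. a i *\<^sub>R f i x) (\<lambda>x. \<Sum>j\<in>J. b j *\<^sub>R g j x)
      = (\<integral>x. (\<Sum>i\<in>I. \<Sum>j\<in>J. a i * b j * (f i x \<bullet> g j x)) \<partial>leb S)"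
    unfolding l2_inner_def inner_sum_left
    by (simp add: inner_sum_right sum_distrib_left mult.assoc mult.left_commute)
  also have "\<dots> = (\<Sum>i\<in>I. \<Sum>j\<in>J. a i * b j * l2_inner S (f i) (g j))"
  proof -
    have i: "integrable (leb S) (\<lambda>x. a i * b j * (f i x \<bullet> g j x))" if "i \<in> I" "j \<in> J" for i j
      using L2_integrable_inner[OF assms(1)[OF that(1)] assms(2)[OF that(2)]] by simp
    have "(\<integral>x. (\<Sum>i\<in>I. \<Sum>j\<in>J. a i * b j * (f i x \<bullet> g j x)) \<partial>leb S)
        = (\<Sum>i\<in>I. \<integral>x. (\<Sum>j\<in>J. a i * b j * (f i x \<bullet> g j x)) \<partial>leb S)"
      by (intro Bochner_Integration.integral_sum Bochner_Integration.integrable_sum i)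
    also have "\<dots> = (\<Sum>i\<in>I. \<Sum>j\<in>J. \<integral>x. a i * b j * (f i x \<bullet> g j x) \<partial>leb S)"
      by (intro sum.cong refl Bochner_Integration.integral_sum i)
    finally show ?thesis by (simp add: l2_inner_def)
  qed
  finally show ?thesis .
qed

lemma l2_inner_cong_AE:
  assumes "f \<in> borel_measurable (leb S)" "f' \<in> borel_measurable (leb S)"
    "g \<in> borel_measurable (leb S)" "g' \<in> borel_measurable (leb S)"
    "AE x in leb S. f x = f' x" "AE x in leb S. g x = g' x"
  shows "l2_inner S f g = l2_inner S f' g'"
  unfolding l2_inner_def
proof (rule integral_cong_AE)
  show "AE x in leb S. f x \<bullet> g x = f' x \<bullet> g' x"
    using assms(5,6) by eventually_elim simp
qed (use assms in \<open>auto intro: borel_measurable_inner\<close>)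

lemma l2_inner_self_nonneg: "0 \<le> l2_inner S f f"
  unfolding l2_inner_def by (rule Bochner_Integration.integral_nonneg) simp

lemma l2_norm_sq: "(l2_norm S f)\<^sup>2 = l2_inner S f f"
  by (simp add: l2_norm_def l2_inner_self_nonneg)

lemma l2_norm_nonneg: "0 \<le> l2_norm S f"
  by (simp add: l2_norm_def l2_inner_self_nonneg)

lemma l2_inner_self_eq_0:
  assumes "f \<in> L2 S" "l2_inner S f f = 0"
  shows "AE x in leb S. f x = 0"
  using assms integral_nonneg_eq_0_iff_AE[OF L2_integrable_inner[OF assms(1,1)]]
  by (simp add: l2_inner_def)

lemma l2_inner_combination:
  assumes "f \<in> L2 S" "g \<in> L2 S"
  shows "l2_inner S (\<lambda>x. a *\<^sub>R f x + b *\<^sub>R g x) (\<lambda>x. a *\<^sub>R f x + b *\<^sub>R g x)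
    = a\<^sup>2 * l2_inner S f f + 2 * a * b * l2_inner S f g + b\<^sup>2 * l2_inner S g g"
proof -
  have "l2_inner S (\<lambda>x. a *\<^sub>R f x + b *\<^sub>R g x) (\<lambda>x. a *\<^sub>R f x + b *\<^sub>R g x)
      = (\<integral>x. a\<^sup>2 * (f x \<bullet> f x) + 2 * a * b * (f x \<bullet> g x) + b\<^sup>2 * (g x \<bullet> g x) \<partial>leb S)"
    unfolding l2_inner_def
    by (intro Bochner_Integration.integral_cong refl)
      (simp add: inner_add_left inner_add_right inner_commute power2_eq_square algebra_simps)
  then show ?thesis
    using L2_integrable_inner[OF assms(1,1)] L2_integrable_inner[OF assms(1,2)]
      L2_integrable_inner[OF assms(2,2)]
    by (simp add: l2_inner_def)
qed

text \<open>With A and B the norms of f and g, expanding the squared norm of B f - A g gives 2 A B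
  (A B - (f, g)) >= 0. This can be divided by A B unless a norm is 0, and then that function
  vanishes almost everywhere.\<close>

lemma l2_inner_Cauchy_Schwarz:
  assumes "f \<in> L2 S" "g \<in> L2 S"
  shows "l2_inner S f g \<le> l2_norm S f * l2_norm S g"
proof -
  let ?A = "l2_norm S f" and ?B = "l2_norm S g"
  have "0 \<le> l2_inner S (\<lambda>x. ?B *\<^sub>R f x + (- ?A) *\<^sub>R g x) (\<lambda>x. ?B *\<^sub>R f x + (- ?A) *\<^sub>R g x)"
    by (rule l2_inner_self_nonneg)
  also have "\<dots> = 2 * (?A * ?B) * (?A * ?B - l2_inner S f g)"
    unfolding l2_inner_combination[OF assms] by (simp flip: l2_norm_sq add: power2_eq_square algebra_simps)
  finally have *: "0 \<le> 2 * (?A * ?B) * (?A * ?B - l2_inner S f g)" .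
  have zero: "l2_inner S f g = 0" if "?A = 0 \<or> ?B = 0"
  proof -
    have "(AE x in leb S. f x = 0) \<or> (AE x in leb S. g x = 0)"
      using that l2_inner_self_eq_0 assms l2_norm_sq by (metis zero_power2)
    then have "AE x in leb S. f x \<bullet> g x = 0"
      by (auto elim: eventually_mono)
    then show ?thesis unfolding l2_inner_def by (rule integral_eq_zero_AE)
  qed
  show ?thesis
  proof (cases "?A = 0 \<or> ?B = 0")
    case False
    then have "0 < 2 * (?A * ?B)" using l2_norm_nonneg[of S f] l2_norm_nonneg[of S g] by simp
    then show ?thesis using * by (simp add: zero_le_mult_iff)
  qed (use zero in auto)
qed

lemma integrable_imp_locally_integrable:
  assumes "open S" "integrable (leb S) f"
  shows "locally_integrable S f"
  unfolding locally_integrable_def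
proof (intro conjI allI impI)
  show "f \<in> borel_measurable (leb S)" using assms(2) by (rule borel_measurable_integrable)
  have "set_integrable lborel S f"
    using assms by (simp add: set_integrable_def integrable_restrict_space)
  then show "set_integrable lborel K f" if "compact K \<and> K \<subseteq> S" for K
    by (rule set_integrable_subset) (use that in \<open>auto intro: borel_closed compact_imp_closed\<close>)
qed

lemma finite_measure_leb:
  assumes "bounded S" "S \<in> sets borel"
  shows "finite_measure (leb S)"
  by (rule finite_measureI)
    (use assms emeasure_bounded_finite[of S] in \<open>simp add: emeasure_restrict_space space_restrict_space\<close>)

lemma L2_imp_integrable:
  fixes f :: "'a::euclidean_space \<Rightarrow> real"
  assumes "bounded S" "S \<in> sets borel" "f \<in> L2 S"
  shows "integrable (leb S) f"
proof -
  \<comment> \<open>A bounded set has finite measure, so the constant 1 is square integrable;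
    pairing with it yields integrability.\<close>
  have "(\<lambda>_. 1 :: real) \<in> L2 S"
    using finite_measure.integrable_const[OF finite_measure_leb[OF assms(1,2)]] by (simp add: L2_iff)
  from L2_integrable_inner[OF assms(3) this] show ?thesis by simp
qed

section \<open>Products of functions of separate variables, and bounded coefficients\<close>

lemma (in pair_sigma_finite) integrable_pair_mult:
  fixes f g :: "_ \<Rightarrow> real"
  assumes "integrable M1 f" "integrable M2 g"
  shows "integrable (M1 \<Otimes>\<^sub>M M2) (\<lambda>(x, y). f x * g y)"
proof (rule Fubini_integrable)
  have [measurable]: "f \<in> borel_measurable M1" "g \<in> borel_measurable M2" using assms by auto
  show "(\<lambda>(x, y). f x * g y) \<in> borel_measurable (M1 \<Otimes>\<^sub>M M2)" by measurable
  show "integrable M1 (\<lambda>x. \<integral>y. norm (case (x, y) of (x, y) \<Rightarrow> f x * g y) \<partial>M2)"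
    using assms by (simp add: abs_mult)
  show "AE x in M1. integrable M2 (\<lambda>y. case (x, y) of (x, y) \<Rightarrow> f x * g y)"
    using assms by simp
qed

lemma L2_pair_mult:
  fixes f :: "'a::euclidean_space \<Rightarrow> 'c::euclidean_space" and g :: "'b::euclidean_space \<Rightarrow> real"
  assumes A: "A \<in> sets borel" and B: "B \<in> sets borel" and "f \<in> L2 A" "g \<in> L2 B"
  shows "(\<lambda>(x, y). g y *\<^sub>R f x) \<in> L2 (A \<times> B)"
proof -
  interpret pair_sigma_finite "leb A" "leb B"
    using A B by (intro pair_sigma_finite.intro sigma_finite_measure_restrict_space)
      (auto intro: lborel.sigma_finite_measure_axioms)
  have [measurable]: "f \<in> borel_measurable (leb A)" "g \<in> borel_measurable (leb B)"
    using assms L2_measurable by auto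
  have "(\<lambda>(x, y). g y *\<^sub>R f x) \<in> borel_measurable (leb A \<Otimes>\<^sub>M leb B)" by measurable
  moreover have "integrable (leb A \<Otimes>\<^sub>M leb B) (\<lambda>(x, y). (f x \<bullet> f x) * (g y \<bullet> g y))"
    using assms by (intro integrable_pair_mult) (auto simp: L2_iff)
  ultimately show ?thesis
    using A B by (simp add: L2_iff leb_Times case_prod_unfold mult_ac)
qed

lemma L2_mult_Linf:
  assumes "f \<in> L2 S" "c \<in> Linf S"
  shows "(\<lambda>x. c x *\<^sub>R f x) \<in> L2 S"
proof -
  obtain K where K: "AE x in leb S. \<bar>c x\<bar> \<le> K" using assms(2) by (auto simp: Linf_def)
  have m: "f \<in> borel_measurable (leb S)" "c \<in> borel_measurable (leb S)"
    using assms by (auto simp: Linf_def L2_measurable)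
  have "integrable (leb S) (\<lambda>x. (c x *\<^sub>R f x) \<bullet> (c x *\<^sub>R f x))"
  proof (rule Bochner_Integration.integrable_bound)
    show "integrable (leb S) (\<lambda>x. K\<^sup>2 * (f x \<bullet> f x))" using assms by (simp add: L2_iff)
    show "(\<lambda>x. (c x *\<^sub>R f x) \<bullet> (c x *\<^sub>R f x)) \<in> borel_measurable (leb S)"
      using m by (intro borel_measurable_inner borel_measurable_scaleR)
    show "AE x in leb S. norm ((c x *\<^sub>R f x) \<bullet> (c x *\<^sub>R f x)) \<le> norm (K\<^sup>2 * (f x \<bullet> f x))"
      using K
    proof eventually_elim
      case (elim x)
      then have "(c x)\<^sup>2 \<le> K\<^sup>2" using power_mono[of "\<bar>c x\<bar>" K 2] by simp
      then have "(c x)\<^sup>2 * (f x \<bullet> f x) \<le> K\<^sup>2 * (f x \<bullet> f x)" by (rule mult_right_mono) simp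
      then have "norm ((c x)\<^sup>2 * (f x \<bullet> f x)) \<le> norm (K\<^sup>2 * (f x \<bullet> f x))" by simp
      then show ?case by (simp add: power2_eq_square mult.assoc)
    qed
  qed
  then show ?thesis using m by (simp add: L2_iff borel_measurable_scaleR)
qed

lemma Linf_fst:
  assumes "A \<in> sets borel" "B \<in> sets borel" "c \<in> Linf A"
  shows "(\<lambda>z. c (fst z)) \<in> Linf (A \<times> B)"
proof -
  interpret pair_sigma_finite "leb A" "leb B"
    using assms by (intro pair_sigma_finite.intro sigma_finite_measure_restrict_space)
      (auto intro: lborel.sigma_finite_measure_axioms)
  obtain K where K: "AE x in leb A. \<bar>c x\<bar> \<le> K" using assms by (auto simp: Linf_def)
  have [measurable]: "c \<in> borel_measurable (leb A)" using assms by (simp add: Linf_def)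
  have m: "(\<lambda>z. c (fst z)) \<in> borel_measurable (leb A \<Otimes>\<^sub>M leb B)" by measurable
  have "AE z in leb A \<Otimes>\<^sub>M leb B. \<bar>c (fst z)\<bar> \<le> K"
  proof (rule AE_pair_measure)
    show "{z \<in> space (leb A \<Otimes>\<^sub>M leb B). \<bar>c (fst z)\<bar> \<le> K} \<in> sets (leb A \<Otimes>\<^sub>M leb B)"
      by measurable
    show "AE x in leb A. AE y in leb B. \<bar>c (fst (x, y))\<bar> \<le> K"
      using K by (simp add: eventually_mono)
  qed
  then show ?thesis using m assms(1,2) unfolding Linf_def leb_Times[OF assms(1,2)] by blast
qed

lemma Linf_mult: "c \<in> Linf S \<Longrightarrow> d \<in> Linf S \<Longrightarrow> (\<lambda>x. c x * d x) \<in> Linf S"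
proof -
  assume cd: "c \<in> Linf S" "d \<in> Linf S"
  then obtain K L where "AE x in leb S. \<bar>c x\<bar> \<le> K" "AE x in leb S. \<bar>d x\<bar> \<le> L"
    by (auto simp: Linf_def)
  then have "AE x in leb S. \<bar>c x * d x\<bar> \<le> K * L"
  proof eventually_elim
    case (elim x)
    then show ?case unfolding abs_mult by (intro mult_mono) auto
  qed
  then show ?thesis using cd by (auto simp: Linf_def borel_measurable_times)
qed

section \<open>Indefinite integrals on an interval\<close>

lemma sigma_finite_leb: "S \<in> sets borel \<Longrightarrow> sigma_finite_measure (leb S)"
  by (simp add: sigma_finite_measure_restrict_space lborel.sigma_finite_measure_axioms)

lemma pair_sigma_finite_leb:
  "A \<in> sets borel \<Longrightarrow> B \<in> sets borel \<Longrightarrow> pair_sigma_finite (leb A) (leb B)"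
  by (simp add: pair_sigma_finite.intro sigma_finite_leb)

lemma leb_integral: "S \<in> sets borel \<Longrightarrow> integral\<^sup>L (leb S) f = (LBINT x:S. f x)"
  for f :: "_ \<Rightarrow> real"
  by (simp add: set_lebesgue_integral_def integral_restrict_space)

lemma leb_integrable: "S \<in> sets borel \<Longrightarrow> integrable (leb S) f \<longleftrightarrow> set_integrable lborel S f"
  for f :: "_ \<Rightarrow> real"
  by (simp add: set_integrable_def integrable_restrict_space)

text \<open>For T > 0 this is absolute continuity of \<open>F\<close> on the closed interval, with
  derivative \<open>f\<close> almost everywhere. The identity is required at every point, endpoints
  included, so that boundary values of \<open>F\<close> have a meaning and integration by parts is
  exact.\<close>

definition indef :: "real \<Rightarrow> (real \<Rightarrow> real) \<Rightarrow> (real \<Rightarrow> real) \<Rightarrow> bool" where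
  "indef T F f \<longleftrightarrow> set_integrable lborel {0<..<T} f \<and>
     (\<forall>t\<in>{0..T}. F t = F 0 + (LBINT s:{0<..<t}. f s))"

lemma set_integrable_sub_Ioo:
  fixes f :: "real \<Rightarrow> real"
  shows "set_integrable lborel {0<..<T} f \<Longrightarrow> t \<le> T \<Longrightarrow> set_integrable lborel {0<..<t} f"
  by (rule set_integrable_subset) auto

lemma indef_integral:
  "set_integrable lborel {0<..<T} f \<Longrightarrow> indef T (\<lambda>t. C + (LBINT s:{0<..<t}. f s)) f"
  by (simp add: indef_def set_lebesgue_integral_def)

lemma indef_continuous:
  assumes "indef T F f"
  shows "continuous_on {0..T} F"
proof -
  let ?g = "\<lambda>s. indicator {0<..<T} s * f s"
  have f: "set_integrable lborel {0<..<T} f" using assms by (simp add: indef_def)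
  then have i: "integrable lborel ?g" by (simp add: set_integrable_def)
  have gi: "set_integrable lborel A ?g" if "A \<in> sets borel" for A
    using integrable_mult_indicator[OF _ i, of A] that by (simp add: set_integrable_def)
  have "(LBINT s:{0<..<t}. f s) = integral {0..t} ?g" if "t \<in> {0..T}" for t
  proof -
    have "(LBINT s:{0<..<t}. f s) = (LBINT s:{0..t}. ?g s)"
      unfolding set_lebesgue_integral_def
    proof (rule integral_cong_AE)
      show "(\<lambda>s. indicator {0<..<t} s *\<^sub>R f s) \<in> borel_measurable lborel"
        using set_integrable_sub_Ioo[OF f, of t] that by (auto simp: set_integrable_def)
      show "(\<lambda>s. indicator {0..t} s *\<^sub>R ?g s) \<in> borel_measurable lborel"
        using gi[of "{0..t}"] by (auto simp: set_integrable_def)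
      \<comment> \<open>Only the point \<open>t\<close> can make a difference, because
        \<open>?g\<close> already vanishes at 0.\<close>
      show "AE s in lborel. indicator {0<..<t} s *\<^sub>R f s = indicator {0..t} s *\<^sub>R ?g s"
        using AE_lborel_singleton[of t]
        by eventually_elim (use that in \<open>auto simp: indicator_def\<close>)
    qed
    also have "\<dots> = integral {0..t} ?g"
      by (rule set_borel_integral_eq_integral(2)) (rule gi, simp)
    finally show ?thesis .
  qed
  moreover have "F t = F 0 + (LBINT s:{0<..<t}. f s)" if "t \<in> {0..T}" for t
    using assms that unfolding indef_def by blast
  ultimately have eq: "F t = F 0 + integral {0..t} ?g" if "t \<in> {0..T}" for t
    using that by metis
  have "?g integrable_on {0..T}"
    by (rule set_borel_integral_eq_integral(1)) (rule gi, simp)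
  then have "continuous_on {0..T} (\<lambda>t. F 0 + integral {0..t} ?g)"
    by (intro continuous_intros indefinite_integral_continuous_1)
  then show ?thesis by (rule continuous_on_eq) (rule eq[symmetric])
qed

lemma continuous_imp_set_integrable:
  fixes F :: "real \<Rightarrow> real"
  assumes "continuous_on {0..T} F"
  shows "set_integrable lborel {0<..<T} F" "F \<in> borel_measurable (leb {0<..<T})"
proof -
  show *: "set_integrable lborel {0<..<T} F"
    by (rule set_integrable_subset[OF borel_integrable_atLeastAtMost'[OF assms]]) auto
  show "F \<in> borel_measurable (leb {0<..<T})"
    using * leb_integrable[of "{0<..<T}" F] by auto
qed

lemma continuous_L2:
  fixes F :: "real \<Rightarrow> real"
  assumes "continuous_on {0..T} F"
  shows "F \<in> L2 {0<..<T}"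
proof -
  have "continuous_on {0..T} (\<lambda>t. F t * F t)" using assms by (intro continuous_intros)
  then show ?thesis
    using continuous_imp_set_integrable assms by (simp add: L2_iff leb_integrable)
qed

lemma set_integrable_continuous_mult:
  fixes F f :: "real \<Rightarrow> real"
  assumes "continuous_on {0..T} F" "set_integrable lborel {0<..<T} f"
  shows "set_integrable lborel {0<..<T} (\<lambda>t. F t * f t)"
proof -
  have "bounded (F ` {0..T})"
    using assms(1) by (intro compact_imp_bounded compact_continuous_image) auto
  then obtain K where K: "\<And>t. t \<in> {0..T} \<Longrightarrow> \<bar>F t\<bar> \<le> K"
    unfolding bounded_iff real_norm_def by blast
  have i: "integrable (leb {0<..<T}) f" using assms(2) by (simp add: leb_integrable)
  have "integrable (leb {0<..<T}) (\<lambda>t. F t * f t)"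
  proof (rule Bochner_Integration.integrable_bound)
    show "integrable (leb {0<..<T}) (\<lambda>t. K * f t)" using i by simp
    show "(\<lambda>t. F t * f t) \<in> borel_measurable (leb {0<..<T})"
      using i continuous_imp_set_integrable(2)[OF assms(1)] by (intro borel_measurable_times) auto
    show "AE t in leb {0<..<T}. norm (F t * f t) \<le> norm (K * f t)"
    proof (rule AE_I2)
      fix t assume "t \<in> space (leb {0<..<T})"
      then have "\<bar>F t\<bar> \<le> \<bar>K\<bar>" using K[of t] by (simp add: space_restrict_space)
      then show "norm (F t * f t) \<le> norm (K * f t)" by (simp add: abs_mult mult_right_mono)
    qed
  qed
  then show ?thesis by (simp add: leb_integrable)
qed

text \<open>Splitting the square \<open>(0,T)\<^sup>2\<close> along its diagonal.\<close>

lemma integral_mult_triangle: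
  fixes f g :: "real \<Rightarrow> real"
  assumes f: "set_integrable lborel {0<..<T} f" and g: "set_integrable lborel {0<..<T} g"
  shows "(LBINT t:{0<..<T}. f t) * (LBINT t:{0<..<T}. g t)
    = (LBINT t:{0<..<T}. f t * (LBINT s:{0<..<t}. g s)) + (LBINT t:{0<..<T}. (LBINT s:{0<..<t}. f s) * g t)"
proof -
  let ?N = "leb {0<..<T}"
  interpret pair_sigma_finite ?N ?N by (rule pair_sigma_finite_leb) auto
  have fi: "integrable ?N f" "integrable ?N g" using f g by (simp_all add: leb_integrable)
  then have [measurable]: "f \<in> borel_measurable ?N" "g \<in> borel_measurable ?N" by auto
  have [measurable]: "(\<lambda>t. t) \<in> borel_measurable ?N" by (rule measurable_restrict_space1) simp
  have p: "integrable (?N \<Otimes>\<^sub>M ?N) (\<lambda>(t, s). f t * g s)"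
    by (rule integrable_pair_mult[OF fi])
  let ?u = "\<lambda>t s. of_bool (s < t) * (f t * g s)" and ?v = "\<lambda>t s. of_bool (\<not> s < t) * (f t * g s)"
  have u: "integrable (?N \<Otimes>\<^sub>M ?N) (\<lambda>(t, s). ?u t s)"
    by (rule Bochner_Integration.integrable_bound[OF p]) (measurable, auto)
  have v: "integrable (?N \<Otimes>\<^sub>M ?N) (\<lambda>(t, s). ?v t s)"
    by (rule Bochner_Integration.integrable_bound[OF p]) (measurable, auto)
  have "(LBINT t:{0<..<T}. f t) * (LBINT t:{0<..<T}. g t) = (\<integral>t. (\<integral>s. f t * g s \<partial>?N) \<partial>?N)"
    by (simp add: leb_integral)
  also have "\<dots> = (\<integral>z. (case z of (t, s) \<Rightarrow> f t * g s) \<partial>(?N \<Otimes>\<^sub>M ?N))"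
    using integral_fst[OF p] by simp
  also have "\<dots> = (\<integral>z. (case z of (t, s) \<Rightarrow> ?u t s) + (case z of (t, s) \<Rightarrow> ?v t s) \<partial>(?N \<Otimes>\<^sub>M ?N))"
    by (intro Bochner_Integration.integral_cong refl) (auto simp: case_prod_beta)
  also have "\<dots> = (\<integral>z. (case z of (t, s) \<Rightarrow> ?u t s) \<partial>(?N \<Otimes>\<^sub>M ?N)) + (\<integral>z. (case z of (t, s) \<Rightarrow> ?v t s) \<partial>(?N \<Otimes>\<^sub>M ?N))"
    using u v by (rule Bochner_Integration.integral_add)
  also have "(\<integral>z. (case z of (t, s) \<Rightarrow> ?u t s) \<partial>(?N \<Otimes>\<^sub>M ?N)) = (\<integral>t. (\<integral>s. ?u t s \<partial>?N) \<partial>?N)"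
    using integral_fst[OF u] by simp
  also have "\<dots> = (\<integral>t. f t * (LBINT s:{0<..<t}. g s) \<partial>?N)"
  proof (rule Bochner_Integration.integral_cong[OF refl])
    fix t assume t: "t \<in> space ?N"
    have "(\<integral>s. ?u t s \<partial>?N) = f t * (\<integral>s. of_bool (s < t) * g s \<partial>?N)"
      by (subst integral_mult_right_zero[symmetric]) (simp add: mult.left_commute)
    also have "(\<integral>s. of_bool (s < t) * g s \<partial>?N) = (LBINT s:{0<..<t}. g s)"
      unfolding leb_integral[of "{0<..<T}", simplified] set_lebesgue_integral_def
      using t by (intro Bochner_Integration.integral_cong) (auto simp: indicator_def space_restrict_space)
    finally show "(\<integral>s. ?u t s \<partial>?N) = f t * (LBINT s:{0<..<t}. g s)" .
  qed
  also have "(\<integral>z. (case z of (t, s) \<Rightarrow> ?v t s) \<partial>(?N \<Otimes>\<^sub>M ?N)) = (\<integral>s. (\<integral>t. ?v t s \<partial>?N) \<partial>?N)"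
    using integral_snd[OF v] by simp
  also have "\<dots> = (\<integral>s. (LBINT t:{0<..<s}. f t) * g s \<partial>?N)"
  proof (rule Bochner_Integration.integral_cong[OF refl])
    fix s assume s: "s \<in> space ?N"
    have "(\<integral>t. ?v t s \<partial>?N) = (\<integral>t. of_bool (\<not> s < t) * f t \<partial>?N) * g s"
      by (subst integral_mult_left_zero[symmetric]) (simp add: mult.assoc)
    also have "(\<integral>t. of_bool (\<not> s < t) * f t \<partial>?N) = (LBINT t:{0<..<s}. f t)"
      unfolding leb_integral[of "{0<..<T}", simplified] set_lebesgue_integral_def
    proof (rule integral_cong_AE)
      have "(\<lambda>t. of_bool (\<not> s < t) * f t) \<in> borel_measurable ?N" by measurable
      then show "(\<lambda>t. indicator {0<..<T} t *\<^sub>R (of_bool (\<not> s < t) * f t)) \<in> borel_measurable lborel"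
        by (simp add: borel_measurable_restrict_space_iff)
      show "(\<lambda>t. indicator {0<..<s} t *\<^sub>R f t) \<in> borel_measurable lborel"
        using set_integrable_sub_Ioo[OF f, of s] s by (auto simp: set_integrable_def space_restrict_space)
      \<comment> \<open>The half \<open>?v\<close> keeps the diagonal, so its inner integral also
        includes the point \<open>s\<close>, a null set.\<close>
      show "AE t in lborel. indicator {0<..<T} t *\<^sub>R (of_bool (\<not> s < t) * f t) = indicator {0<..<s} t *\<^sub>R f t"
        using AE_lborel_singleton[of s]
        by eventually_elim (use s in \<open>auto simp: indicator_def space_restrict_space\<close>)
    qed
    finally show "(\<integral>t. ?v t s \<partial>?N) = (LBINT t:{0<..<s}. f t) * g s" .
  qed
  finally show ?thesis by (simp add: leb_integral)
qed

text \<open>The product rule for absolutely continuous functions. Once the initial values are split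
  off, all terms are linear except the product of the two integrals, and that one is the triangle
  identity on (0,t).\<close>

lemma indef_mult:
  assumes F: "indef T F f" and G: "indef T G g"
  shows "indef T (\<lambda>t. F t * G t) (\<lambda>t. f t * G t + F t * g t)"
proof -
  have f: "set_integrable lborel {0<..<T} f" and g: "set_integrable lborel {0<..<T} g"
    using F G by (auto simp: indef_def)
  have fG: "set_integrable lborel {0<..<T} (\<lambda>t. f t * G t)"
    using set_integrable_continuous_mult[OF indef_continuous[OF G] f] by (simp add: mult.commute)
  have Fg: "set_integrable lborel {0<..<T} (\<lambda>t. F t * g t)"
    by (rule set_integrable_continuous_mult[OF indef_continuous[OF F] g])
  have "F t * G t = F 0 * G 0 + (LBINT s:{0<..<t}. f s * G s + F s * g s)" if t: "t \<in> {0..T}" for t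
  proof -
    define If where "If s = (LBINT r:{0<..<s}. f r)" for s
    define Ig where "Ig s = (LBINT r:{0<..<s}. g r)" for s
    have le: "t \<le> T" using t by simp
    have FG: "F s = F 0 + If s" "G s = G 0 + Ig s" if "s \<in> {0..t}" for s
    proof -
      have "s \<in> {0..T}" using that t by simp
      then show "F s = F 0 + If s" "G s = G 0 + Ig s"
        using F G unfolding indef_def If_def Ig_def by blast+
    qed
    have cIf: "continuous_on {0..t} If" "continuous_on {0..t} Ig"
      using indef_continuous[OF indef_integral[of t _ 0]] f g set_integrable_sub_Ioo[OF _ le]
      unfolding If_def[abs_def] Ig_def[abs_def] by auto
    note ft = set_integrable_sub_Ioo[OF f le] and gt = set_integrable_sub_Ioo[OF g le]
    have fIg: "set_integrable lborel {0<..<t} (\<lambda>s. f s * Ig s)"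
      using set_integrable_continuous_mult[OF cIf(2) ft] by (simp add: mult.commute)
    have Ifg: "set_integrable lborel {0<..<t} (\<lambda>s. If s * g s)"
      by (rule set_integrable_continuous_mult[OF cIf(1) gt])
    have "(LBINT s:{0<..<t}. f s * G s + F s * g s)
        = (LBINT s:{0<..<t}. (G 0 * f s + F 0 * g s) + (f s * Ig s + If s * g s))"
    proof (rule set_lebesgue_integral_cong)
      show "\<forall>s. s \<in> {0<..<t} \<longrightarrow> f s * G s + F s * g s = (G 0 * f s + F 0 * g s) + (f s * Ig s + If s * g s)"
      proof (intro allI impI)
        fix s assume "s \<in> {0<..<t}"
        then have "F s = F 0 + If s" "G s = G 0 + Ig s" using FG[of s] by auto
        then show "f s * G s + F s * g s = (G 0 * f s + F 0 * g s) + (f s * Ig s + If s * g s)"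
          by (simp add: algebra_simps)
      qed
    qed simp
    also have "\<dots> = G 0 * If t + F 0 * Ig t + ((LBINT s:{0<..<t}. f s * Ig s) + (LBINT s:{0<..<t}. If s * g s))"
      using ft gt fIg Ifg by (simp add: set_integral_add If_def[of t] Ig_def[of t])
    also have "(LBINT s:{0<..<t}. f s * Ig s) + (LBINT s:{0<..<t}. If s * g s) = If t * Ig t"
      using integral_mult_triangle[OF ft gt] by (simp add: If_def Ig_def)
    finally have *: "(LBINT s:{0<..<t}. f s * G s + F s * g s) = G 0 * If t + F 0 * Ig t + If t * Ig t" .
    have "F t = F 0 + If t" "G t = G 0 + Ig t" using FG[of t] t by auto
    then show ?thesis unfolding * by (simp add: algebra_simps)
  qed
  then show ?thesis
    unfolding indef_def using set_integral_add(1)[OF fG Fg] by blast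
qed

lemma indef_C1:
  assumes "\<And>t. (F has_real_derivative f t) (at t)" "continuous_on UNIV f"
  shows "indef T F f"
  unfolding indef_def
proof (intro conjI ballI)
  have c: "continuous_on A f" for A using assms(2) continuous_on_subset by blast
  then show i: "set_integrable lborel {0<..<T} f"
    by (simp add: continuous_imp_set_integrable)
  fix t assume t: "t \<in> {0..T}"
  have "(f has_integral (F t - F 0)) {0..t}"
    using t assms(1) by (intro fundamental_theorem_of_calculus)
      (auto simp flip: has_real_derivative_iff_has_vector_derivative intro: has_field_derivative_at_within)
  moreover have "(LBINT s:{0..t}. f s) = integral {0..t} f"
    by (rule set_borel_integral_eq_integral(2)) (rule borel_integrable_atLeastAtMost'[OF c])
  moreover have "(LBINT s:{0<..<t}. f s) = (LBINT s:{0..t}. f s)"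
    unfolding set_lebesgue_integral_def
  proof (rule integral_cong_AE)
    show "(\<lambda>s. indicator {0<..<t} s *\<^sub>R f s) \<in> borel_measurable lborel"
      using set_integrable_sub_Ioo[OF i, of t] t by (auto simp: set_integrable_def)
    show "(\<lambda>s. indicator {0..t} s *\<^sub>R f s) \<in> borel_measurable lborel"
      using borel_integrable_atLeastAtMost'[OF c[of "{0..t}"]] by (auto simp: set_integrable_def)
    show "AE s in lborel. indicator {0<..<t} s *\<^sub>R f s = indicator {0..t} s *\<^sub>R f s"
      using AE_lborel_singleton[of t] AE_lborel_singleton[of 0]
      by eventually_elim (auto simp: indicator_def)
  qed
  ultimately show "F t = F 0 + (LBINT s:{0<..<t}. f s)"
    by (simp add: integral_unique)
qed

lemma indef_scale: "indef T F f \<Longrightarrow> indef T (\<lambda>t. a * F t) (\<lambda>t. a * f t)"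
  unfolding indef_def
proof (elim conjE, intro conjI ballI)
  fix t assume "\<forall>t\<in>{0..T}. F t = F 0 + (LBINT s:{0<..<t}. f s)" "t \<in> {0..T}"
  then have "F t = F 0 + (LBINT s:{0<..<t}. f s)" by blast
  then show "a * F t = a * F 0 + (LBINT s:{0<..<t}. a * f s)"
    by (simp add: algebra_simps)
qed simp

lemma indef_sum:
  assumes "\<And>i. i \<in> I \<Longrightarrow> indef T (F i) (f i)"
  shows "indef T (\<lambda>t. \<Sum>i\<in>I. a i * F i t) (\<lambda>t. \<Sum>i\<in>I. a i * f i t)"
  using assms
proof (induction I rule: infinite_finite_induct)
  case (insert i I)
  have add: "indef T (\<lambda>t. F t + G t) (\<lambda>t. f t + g t)" if FG: "indef T F f" "indef T G g" for F f G g
    unfolding indef_def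
  proof (intro conjI ballI)
    have fg: "set_integrable lborel {0<..<T} f" "set_integrable lborel {0<..<T} g"
      using FG unfolding indef_def by blast+
    then show "set_integrable lborel {0<..<T} (\<lambda>t. f t + g t)" by (rule set_integral_add(1))
    fix t assume t: "t \<in> {0..T}"
    then have "(LBINT s:{0<..<t}. f s + g s) = (LBINT s:{0<..<t}. f s) + (LBINT s:{0<..<t}. g s)"
      by (intro set_integral_add(2) set_integrable_sub_Ioo[OF fg(1)] set_integrable_sub_Ioo[OF fg(2)]) simp_all
    moreover have "F t = F 0 + (LBINT s:{0<..<t}. f s)" "G t = G 0 + (LBINT s:{0<..<t}. g s)"
      using FG t unfolding indef_def by blast+
    ultimately show "F t + G t = F 0 + G 0 + (LBINT s:{0<..<t}. f s + g s)" by linarith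
  qed
  have "indef T (\<lambda>t. a i * F i t + (\<Sum>i\<in>I. a i * F i t)) (\<lambda>t. a i * f i t + (\<Sum>i\<in>I. a i * f i t))"
    by (intro add indef_scale insert.IH insert.prems) auto
  with insert.hyps show ?case by simp
qed (simp_all add: indef_def set_integrable_def set_lebesgue_integral_def)

lemma indef_exp_weight:
  assumes T: "T > 0"
  shows "indef T (\<lambda>t. exp (- t / T)) (\<lambda>t. - (1 / T) * exp (- t / T))"
proof (rule indef_C1)
  show "((\<lambda>t. exp (- t / T)) has_real_derivative - (1 / T) * exp (- t / T)) (at t)" for t
    using T by (auto intro!: derivative_eq_intros)
  show "continuous_on UNIV (\<lambda>t. - (1 / T) * exp (- t / T))"
    using T by (intro continuous_intros) auto
qed

text \<open>Integrating the derivative of \<open>exp (- t / T) * (r t)\<^sup>2\<close> over \<open>(0, T)\<close>.\<close>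

lemma exp_weight_energy:
  assumes T: "T > 0" and r: "indef T r h"
  shows "(LBINT t:{0<..<T}. exp (- t / T) * (h t * r t)) + (r 0)\<^sup>2 / 2
    \<ge> (LBINT t:{0<..<T}. (r t)\<^sup>2) / (2 * exp 1 * T)"
proof -
  let ?e = "\<lambda>t. exp (- t / T)"
  have e: "indef T ?e (\<lambda>t. - (1 / T) * ?e t)" using T by (rule indef_exp_weight)
  note cr = indef_continuous[OF r] and ce = indef_continuous[OF e]
  have h: "set_integrable lborel {0<..<T} h" using r by (simp add: indef_def)
  have hr: "set_integrable lborel {0<..<T} (\<lambda>t. ?e t * (h t * r t))"
    using set_integrable_continuous_mult[OF continuous_on_mult[OF ce cr] h] by (simp add: mult_ac)
  have rr: "set_integrable lborel {0<..<T} (\<lambda>t. ?e t * (r t)\<^sup>2)"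
    by (intro continuous_imp_set_integrable continuous_on_mult ce continuous_on_power cr)
  have rr': "set_integrable lborel {0<..<T} (\<lambda>t. (r t)\<^sup>2)"
    by (intro continuous_imp_set_integrable continuous_on_power cr)
  \<comment> \<open>The product rule is used twice, for the weight times \<open>r\<close> times
    \<open>r\<close>, and evaluated at the endpoint \<open>T\<close>.\<close>
  have "?e T * r T * r T = ?e 0 * r 0 * r 0
      + (LBINT t:{0<..<T}. (- (1 / T) * ?e t * r t + ?e t * h t) * r t + ?e t * r t * h t)"
    using indef_mult[OF indef_mult[OF e r] r] T unfolding indef_def
    by (elim conjE ballE[of _ _ T]) auto
  also have "(LBINT t:{0<..<T}. (- (1 / T) * ?e t * r t + ?e t * h t) * r t + ?e t * r t * h t)
      = (LBINT t:{0<..<T}. 2 * (?e t * (h t * r t)) - 1 / T * (?e t * (r t)\<^sup>2))"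
    by (rule set_lebesgue_integral_cong) (auto simp: power2_eq_square algebra_simps)
  also have "\<dots> = 2 * (LBINT t:{0<..<T}. ?e t * (h t * r t)) - 1 / T * (LBINT t:{0<..<T}. ?e t * (r t)\<^sup>2)"
    using hr rr by (subst set_integral_diff) auto
  finally have eq: "?e T * (r T)\<^sup>2 = (r 0)\<^sup>2 + 2 * (LBINT t:{0<..<T}. ?e t * (h t * r t))
      - 1 / T * (LBINT t:{0<..<T}. ?e t * (r t)\<^sup>2)"
    by (simp add: power2_eq_square mult.assoc)
  have "exp (- 1) * (LBINT t:{0<..<T}. (r t)\<^sup>2) = (LBINT t:{0<..<T}. exp (- 1) * (r t)\<^sup>2)"
    by simp
  also have "\<dots> \<le> (LBINT t:{0<..<T}. ?e t * (r t)\<^sup>2)"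
    using rr rr' T by (intro set_integral_mono) (auto intro!: mult_right_mono)
  finally have "exp (- 1) * (LBINT t:{0<..<T}. (r t)\<^sup>2) \<le> (LBINT t:{0<..<T}. ?e t * (r t)\<^sup>2)" .
  then have "1 / T * (exp (- 1) * (LBINT t:{0<..<T}. (r t)\<^sup>2)) \<le> 1 / T * (LBINT t:{0<..<T}. ?e t * (r t)\<^sup>2)"
    using T by (intro mult_left_mono) auto
  \<comment> \<open>The terminal value has the favourable sign and is dropped. Halving the identity
    produces both the initial term with factor 1/2 and the 2 in the constant.\<close>
  moreover have "0 \<le> ?e T * (r T)\<^sup>2" by simp
  moreover have "1 / T * (exp (- 1) * (LBINT t:{0<..<T}. (r t)\<^sup>2)) / 2
      = (LBINT t:{0<..<T}. (r t)\<^sup>2) / (2 * exp 1 * T)"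
    by (simp add: exp_minus field_simps)
  moreover have "q \<le> E + D / 2" if "A \<le> B" "0 \<le> C" "A / 2 = q" "C = D + 2 * E - B" for A B C D E q :: real
    using that by linarith
  ultimately show ?thesis using eq by blast
qed

section \<open>Weak derivatives on an interval and on a product\<close>

lemma test_functionI:
  assumes "\<And>k. Ck k \<phi>" "{x. \<phi> x \<noteq> 0} \<subseteq> K" "compact K" "K \<subseteq> S"
  shows "test_function S \<phi>"
proof -
  have sub: "closure {x. \<phi> x \<noteq> 0} \<subseteq> K"
    using assms(2) compact_imp_closed[OF assms(3)] by (rule closure_minimal)
  moreover have "compact (closure {x. \<phi> x \<noteq> 0})"
    using bounded_subset[OF compact_imp_bounded[OF assms(3)] sub] by (simp add: compact_eq_bounded_closed)
  ultimately show ?thesis using assms unfolding test_function_def by blast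
qed

text \<open>The support of a slice lies in the projection of the compact support, which is compact
  and contained in \<open>B\<close>; smoothness comes from composing with the affine map that
  inserts \<open>x\<close>.\<close>

lemma test_function_slice_snd:
  fixes \<phi> :: "'a::euclidean_space \<times> 'b::euclidean_space \<Rightarrow> real"
  assumes "test_function (A \<times> B) \<phi>"
  shows "test_function B (\<lambda>y. \<phi> (x, y))"
    "frechet_derivative (\<lambda>y. \<phi> (x, y)) (at y) v = frechet_derivative \<phi> (at (x, y)) (0, v)"
proof -
  have L: "linear (\<lambda>y. (0, y) :: 'a \<times> 'b)" by (rule linearI) auto
  have eq: "(x, y) = (x, 0) + (0, y)" for y :: 'b by simp
  show "test_function B (\<lambda>y. \<phi> (x, y))"
  proof (rule test_functionI)
    show "Ck k (\<lambda>y. \<phi> (x, y))" for k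
      using Ck_compose_affine[OF L, of k \<phi> "(x, 0)"] assms by (simp add: test_function_def)
    show "{y. \<phi> (x, y) \<noteq> 0} \<subseteq> snd ` closure {z. \<phi> z \<noteq> 0}"
      using closure_subset[of "{z. \<phi> z \<noteq> 0}"] by force
    show "compact (snd ` closure {z. \<phi> z \<noteq> 0})"
      using assms by (intro compact_continuous_image continuous_intros) (simp add: test_function_def)
    show "snd ` closure {z. \<phi> z \<noteq> 0} \<subseteq> B"
      using assms by (auto simp: test_function_def)
  qed
  show "frechet_derivative (\<lambda>y. \<phi> (x, y)) (at y) v = frechet_derivative \<phi> (at (x, y)) (0, v)"
    using frechet_derivative_chain_affine(2)[OF L, of \<phi> "(x, 0)" y v]
      test_function_differentiable[OF assms] by simp
qed

lemma test_function_slice_fst: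
  fixes \<phi> :: "'a::euclidean_space \<times> 'b::euclidean_space \<Rightarrow> real"
  assumes "test_function (A \<times> B) \<phi>"
  shows "test_function A (\<lambda>x. \<phi> (x, y))"
    "frechet_derivative (\<lambda>x. \<phi> (x, y)) (at x) v = frechet_derivative \<phi> (at (x, y)) (v, 0)"
proof -
  have L: "linear (\<lambda>x. (x, 0) :: 'a \<times> 'b)" by (rule linearI) auto
  show "test_function A (\<lambda>x. \<phi> (x, y))"
  proof (rule test_functionI)
    show "Ck k (\<lambda>x. \<phi> (x, y))" for k
      using Ck_compose_affine[OF L, of k \<phi> "(0, y)"] assms by (simp add: test_function_def)
    show "{x. \<phi> (x, y) \<noteq> 0} \<subseteq> fst ` closure {z. \<phi> z \<noteq> 0}"
      using closure_subset[of "{z. \<phi> z \<noteq> 0}"] by force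
    show "compact (fst ` closure {z. \<phi> z \<noteq> 0})"
      using assms by (intro compact_continuous_image continuous_intros) (simp add: test_function_def)
    show "fst ` closure {z. \<phi> z \<noteq> 0} \<subseteq> A"
      using assms by (auto simp: test_function_def)
  qed
  show "frechet_derivative (\<lambda>x. \<phi> (x, y)) (at x) v = frechet_derivative \<phi> (at (x, y)) (v, 0)"
    using frechet_derivative_chain_affine(2)[OF L, of \<phi> "(0, y)" x v]
      test_function_differentiable[OF assms] by simp
qed

text \<open>By Fubini the defining identity on the product is the integral over \<open>A\<close> of
  the identities on the slices, each tested with a slice of \<phi>.\<close>

lemma has_weak_deriv_slices_snd:
  fixes f g :: "'a::euclidean_space \<times> 'b::euclidean_space \<Rightarrow> real"
  assumes A: "open A" and B: "open B"
    and f: "integrable (leb (A \<times> B)) f" and g: "integrable (leb (A \<times> B)) g"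
    and d: "\<And>x. x \<in> A \<Longrightarrow> has_weak_deriv B v (\<lambda>y. f (x, y)) (\<lambda>y. g (x, y))"
  shows "has_weak_deriv (A \<times> B) (0, v) f g"
proof -
  have AB: "open (A \<times> B)" using A B by (rule open_Times)
  have li: "locally_integrable (A \<times> B) f" "locally_integrable (A \<times> B) g"
    using integrable_imp_locally_integrable[OF AB] f g by auto
  have bor: "A \<in> sets borel" "B \<in> sets borel" using A B by auto
  interpret pair_sigma_finite "leb A" "leb B" by (rule pair_sigma_finite_leb[OF bor])
  have "(\<integral>z. f z * frechet_derivative \<phi> (at z) (0, v) \<partial>leb (A \<times> B)) = - (\<integral>z. g z * \<phi> z \<partial>leb (A \<times> B))"
    if t: "test_function (A \<times> B) \<phi>" for \<phi>
  proof -
    have "(\<integral>z. f z * frechet_derivative \<phi> (at z) (0, v) \<partial>leb (A \<times> B))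
        = (\<integral>x. (\<integral>y. f (x, y) * frechet_derivative \<phi> (at (x, y)) (0, v) \<partial>leb B) \<partial>leb A)"
      using integrable_locally_integrable_mult_test[OF AB li(1) test_function_frechet_derivative[OF t], of "(0, v)"]
      unfolding leb_Times[OF bor] by (rule integral_fst'[symmetric])
    also have "\<dots> = (\<integral>x. - (\<integral>y. g (x, y) * \<phi> (x, y) \<partial>leb B) \<partial>leb A)"
    proof (rule Bochner_Integration.integral_cong[OF refl])
      fix x assume "x \<in> space (leb A)"
      then have "x \<in> A" by (simp add: space_restrict_space)
      from d[OF this] show "(\<integral>y. f (x, y) * frechet_derivative \<phi> (at (x, y)) (0, v) \<partial>leb B)
          = - (\<integral>y. g (x, y) * \<phi> (x, y) \<partial>leb B)"
        unfolding has_weak_deriv_def test_function_slice_snd(2)[OF t, symmetric]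
        using test_function_slice_snd(1)[OF t, of x] by blast
    qed
    also have "\<dots> = - (\<integral>x. (\<integral>y. g (x, y) * \<phi> (x, y) \<partial>leb B) \<partial>leb A)"
      by simp
    also have "(\<integral>x. (\<integral>y. g (x, y) * \<phi> (x, y) \<partial>leb B) \<partial>leb A) = (\<integral>z. g z * \<phi> z \<partial>leb (A \<times> B))"
      using integrable_locally_integrable_mult_test[OF AB li(2) t]
      unfolding leb_Times[OF bor] by (rule integral_fst')
    finally show ?thesis .
  qed
  then show ?thesis using li by (simp add: has_weak_deriv_def)
qed

lemma has_weak_deriv_slices_fst:
  fixes f g :: "'a::euclidean_space \<times> 'b::euclidean_space \<Rightarrow> real"
  assumes A: "open A" and B: "open B"
    and f: "integrable (leb (A \<times> B)) f" and g: "integrable (leb (A \<times> B)) g"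
    and d: "\<And>y. y \<in> B \<Longrightarrow> has_weak_deriv A v (\<lambda>x. f (x, y)) (\<lambda>x. g (x, y))"
  shows "has_weak_deriv (A \<times> B) (v, 0) f g"
proof -
  have AB: "open (A \<times> B)" using A B by (rule open_Times)
  have li: "locally_integrable (A \<times> B) f" "locally_integrable (A \<times> B) g"
    using integrable_imp_locally_integrable[OF AB] f g by auto
  have bor: "A \<in> sets borel" "B \<in> sets borel" using A B by auto
  interpret pair_sigma_finite "leb A" "leb B" by (rule pair_sigma_finite_leb[OF bor])
  have snd: "(\<integral>z. h z \<partial>leb (A \<times> B)) = (\<integral>y. (\<integral>x. h (x, y) \<partial>leb A) \<partial>leb B)"
    if "integrable (leb (A \<times> B)) h" for h :: "'a \<times> 'b \<Rightarrow> real"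
    using integral_snd[of "\<lambda>x y. h (x, y)"] that by (simp add: leb_Times[OF bor])
  have "(\<integral>z. f z * frechet_derivative \<phi> (at z) (v, 0) \<partial>leb (A \<times> B)) = - (\<integral>z. g z * \<phi> z \<partial>leb (A \<times> B))"
    if t: "test_function (A \<times> B) \<phi>" for \<phi>
  proof -
    have "(\<integral>z. f z * frechet_derivative \<phi> (at z) (v, 0) \<partial>leb (A \<times> B))
        = (\<integral>y. (\<integral>x. f (x, y) * frechet_derivative \<phi> (at (x, y)) (v, 0) \<partial>leb A) \<partial>leb B)"
      using integrable_locally_integrable_mult_test[OF AB li(1) test_function_frechet_derivative[OF t], of "(v, 0)"]
      by (rule snd)
    also have "\<dots> = (\<integral>y. - (\<integral>x. g (x, y) * \<phi> (x, y) \<partial>leb A) \<partial>leb B)"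
    proof (rule Bochner_Integration.integral_cong[OF refl])
      fix y assume "y \<in> space (leb B)"
      then have "y \<in> B" by (simp add: space_restrict_space)
      from d[OF this] show "(\<integral>x. f (x, y) * frechet_derivative \<phi> (at (x, y)) (v, 0) \<partial>leb A)
          = - (\<integral>x. g (x, y) * \<phi> (x, y) \<partial>leb A)"
        unfolding has_weak_deriv_def test_function_slice_fst(2)[OF t, symmetric]
        using test_function_slice_fst(1)[OF t, of y] by blast
    qed
    also have "\<dots> = - (\<integral>y. (\<integral>x. g (x, y) * \<phi> (x, y) \<partial>leb A) \<partial>leb B)"
      by simp
    also have "(\<integral>y. (\<integral>x. g (x, y) * \<phi> (x, y) \<partial>leb A) \<partial>leb B) = (\<integral>z. g z * \<phi> z \<partial>leb (A \<times> B))"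
      using integrable_locally_integrable_mult_test[OF AB li(2) t] by (rule snd[symmetric])
    finally show ?thesis .
  qed
  then show ?thesis using li by (simp add: has_weak_deriv_def)
qed

lemma test_function_real_derivative:
  fixes \<phi> :: "real \<Rightarrow> real"
  assumes "test_function S \<phi>"
  shows "(\<phi> has_real_derivative frechet_derivative \<phi> (at t) 1) (at t)"
proof -
  have d: "(\<phi> has_derivative frechet_derivative \<phi> (at t)) (at t)"
    using test_function_differentiable[OF assms] by (simp flip: frechet_derivative_works)
  have "frechet_derivative \<phi> (at t) = (\<lambda>x. x * frechet_derivative \<phi> (at t) 1)"
  proof
    show "frechet_derivative \<phi> (at t) x = x * frechet_derivative \<phi> (at t) 1" for x
      using linear_cmul[OF has_derivative_linear[OF d], of x 1] by simp
  qed
  also have "\<dots> = (*) (frechet_derivative \<phi> (at t) 1)" by (simp add: fun_eq_iff)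
  finally show ?thesis using d unfolding has_field_derivative_def by metis
qed

text \<open>Integration by parts: the product rule for \<open>G\<close> times \<phi> is evaluated at
  \<open>T\<close>, and \<phi> vanishes at both ends because its support lies in the open
  interval.\<close>

lemma indef_imp_has_weak_deriv:
  assumes T: "T > 0" and G: "indef T G g"
  shows "has_weak_deriv {0<..<T} 1 G g"
proof -
  have g: "set_integrable lborel {0<..<T} g" using G by (simp add: indef_def)
  have cG: "continuous_on {0..T} G" by (rule indef_continuous[OF G])
  have li: "locally_integrable {0<..<T} G" "locally_integrable {0<..<T} g"
    using integrable_imp_locally_integrable[of "{0<..<T}"] g continuous_imp_set_integrable(1)[OF cG]
    by (simp_all add: leb_integrable)
  have "(\<integral>t. G t * frechet_derivative \<phi> (at t) 1 \<partial>leb {0<..<T}) = - (\<integral>t. g t * \<phi> t \<partial>leb {0<..<T})"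
    if t: "test_function {0<..<T} \<phi>" for \<phi>
  proof -
    let ?\<phi>' = "\<lambda>t. frechet_derivative \<phi> (at t) 1"
    have t': "test_function {0<..<T} ?\<phi>'" by (rule test_function_frechet_derivative[OF t])
    have "indef T \<phi> ?\<phi>'"
      by (rule indef_C1[OF test_function_real_derivative[OF t] test_function_continuous_on[OF t']])
    from indef_mult[OF G this]
    have "G T * \<phi> T = G 0 * \<phi> 0 + (LBINT t:{0<..<T}. g t * \<phi> t + G t * ?\<phi>' t)"
      using T unfolding indef_def by (elim conjE ballE[of _ _ T]) auto
    then have "0 = (\<integral>t. g t * \<phi> t + G t * ?\<phi>' t \<partial>leb {0<..<T})"
      using test_function_eq_0[OF t] by (simp add: leb_integral)
    also have "\<dots> = (\<integral>t. g t * \<phi> t \<partial>leb {0<..<T}) + (\<integral>t. G t * ?\<phi>' t \<partial>leb {0<..<T})"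
      by (intro Bochner_Integration.integral_add integrable_locally_integrable_mult_test li t t') auto
    finally show ?thesis by simp
  qed
  then show ?thesis using li by (simp add: has_weak_deriv_def)
qed

section \<open>The du Bois-Reymond lemma and regular representatives of \<open>H20\<close>\<close>

lemma test_function_linear_combination:
  assumes "test_function S \<phi>" "test_function S \<psi>"
  shows "test_function S (\<lambda>x. \<phi> x - k * \<psi> x)"
proof (rule test_functionI)
  show "Ck n (\<lambda>x. \<phi> x - k * \<psi> x)" for n
    using assms by (intro Ck_diff Ck_mult Ck_const) (auto simp: test_function_def)
  show "{x. \<phi> x - k * \<psi> x \<noteq> 0} \<subseteq> closure {x. \<phi> x \<noteq> 0} \<union> closure {x. \<psi> x \<noteq> 0}"
  proof
    fix x assume "x \<in> {x. \<phi> x - k * \<psi> x \<noteq> 0}"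
    then have "\<phi> x \<noteq> 0 \<or> \<psi> x \<noteq> 0" by auto
    then show "x \<in> closure {x. \<phi> x \<noteq> 0} \<union> closure {x. \<psi> x \<noteq> 0}"
      using closure_subset[of "{x. \<phi> x \<noteq> 0}"] closure_subset[of "{x. \<psi> x \<noteq> 0}"] by blast
  qed
qed (use assms in \<open>auto simp: test_function_def\<close>)

text \<open>A primitive vanishes to the left of the support by construction and to the right of it
  because the total integral is 0, so it is compactly supported again.\<close>

lemma test_function_antiderivative:
  fixes T :: real
  assumes \<theta>: "test_function {0<..<T} \<theta>" and 0: "(\<integral>t. \<theta> t \<partial>leb {0<..<T}) = 0"
  obtains \<Theta> where "test_function {0<..<T} \<Theta>" "\<And>t. frechet_derivative \<Theta> (at t) 1 = \<theta> t"
proof -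
  let ?C = "closure {t. \<theta> t \<noteq> 0}"
  have C: "compact ?C" "?C \<subseteq> {0<..<T}" using \<theta> by (auto simp: test_function_def)
  obtain a b where ab: "0 < a" "b < T" "?C \<subseteq> {a..b}"
  proof (cases "?C = {}")
    case True
    \<comment> \<open>For empty support any \<open>a > 0\<close> and \<open>b < T\<close> serve; the
      interval between them may be empty.\<close>
    have s: "?C \<subseteq> {1..T - 1}" unfolding True by (rule empty_subsetI)
    show ?thesis by (rule that[OF _ _ s]) simp_all
  next
    case False
    obtain a where a: "a \<in> ?C" "\<forall>t\<in>?C. a \<le> t" using compact_attains_inf[OF C(1) False] ..
    obtain b where b: "b \<in> ?C" "\<forall>t\<in>?C. t \<le> b" using compact_attains_sup[OF C(1) False] ..
    have "0 < a" "b < T" using subsetD[OF C(2) a(1)] subsetD[OF C(2) b(1)] by simp_all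
    moreover have "?C \<subseteq> {a..b}"
      by (rule subsetI) (simp only: atLeastAtMost_iff a(2)[rule_format] b(2)[rule_format])
    ultimately show ?thesis by (rule that)
  qed
  have z: "\<theta> t = 0" if "t \<notin> {a..b}" for t
    using subset_trans[OF closure_subset ab(3)] that by blast
  have c: "continuous_on A \<theta>" for A by (rule test_function_continuous_on[OF \<theta>])
  define \<Theta> where "\<Theta> t = integral {0..t} \<theta>" for t
  have lo: "\<Theta> t = 0" if "t < a" for t
    unfolding \<Theta>_def using that z by (intro integral_unique has_integral_is_0) auto
  have hi: "\<Theta> t = 0" if "t > b" for t
  proof -
    have "\<Theta> t = (LBINT s:{0..t}. \<theta> s)"
      unfolding \<Theta>_def
      by (rule set_borel_integral_eq_integral(2)[symmetric]) (rule borel_integrable_atLeastAtMost'[OF c])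
    also have "\<dots> = (LBINT s:{0<..<T}. \<theta> s)"
      unfolding set_lebesgue_integral_def using that z ab
      by (intro Bochner_Integration.integral_cong) (auto simp: indicator_def)
    also have "\<dots> = 0" using 0 by (simp add: leb_integral)
    finally show ?thesis .
  qed
  have der: "(\<Theta> has_real_derivative \<theta> t) (at t)" for t
  proof (cases "t > 0")
    case True
    have "(\<Theta> has_real_derivative \<theta> t) (at t within {0..t + 1})"
      unfolding \<Theta>_def[abs_def] using True by (intro integral_has_real_derivative c) auto
    then show ?thesis using True by (simp add: at_within_Icc_at)
  next
    case False
    have "((\<lambda>_. 0) has_real_derivative 0) (at t)" by simp
    then have "(\<Theta> has_real_derivative 0) (at t)"
      by (rule has_field_derivative_transform_within_open[of _ _ _ "{..<a}"]) (use False ab lo in auto)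
    then show ?thesis using z[of t] False ab by simp
  qed
  \<comment> \<open>Smoothness of \<Theta> is read off from that of \<theta>, which
    \<open>Ck_real_iff\<close> permits at successor orders only; hence the detour through
    \<open>Suc k\<close>.\<close>
  have "Ck k \<Theta>" for k
  proof (rule Ck_Suc_D)
    show "Ck (Suc k) \<Theta>" using \<theta> by (simp only: Ck_real_iff[OF der] test_function_def)
  qed
  then have "test_function {0<..<T} \<Theta>"
  proof (rule test_functionI)
    show "{t. \<Theta> t \<noteq> 0} \<subseteq> {a..b}"
      using lo hi by (auto simp: not_less[symmetric])
  qed (use ab in auto)
  moreover have "frechet_derivative \<Theta> (at t) 1 = \<theta> t" for t
    by (simp flip: frechet_derivative_at[OF der[of t, unfolded has_field_derivative_def]])
  ultimately show ?thesis by (rule that)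
qed

text \<open>Fix a test function \<psi> with nonzero integral. Every \<phi> minus a suitable multiple
  of \<psi> has mean zero, hence is the derivative of a test function and is annihilated by
  \<open>D\<close>. The value \<open>C\<close> is what testing with \<psi> dictates.\<close>

lemma has_weak_deriv_zero_imp_AE_const:
  fixes T :: real
  assumes T: "T > 0" and D: "has_weak_deriv {0<..<T} 1 D (\<lambda>_. 0)"
  shows "\<exists>C. AE t in leb {0<..<T}. D t = C"
proof -
  let ?I = "leb {0<..<T}"
  have oI: "open {0<..<T}" by simp
  have Dl: "locally_integrable {0<..<T} D" using D by (simp add: has_weak_deriv_def)
  have one: "locally_integrable {0<..<T} (\<lambda>_. 1)"
    by (rule integrable_imp_locally_integrable) (simp_all add: leb_integrable continuous_imp_set_integrable)
  \<comment> \<open>The middle third is a box with closure inside the interval. Integrals of its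
    bumps tend to its length T/3, so one of them is nonzero and supplies \<psi>.\<close>
  have sub: "cbox (T / 3) (2 * T / 3) \<subseteq> {0<..<T}" using T by auto
  have "(LBINT t:box (T / 3) (2 * T / 3). 1) = T / 3"
    using T by (simp add: set_lebesgue_integral_def)
  with integral_box_bump_tendsto(2)[OF oI one sub]
  have lim: "(\<lambda>n. \<integral>t. 1 * box_bump n (T / 3) (2 * T / 3) t \<partial>?I) \<longlonglongrightarrow> T / 3"
    by metis
  have "\<exists>n. (\<integral>t. 1 * box_bump n (T / 3) (2 * T / 3) t \<partial>?I) \<noteq> 0"
  proof (rule ccontr)
    assume "\<nexists>n. (\<integral>t. 1 * box_bump n (T / 3) (2 * T / 3) t \<partial>?I) \<noteq> 0"
    with lim have "(\<lambda>n::nat. 0) \<longlonglongrightarrow> T / 3" by simp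
    with T show False by (simp add: LIMSEQ_const_iff)
  qed
  then obtain \<psi> where \<psi>: "test_function {0<..<T} \<psi>" "(\<integral>t. \<psi> t \<partial>?I) \<noteq> 0"
    using test_function_box_bump[OF sub] by auto
  define C where "C = (\<integral>t. D t * \<psi> t \<partial>?I) / (\<integral>t. \<psi> t \<partial>?I)"
  have Cl: "locally_integrable {0<..<T} (\<lambda>_. C)"
    by (rule integrable_imp_locally_integrable) (simp_all add: leb_integrable continuous_imp_set_integrable)
  have "AE t in ?I. D t - C = 0"
  proof (rule AE_zero_if_test_integrals_zero[OF oI locally_integrable_diff[OF Dl Cl]])
    fix \<phi> :: "real \<Rightarrow> real" assume \<phi>: "test_function {0<..<T} \<phi>"
    define k where "k = (\<integral>t. \<phi> t \<partial>?I) / (\<integral>t. \<psi> t \<partial>?I)"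
    have ti: "integrable ?I \<phi>" "integrable ?I \<psi>"
      using integrable_locally_integrable_mult_test[OF oI one] \<phi> \<psi>(1) by force+
    have Di: "integrable ?I (\<lambda>t. D t * \<phi> t)" "integrable ?I (\<lambda>t. D t * \<psi> t)"
      using integrable_locally_integrable_mult_test[OF oI Dl] \<phi> \<psi>(1) by auto
    have "(\<integral>t. \<phi> t - k * \<psi> t \<partial>?I) = 0"
      using ti \<psi>(2) by (simp add: k_def)
    then obtain \<Theta> where \<Theta>: "test_function {0<..<T} \<Theta>" "\<And>t. frechet_derivative \<Theta> (at t) 1 = \<phi> t - k * \<psi> t"
      using test_function_antiderivative[OF test_function_linear_combination[OF \<phi> \<psi>(1)]] by metis
    have "(\<integral>t. D t * (\<phi> t - k * \<psi> t) \<partial>?I) = 0"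
    proof -
      have "(\<integral>t. D t * frechet_derivative \<Theta> (at t) 1 \<partial>?I) = - (\<integral>t. 0 * \<Theta> t \<partial>?I)"
        using D \<Theta>(1) unfolding has_weak_deriv_def by blast
      then show ?thesis unfolding \<Theta>(2) by simp
    qed
    also have "(\<integral>t. D t * (\<phi> t - k * \<psi> t) \<partial>?I) = (\<integral>t. D t * \<phi> t - k * (D t * \<psi> t) \<partial>?I)"
      by (simp add: algebra_simps)
    also have "\<dots> = (\<integral>t. D t * \<phi> t \<partial>?I) - k * (\<integral>t. D t * \<psi> t \<partial>?I)"
      using Di by simp
    finally have "(\<integral>t. D t * \<phi> t \<partial>?I) = C * (\<integral>t. \<phi> t \<partial>?I)"
      by (simp add: k_def C_def mult.commute)
    then show "(\<integral>t. (D t - C) * \<phi> t \<partial>?I) = 0"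
      using Di ti by (simp add: left_diff_distrib)
  qed
  then show ?thesis by (auto elim: eventually_mono)
qed

text \<open>A null set cannot contain a whole interval next to 0. This carries identities that hold
  almost everywhere to the initial time, once continuity is available.\<close>

lemma AE_Ioo_near_0:
  fixes T :: real
  assumes T: "T > 0" and P: "AE t in leb {0<..<T}. P t" and \<delta>: "\<delta> > 0"
  shows "\<exists>t. 0 < t \<and> t < T \<and> t < \<delta> \<and> P t"
proof (rule ccontr)
  assume no: "\<nexists>t. 0 < t \<and> t < T \<and> t < \<delta> \<and> P t"
  have "AE t in lborel. t \<in> {0<..<T} \<longrightarrow> P t" using P by (simp add: AE_restrict_space_iff)
  then have "AE t in lborel. t \<notin> {0<..<min T \<delta>}"
    by eventually_elim (use no in auto)
  then have "{0<..<min T \<delta>} \<in> null_sets lborel"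
    by (subst AE_iff_null_sets) simp_all
  then show False using T \<delta> by (simp add: null_sets_def)
qed

text \<open>Integrating the weak second derivative twice recovers \<open>u\<close> up to a constant.
  The initial condition refers to some continuous representative \<open>W\<close>, so the constant
  is determined by comparing \<open>W\<close> with the integral \<open>w\<close> near 0.\<close>

lemma H20_representation:
  assumes T: "T > 0" and u: "u \<in> H20 T"
  obtains w r h where "indef T w r" "indef T r h" "w 0 = 0" "h \<in> L2 {0<..<T}"
    "AE t in leb {0<..<T}. u t = w t"
proof -
  let ?I = "leb {0<..<T}"
  have antideriv: "\<exists>C. AE t in ?I. f t = C + (LBINT s:{0<..<t}. g s)"
    if d: "has_weak_deriv {0<..<T} 1 f g" and g: "g \<in> L2 {0<..<T}" for f g
  proof -
    have "set_integrable lborel {0<..<T} g"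
      using L2_imp_integrable[OF _ _ g] by (simp add: leb_integrable)
    then have i: "indef T (\<lambda>t. 0 + (LBINT s:{0<..<t}. g s)) g" by (rule indef_integral)
    \<comment> \<open>The difference of two functions is written as a sum over \<open>bool\<close>
      with coefficients 1 and -1, to fit \<open>has_weak_deriv_sum\<close>.\<close>
    have "has_weak_deriv {0<..<T} 1 (\<lambda>t. \<Sum>b\<in>UNIV. (if b then 1 else - 1) * (if b then f t else 0 + (LBINT s:{0<..<t}. g s)))
        (\<lambda>t. \<Sum>b\<in>UNIV. (if b then 1 else - 1) * (if b then g t else g t))"
    proof (rule has_weak_deriv_sum)
      show "has_weak_deriv {0<..<T} 1 (\<lambda>t. if b then f t else 0 + (LBINT s:{0<..<t}. g s)) (\<lambda>t. if b then g t else g t)" for b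
        using d indef_imp_has_weak_deriv[OF T i] by (cases b) simp_all
    qed simp
    then have "has_weak_deriv {0<..<T} 1 (\<lambda>t. f t - (LBINT s:{0<..<t}. g s)) (\<lambda>_. 0)"
      by (simp add: UNIV_bool)
    from has_weak_deriv_zero_imp_AE_const[OF T this] obtain C
      where "AE t in ?I. f t - (LBINT s:{0<..<t}. g s) = C" by blast
    then show ?thesis by (intro exI[of _ C]) (auto elim: eventually_mono)
  qed
  obtain g where g: "g \<in> Hk 1 {0<..<T}" "has_weak_deriv {0<..<T} 1 u g"
    using u by (auto simp: H20_def numeral_2_eq_2)
  obtain h where h: "h \<in> L2 {0<..<T}" "has_weak_deriv {0<..<T} 1 g h" and gL: "g \<in> L2 {0<..<T}"
    using g(1) by auto
  obtain W where W: "continuous_on {0..T} W" "AE t in ?I. u t = W t" "W 0 = 0"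
    using u by (auto simp: H20_def)
  obtain C where C: "AE t in ?I. g t = C + (LBINT s:{0<..<t}. h s)" using antideriv[OF h(2,1)] by blast
  define r where "r t = C + (LBINT s:{0<..<t}. h s)" for t
  have hi: "set_integrable lborel {0<..<T} h"
    using L2_imp_integrable[OF _ _ h(1)] by (simp add: leb_integrable)
  have r: "indef T r h" unfolding r_def[abs_def] using hi by (rule indef_integral)
  have ri: "set_integrable lborel {0<..<T} r"
    by (rule continuous_imp_set_integrable[OF indef_continuous[OF r]])
  define w where "w t = 0 + (LBINT s:{0<..<t}. r s)" for t
  have w: "indef T w r" unfolding w_def[abs_def] using ri by (rule indef_integral)
  have w0: "w 0 = 0" by (simp add: w_def set_lebesgue_integral_def)
  have gr: "AE t in ?I. g t = r t" using C by (simp add: r_def)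
  obtain C' where "AE t in ?I. u t = C' + (LBINT s:{0<..<t}. g s)" using antideriv[OF g(2) gL] by blast
  moreover have "(LBINT s:{0<..<t}. g s) = w t" if "t \<in> {0<..<T}" for t
  proof -
    have gi: "set_integrable lborel {0<..<T} g"
      using L2_imp_integrable[OF _ _ gL] by (simp add: leb_integrable)
    have "AE s in lborel. s \<in> {0<..<T} \<longrightarrow> g s = r s" using gr by (simp add: AE_restrict_space_iff)
    then have "AE s in lborel. indicator {0<..<t} s *\<^sub>R g s = indicator {0<..<t} s *\<^sub>R r s"
      by eventually_elim (use that in \<open>auto simp: indicator_def\<close>)
    then show ?thesis
      using set_integrable_sub_Ioo[OF gi, of t] set_integrable_sub_Ioo[OF ri, of t] that
      unfolding w_def set_lebesgue_integral_def set_integrable_def by (simp add: integral_cong_AE)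
  qed
  ultimately have uw: "AE t in ?I. u t = C' + w t"
    by (auto simp: AE_restrict_space_iff elim!: eventually_mono)
  \<comment> \<open>\<open>W - w\<close> is continuous, is 0 at time 0, and equals \<open>C'\<close>
    at times arbitrarily close to 0.\<close>
  have "C' = 0"
  proof (rule ccontr)
    assume C': "C' \<noteq> 0"
    have ae: "AE t in ?I. W t - w t = C'" using uw W(2) by eventually_elim simp
    have "continuous_on {0..T} (\<lambda>t. W t - w t)"
      using W(1) indef_continuous[OF w] by (rule continuous_on_diff)
    then obtain \<delta> where "\<delta> > 0" "\<forall>t\<in>{0..T}. dist t 0 < \<delta> \<longrightarrow> dist (W t - w t) (W 0 - w 0) < \<bar>C'\<bar>"
      unfolding continuous_on_iff using T C' by (metis atLeastAtMost_iff less_eq_real_def zero_less_abs_iff)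
    moreover obtain t where "0 < t" "t < T" "t < \<delta>" "W t - w t = C'"
      using AE_Ioo_near_0[OF T ae \<open>\<delta> > 0\<close>] by blast
    ultimately show False using W(3) w0 by (auto simp: dist_real_def)
  qed
  then have "AE t in ?I. u t = w t" using uw by simp
  then show ?thesis by (rule that[OF w r w0 h(1)])
qed

section \<open>Sums of products on the space-time cylinder\<close>

text \<open>The scalar estimate is summed over the coordinates; the zero initial value removes the
  boundary term in each.\<close>

lemma exp_weight_energy_vector:
  fixes P Q :: "real \<Rightarrow> 'a::euclidean_space"
  assumes T: "T > 0" and P: "\<And>b. b \<in> Basis \<Longrightarrow> indef T (\<lambda>t. P t \<bullet> b) (\<lambda>t. Q t \<bullet> b)"
    and P0: "P 0 = 0"
  shows "(LBINT t:{0<..<T}. exp (- t / T) * (Q t \<bullet> P t)) \<ge> (LBINT t:{0<..<T}. P t \<bullet> P t) / (2 * exp 1 * T)"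
proof -
  let ?e = "\<lambda>t. exp (- t / T)"
  have ce: "continuous_on {0..T} ?e" using T by (intro continuous_intros) auto
  have i1: "set_integrable lborel {0<..<T} (\<lambda>t. ?e t * ((Q t \<bullet> b) * (P t \<bullet> b)))" if "b \<in> Basis" for b
    using set_integrable_continuous_mult[OF continuous_on_mult[OF ce indef_continuous[OF P[OF that]]], of "\<lambda>t. Q t \<bullet> b"]
      P[OF that] by (simp add: indef_def mult_ac)
  have i2: "set_integrable lborel {0<..<T} (\<lambda>t. (P t \<bullet> b)\<^sup>2)" if "b \<in> Basis" for b
    by (intro continuous_imp_set_integrable continuous_on_power indef_continuous[OF P[OF that]])
  have s: "(LBINT t:{0<..<T}. (\<Sum>b\<in>Basis. f b t)) = (\<Sum>b\<in>Basis. (LBINT t:{0<..<T}. f b t))"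
    if "\<And>b::'a. b \<in> Basis \<Longrightarrow> set_integrable lborel {0<..<T} (f b)" for f
    using that unfolding set_lebesgue_integral_def set_integrable_def scaleR_sum_right
    by (rule Bochner_Integration.integral_sum)
  have "(LBINT t:{0<..<T}. P t \<bullet> P t) / (2 * exp 1 * T)
      = (\<Sum>b\<in>Basis. (LBINT t:{0<..<T}. (P t \<bullet> b)\<^sup>2) / (2 * exp 1 * T))"
    unfolding euclidean_inner[of "P t" "P t" for t] power2_eq_square[symmetric]
    by (subst s[OF i2]) (simp_all add: sum_divide_distrib)
  also have "\<dots> \<le> (\<Sum>b\<in>Basis. (LBINT t:{0<..<T}. ?e t * ((Q t \<bullet> b) * (P t \<bullet> b))))"
    using exp_weight_energy[OF T P] P0 by (intro sum_mono) simp
  also have "\<dots> = (LBINT t:{0<..<T}. ?e t * (Q t \<bullet> P t))"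
    unfolding euclidean_inner[of "Q t" "P t" for t] sum_distrib_left
    by (subst s[OF i1]) simp_all
  finally show ?thesis .
qed

text \<open>Lifts an energy estimate in time, valid for each point of space, to the cylinder;
  \<theta> carries the contribution of the initial values.\<close>

lemma leb_Times_integral_mono:
  fixes \<Phi> \<Psi> :: "'a::euclidean_space \<times> 'b::euclidean_space \<Rightarrow> real"
  assumes A: "A \<in> sets borel" and B: "B \<in> sets borel"
    and \<Phi>: "integrable (leb (A \<times> B)) \<Phi>" and \<Psi>: "integrable (leb (A \<times> B)) \<Psi>"
    and \<theta>: "integrable (leb A) \<theta>"
    and le: "\<And>x. x \<in> A \<Longrightarrow> (\<integral>y. \<Phi> (x, y) \<partial>leb B) \<le> (\<integral>y. \<Psi> (x, y) \<partial>leb B) + \<theta> x"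
  shows "(\<integral>z. \<Phi> z \<partial>leb (A \<times> B)) \<le> (\<integral>z. \<Psi> z \<partial>leb (A \<times> B)) + (\<integral>x. \<theta> x \<partial>leb A)"
proof -
  interpret pair_sigma_finite "leb A" "leb B" by (rule pair_sigma_finite_leb[OF A B])
  note \<Phi>' = \<Phi>[unfolded leb_Times[OF A B]] and \<Psi>' = \<Psi>[unfolded leb_Times[OF A B]]
  have "(\<integral>z. \<Phi> z \<partial>leb (A \<times> B)) = (\<integral>x. (\<integral>y. \<Phi> (x, y) \<partial>leb B) \<partial>leb A)"
    unfolding leb_Times[OF A B] by (rule integral_fst'[OF \<Phi>', symmetric])
  also have "\<dots> \<le> (\<integral>x. (\<integral>y. \<Psi> (x, y) \<partial>leb B) + \<theta> x \<partial>leb A)"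
    by (intro integral_mono integrable_fst'[OF \<Phi>'] Bochner_Integration.integrable_add
        integrable_fst'[OF \<Psi>'] \<theta> le) (simp add: space_restrict_space)
  also have "\<dots> = (\<integral>x. (\<integral>y. \<Psi> (x, y) \<partial>leb B) \<partial>leb A) + (\<integral>x. \<theta> x \<partial>leb A)"
    by (rule Bochner_Integration.integral_add[OF integrable_fst'[OF \<Psi>'] \<theta>])
  also have "(\<integral>x. (\<integral>y. \<Psi> (x, y) \<partial>leb B) \<partial>leb A) = (\<integral>z. \<Psi> z \<partial>leb (A \<times> B))"
    unfolding leb_Times[OF A B] by (rule integral_fst'[OF \<Psi>'])
  finally show ?thesis .
qed

lemma l2_norm_triangle:
  assumes "f \<in> L2 S" "g \<in> L2 S"
  shows "l2_norm S (\<lambda>x. f x + g x) \<le> l2_norm S f + l2_norm S g"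
proof (rule power2_le_imp_le)
  have "(l2_norm S (\<lambda>x. f x + g x))\<^sup>2 = l2_inner S f f + 2 * l2_inner S f g + l2_inner S g g"
    using l2_inner_combination[OF assms, of 1 1] by (simp add: l2_norm_sq)
  also have "\<dots> \<le> (l2_norm S f + l2_norm S g)\<^sup>2"
    using l2_inner_Cauchy_Schwarz[OF assms] by (simp add: power2_sum l2_norm_sq)
  finally show "(l2_norm S (\<lambda>x. f x + g x))\<^sup>2 \<le> (l2_norm S f + l2_norm S g)\<^sup>2" .
qed (intro add_nonneg_nonneg l2_norm_nonneg)

lemma l2_norm_cong_AE:
  assumes "f \<in> borel_measurable (leb S)" "g \<in> borel_measurable (leb S)" "AE x in leb S. f x = g x"
  shows "l2_norm S f = l2_norm S g"
  unfolding l2_norm_def by (simp add: l2_inner_cong_AE[OF assms(1,2,1,2,3,3)])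

text \<open>Exchanging the two quantifiers requires a measurable predicate, so \<open>P\<close> is
  first replaced by membership in the complement of a measurable null set.\<close>

lemma AE_leb_Times_swap:
  assumes A: "A \<in> sets borel" and B: "B \<in> sets borel" and P: "AE z in leb (A \<times> B). P z"
  shows "AE y in leb B. AE x in leb A. P (x, y)"
proof -
  interpret pair_sigma_finite "leb A" "leb B" by (rule pair_sigma_finite_leb[OF A B])
  let ?M = "leb A \<Otimes>\<^sub>M leb B"
  obtain N where N: "N \<in> null_sets ?M" "{z \<in> space ?M. \<not> P z} \<subseteq> N"
    using P unfolding leb_Times[OF A B] eventually_ae_filter by blast
  have "AE z in ?M. z \<notin> N" using N(1) by (rule AE_not_in)
  from AE_pair[OF this] have "AE x in leb A. AE y in leb B. (x, y) \<notin> N" .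
  moreover have "{z \<in> space ?M. (fst z, snd z) \<notin> N} \<in> sets ?M"
    using N(1) by (auto intro: sets.sets_Collect_neg simp: null_sets_def)
  ultimately have "AE y in leb B. AE x in leb A. (x, y) \<notin> N"
    using AE_commute[of "\<lambda>x y. (x, y) \<notin> N"] by simp
  then show ?thesis
  proof (rule AE_mp, intro AE_I2[where M = "leb B"] impI)
    fix y assume "y \<in> space (leb B)" "AE x in leb A. (x, y) \<notin> N"
    from this(2) AE_space show "AE x in leb A. P (x, y)"
    proof eventually_elim
      case (elim x)
      then have "(x, y) \<in> space ?M" using \<open>y \<in> space (leb B)\<close> by (simp add: space_pair_measure)
      then show ?case using N(2) elim by blast
    qed
  qed
qed

text \<open>Two continuous curves in L2 representing the same function agree at almost every time,
  in particular at times arbitrarily close to 0; the triangle inequality through such a time makes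
  the distance of the initial values arbitrarily small.\<close>

lemma has_initial_trace_unique:
  assumes \<Omega>: "\<Omega> \<in> sets borel" and T: "T > 0"
    and 1: "has_initial_trace \<Omega> T f g\<^sub>1" and 2: "has_initial_trace \<Omega> T f g\<^sub>2"
  shows "AE x in leb \<Omega>. g\<^sub>1 x = g\<^sub>2 x"
proof -
  obtain w\<^sub>1 where w1: "\<forall>t\<in>{0..T}. w\<^sub>1 t \<in> L2 \<Omega>"
      "\<forall>t\<in>{0..T}. ((\<lambda>s. l2_norm \<Omega> (\<lambda>x. w\<^sub>1 s x - w\<^sub>1 t x)) \<longlongrightarrow> 0) (at t within {0..T})"
      "AE (x, t) in leb (cyl \<Omega> T). f (x, t) = w\<^sub>1 t x" "w\<^sub>1 0 = g\<^sub>1"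
    using 1 by (auto simp: has_initial_trace_def)
  obtain w\<^sub>2 where w2: "\<forall>t\<in>{0..T}. w\<^sub>2 t \<in> L2 \<Omega>"
      "\<forall>t\<in>{0..T}. ((\<lambda>s. l2_norm \<Omega> (\<lambda>x. w\<^sub>2 s x - w\<^sub>2 t x)) \<longlongrightarrow> 0) (at t within {0..T})"
      "AE (x, t) in leb (cyl \<Omega> T). f (x, t) = w\<^sub>2 t x" "w\<^sub>2 0 = g\<^sub>2"
    using 2 by (auto simp: has_initial_trace_def)
  have "AE (x, t) in leb (cyl \<Omega> T). w\<^sub>1 t x = w\<^sub>2 t x"
    using w1(3) w2(3) by eventually_elim auto
  from AE_leb_Times_swap[OF \<Omega> _ this]
  have eq: "AE t in leb {0<..<T}. AE x in leb \<Omega>. w\<^sub>1 t x = w\<^sub>2 t x" by simp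
  have gL: "g\<^sub>1 \<in> L2 \<Omega>" "g\<^sub>2 \<in> L2 \<Omega>" using w1 w2 T by force+
  have small: "l2_norm \<Omega> (\<lambda>x. g\<^sub>1 x - g\<^sub>2 x) \<le> \<epsilon> + \<epsilon>" if \<epsilon>: "\<epsilon> > 0" for \<epsilon>
  proof -
    have "\<forall>\<^sub>F s in at 0 within {0..T}. l2_norm \<Omega> (\<lambda>x. w\<^sub>1 s x - g\<^sub>1 x) < \<epsilon>"
      using w1(2,4) T \<epsilon> by (force dest: order_tendstoD(2))
    moreover have "\<forall>\<^sub>F s in at 0 within {0..T}. l2_norm \<Omega> (\<lambda>x. w\<^sub>2 s x - g\<^sub>2 x) < \<epsilon>"
      using w2(2,4) T \<epsilon> by (force dest: order_tendstoD(2))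
    ultimately have "\<forall>\<^sub>F s in at 0 within {0..T}.
        l2_norm \<Omega> (\<lambda>x. w\<^sub>1 s x - g\<^sub>1 x) < \<epsilon> \<and> l2_norm \<Omega> (\<lambda>x. w\<^sub>2 s x - g\<^sub>2 x) < \<epsilon>"
      by (rule eventually_conj)
    then obtain \<delta> where \<delta>: "\<delta> > 0" "\<And>s. s \<in> {0..T} \<Longrightarrow> s \<noteq> 0 \<Longrightarrow> dist s 0 < \<delta> \<Longrightarrow>
        l2_norm \<Omega> (\<lambda>x. w\<^sub>1 s x - g\<^sub>1 x) < \<epsilon> \<and> l2_norm \<Omega> (\<lambda>x. w\<^sub>2 s x - g\<^sub>2 x) < \<epsilon>"
      unfolding eventually_at by blast
    obtain t where t: "0 < t" "t < T" "t < \<delta>" "AE x in leb \<Omega>. w\<^sub>1 t x = w\<^sub>2 t x"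
      using AE_Ioo_near_0[OF T eq \<delta>(1)] by blast
    have wL: "w\<^sub>1 t \<in> L2 \<Omega>" "w\<^sub>2 t \<in> L2 \<Omega>" using w1(1) w2(1) t by auto
    have m: "l2_norm \<Omega> (\<lambda>x. p x - q x) = l2_norm \<Omega> (\<lambda>x. q x - p x)" for p q :: "'a \<Rightarrow> real"
      unfolding l2_norm_def l2_inner_def by (simp add: algebra_simps)
    have "l2_norm \<Omega> (\<lambda>x. g\<^sub>1 x - g\<^sub>2 x) = l2_norm \<Omega> (\<lambda>x. (g\<^sub>1 x - w\<^sub>1 t x) + (w\<^sub>2 t x - g\<^sub>2 x))"
    proof (rule l2_norm_cong_AE)
      show "AE x in leb \<Omega>. g\<^sub>1 x - g\<^sub>2 x = (g\<^sub>1 x - w\<^sub>1 t x) + (w\<^sub>2 t x - g\<^sub>2 x)"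
        using t(4) by eventually_elim simp
      show "(\<lambda>x. g\<^sub>1 x - g\<^sub>2 x) \<in> borel_measurable (leb \<Omega>)"
        by (intro L2_measurable L2_diff gL)
      show "(\<lambda>x. (g\<^sub>1 x - w\<^sub>1 t x) + (w\<^sub>2 t x - g\<^sub>2 x)) \<in> borel_measurable (leb \<Omega>)"
        by (intro L2_measurable L2_add L2_diff gL wL)
    qed
    also have "\<dots> \<le> l2_norm \<Omega> (\<lambda>x. g\<^sub>1 x - w\<^sub>1 t x) + l2_norm \<Omega> (\<lambda>x. w\<^sub>2 t x - g\<^sub>2 x)"
      by (intro l2_norm_triangle L2_diff gL wL)
    also have "\<dots> \<le> \<epsilon> + \<epsilon>"
      using \<delta>(2)[of t] t m[of g\<^sub>1 "w\<^sub>1 t"] by (auto simp: dist_real_def)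
    finally show ?thesis .
  qed
  have "l2_norm \<Omega> (\<lambda>x. g\<^sub>1 x - g\<^sub>2 x) \<le> 0"
  proof (rule field_le_epsilon)
    fix \<epsilon> :: real assume "\<epsilon> > 0"
    then show "l2_norm \<Omega> (\<lambda>x. g\<^sub>1 x - g\<^sub>2 x) \<le> 0 + \<epsilon>" using small[of "\<epsilon> / 2"] by simp
  qed
  then have "l2_norm \<Omega> (\<lambda>x. g\<^sub>1 x - g\<^sub>2 x) = 0"
    using l2_norm_nonneg[of \<Omega> "\<lambda>x. g\<^sub>1 x - g\<^sub>2 x"] by linarith
  then have "l2_inner \<Omega> (\<lambda>x. g\<^sub>1 x - g\<^sub>2 x) (\<lambda>x. g\<^sub>1 x - g\<^sub>2 x) = 0"
    by (simp flip: l2_norm_sq)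
  from l2_inner_self_eq_0[OF L2_diff[OF gL] this] show ?thesis by eventually_elim simp
qed

text \<open>The elementary tensor. The space factor may be vector valued, so that the same notation
  covers the functions and their gradients.\<close>

definition tp :: "('a \<Rightarrow> 'c::real_vector) \<Rightarrow> (real \<Rightarrow> real) \<Rightarrow> 'a \<times> real \<Rightarrow> 'c" where
  "tp f g z = g (snd z) *\<^sub>R f (fst z)"

lemma L2_tp:
  fixes f :: "'a::euclidean_space \<Rightarrow> 'c::euclidean_space"
  assumes "\<Omega> \<in> sets borel" "f \<in> L2 \<Omega>" "g \<in> L2 {0<..<T}"
  shows "tp f g \<in> L2 (cyl \<Omega> T)"
  using L2_pair_mult[OF assms(1) _ assms(2,3)] by (simp add: tp_def[abs_def] case_prod_unfold)

lemma tp_has_weak_deriv_t: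
  fixes f :: "'a::euclidean_space \<Rightarrow> real"
  assumes T: "T > 0" and \<Omega>: "open \<Omega>" "bounded \<Omega>" and f: "f \<in> L2 \<Omega>"
    and G: "indef T G g" and g: "g \<in> L2 {0<..<T}"
  shows "has_weak_deriv (cyl \<Omega> T) (0, 1) (tp f G) (tp f g)"
proof (rule has_weak_deriv_slices_snd)
  have b: "bounded (cyl \<Omega> T)" "cyl \<Omega> T \<in> sets borel"
    using \<Omega> by (auto intro!: borel_open bounded_Times open_Times)
  show "integrable (leb (cyl \<Omega> T)) (tp f G)"
    using \<Omega>(1) by (intro L2_imp_integrable b L2_tp f continuous_L2 indef_continuous[OF G]) auto
  show "integrable (leb (cyl \<Omega> T)) (tp f g)"
    using \<Omega>(1) by (intro L2_imp_integrable b L2_tp f g) auto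
  fix x
  show "has_weak_deriv {0<..<T} 1 (\<lambda>y. tp f G (x, y)) (\<lambda>y. tp f g (x, y))"
    using indef_imp_has_weak_deriv[OF T indef_scale[OF G, of "f x"]] by (simp add: tp_def mult.commute)
qed (use \<Omega> in auto)

lemma tp_has_weak_deriv_x:
  fixes f f' :: "'a::euclidean_space \<Rightarrow> real"
  assumes \<Omega>: "open \<Omega>" "bounded \<Omega>" and f: "f \<in> L2 \<Omega>" and f': "f' \<in> L2 \<Omega>"
    and d: "has_weak_deriv \<Omega> b f f'" and g: "g \<in> L2 {0<..<T}"
  shows "has_weak_deriv (cyl \<Omega> T) (b, 0) (tp f g) (tp f' g)"
proof (rule has_weak_deriv_slices_fst)
  have b: "bounded (cyl \<Omega> T)" "cyl \<Omega> T \<in> sets borel"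
    using \<Omega> by (auto intro!: borel_open bounded_Times open_Times)
  show "integrable (leb (cyl \<Omega> T)) (tp f g)" "integrable (leb (cyl \<Omega> T)) (tp f' g)"
    using \<Omega>(1) by (intro L2_imp_integrable b L2_tp f f' g; simp)+
  fix y
  show "has_weak_deriv \<Omega> b (\<lambda>x. tp f g (x, y)) (\<lambda>x. tp f' g (x, y))"
    \<comment> \<open>A one-element index set turns the sum rule into scaling by the constant
      \<open>g y\<close>.\<close>
    using has_weak_deriv_sum[OF \<Omega>(1), of "{()}" b "\<lambda>_. f" "\<lambda>_. f'" "\<lambda>_. g y"] d by (simp add: tp_def)
qed (use \<Omega> in auto)

text \<open>The functions \<open>gv i\<close>, \<open>r i\<close> and \<open>h i\<close> are the gradient of \<open>v i\<close> and the first two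
  derivatives of \<open>w i\<close>.\<close>

locale tensor_family =
  fixes \<Omega> :: "'a::euclidean_space set" and T :: real and c :: "'a \<Rightarrow> real"
    and I :: "'i set" and v :: "'i \<Rightarrow> 'a \<Rightarrow> real" and gv :: "'i \<Rightarrow> 'a \<Rightarrow> 'a"
    and w r h :: "'i \<Rightarrow> real \<Rightarrow> real"
  assumes open_\<Omega>: "open \<Omega>" and bounded_\<Omega>: "bounded \<Omega>" and T_pos: "T > 0"
    and c_Linf: "c \<in> Linf \<Omega>" and finite_I: "finite I"
    and v_L2: "i \<in> I \<Longrightarrow> v i \<in> L2 \<Omega>" and gv_L2: "i \<in> I \<Longrightarrow> gv i \<in> L2 \<Omega>"
    and gv_deriv: "i \<in> I \<Longrightarrow> b \<in> Basis \<Longrightarrow> has_weak_deriv \<Omega> b (v i) (\<lambda>x. gv i x \<bullet> b)"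
    and w_indef: "i \<in> I \<Longrightarrow> indef T (w i) (r i)" and r_indef: "i \<in> I \<Longrightarrow> indef T (r i) (h i)"
    and w_0: "i \<in> I \<Longrightarrow> w i 0 = 0" and h_L2: "i \<in> I \<Longrightarrow> h i \<in> L2 {0<..<T}"
begin

text \<open>One coefficient vector is combined with varying factor families: the same
  \<open>a\<close> describes a function, its derivatives and its image under
  \<open>LT\<close>.\<close>

definition tens :: "('i \<Rightarrow> real) \<Rightarrow> ('i \<Rightarrow> 'a \<Rightarrow> 'c::real_vector) \<Rightarrow> ('i \<Rightarrow> real \<Rightarrow> real) \<Rightarrow> 'a \<times> real \<Rightarrow> 'c" where
  "tens a f g z = (\<Sum>i\<in>I. a i *\<^sub>R tp (f i) (g i) z)"

text \<open>The operator \<open>LT\<close> turns the time factor \<open>w i\<close> into \<open>w_exp i\<close>, whose first two derivatives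
  are \<open>r_exp i\<close> and \<open>dr_exp i\<close>.\<close>

definition r_exp :: "'i \<Rightarrow> real \<Rightarrow> real" where
  "r_exp i t = exp (- t / T) * r i t"

definition dr_exp :: "'i \<Rightarrow> real \<Rightarrow> real" where
  "dr_exp i t = - (1 / T) * exp (- t / T) * r i t + exp (- t / T) * h i t"

definition w_exp :: "'i \<Rightarrow> real \<Rightarrow> real" where
  "w_exp i t = (LBINT s:{0<..<t}. r_exp i s)"

lemma borel_\<Omega>: "\<Omega> \<in> sets borel"
  using open_\<Omega> by simp

lemma open_cyl: "open (cyl \<Omega> T)"
  using open_\<Omega> by (simp add: open_Times)

lemma exp_continuous: "continuous_on A (\<lambda>t. exp (- t / T))"
  using T_pos by (intro continuous_intros) auto

lemma r_exp_indef: "i \<in> I \<Longrightarrow> indef T (r_exp i) (dr_exp i)"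
  unfolding r_exp_def[abs_def] dr_exp_def[abs_def] by (intro indef_mult indef_exp_weight T_pos r_indef)

lemma w_continuous: "i \<in> I \<Longrightarrow> continuous_on {0..T} (w i)"
  and r_continuous: "i \<in> I \<Longrightarrow> continuous_on {0..T} (r i)"
  and r_exp_continuous: "i \<in> I \<Longrightarrow> continuous_on {0..T} (r_exp i)"
  using w_indef r_indef r_exp_indef indef_continuous by blast+

lemma w_L2: "i \<in> I \<Longrightarrow> w i \<in> L2 {0<..<T}"
  and r_L2: "i \<in> I \<Longrightarrow> r i \<in> L2 {0<..<T}"
  and r_exp_L2: "i \<in> I \<Longrightarrow> r_exp i \<in> L2 {0<..<T}"
  by (simp_all add: continuous_L2 w_continuous r_continuous r_exp_continuous)

lemma r_exp_integrable: "i \<in> I \<Longrightarrow> set_integrable lborel {0<..<T} (r_exp i)"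
  by (intro continuous_imp_set_integrable r_exp_continuous)

lemma w_exp_indef: "i \<in> I \<Longrightarrow> indef T (w_exp i) (r_exp i)"
  using indef_integral[OF r_exp_integrable, of i 0] by (simp add: w_exp_def[abs_def])

lemma tens_L2:
  fixes f :: "'i \<Rightarrow> 'a \<Rightarrow> 'c::euclidean_space"
  assumes "\<And>i. i \<in> I \<Longrightarrow> f i \<in> L2 \<Omega>" "\<And>i. i \<in> I \<Longrightarrow> g i \<in> L2 {0<..<T}"
  shows "tens a f g \<in> L2 (cyl \<Omega> T)"
  unfolding tens_def[abs_def] by (intro L2_sum L2_tp borel_\<Omega> assms)

text \<open>Input and output are both measurable functions known almost everywhere as a
  \<open>tens\<close>, so the lemma can be applied to its own result and to the output of
  \<open>LT\<close>.\<close>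

lemma dt_tens:
  assumes G: "\<And>i. i \<in> I \<Longrightarrow> indef T (G i) (g i)" and g: "\<And>i. i \<in> I \<Longrightarrow> g i \<in> L2 {0<..<T}"
    and f: "f \<in> borel_measurable (leb (cyl \<Omega> T))"
    and eq: "AE z in leb (cyl \<Omega> T). f z = tens a v G z"
  shows "AE z in leb (cyl \<Omega> T). dt \<Omega> T f z = tens a v g z"
    and "dt \<Omega> T f \<in> borel_measurable (leb (cyl \<Omega> T))"
proof -
  have "has_weak_deriv (cyl \<Omega> T) (0, 1) (tens a v G) (tens a v g)"
    unfolding tens_def[abs_def] real_scaleR_def
    by (intro has_weak_deriv_sum open_cyl tp_has_weak_deriv_t T_pos open_\<Omega> bounded_\<Omega> v_L2 G g)
  then have d: "has_weak_deriv (cyl \<Omega> T) (0, 1) f (tens a v g)"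
    by (rule has_weak_deriv_cong_AE[OF open_cyl _ f]) (use eq in eventually_elim, simp)
  show "AE z in leb (cyl \<Omega> T). dt \<Omega> T f z = tens a v g z"
    unfolding dt_def by (rule weak_deriv_AE[OF open_cyl d])
  show "dt \<Omega> T f \<in> borel_measurable (leb (cyl \<Omega> T))"
    unfolding dt_def by (rule weak_deriv_measurable[OF d])
qed

lemma grad_x_tens:
  assumes g: "\<And>i. i \<in> I \<Longrightarrow> g i \<in> L2 {0<..<T}"
    and f: "f \<in> borel_measurable (leb (cyl \<Omega> T))"
    and eq: "AE z in leb (cyl \<Omega> T). f z = tens a v g z"
  shows "AE z in leb (cyl \<Omega> T). grad_x \<Omega> T f z = tens a gv g z"
    and "grad_x \<Omega> T f \<in> borel_measurable (leb (cyl \<Omega> T))"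
proof -
  \<comment> \<open>Each coordinate of the gradient is dominated by its norm.\<close>
  have gvb: "(\<lambda>x. gv i x \<bullet> b) \<in> L2 \<Omega>" if "i \<in> I" "b \<in> Basis" for i b
  proof -
    have "integrable (leb \<Omega>) (\<lambda>x. (gv i x \<bullet> b) * (gv i x \<bullet> b))"
    proof (rule Bochner_Integration.integrable_bound)
      show "integrable (leb \<Omega>) (\<lambda>x. gv i x \<bullet> gv i x)" using gv_L2[OF that(1)] by (simp add: L2_iff)
      show "(\<lambda>x. (gv i x \<bullet> b) * (gv i x \<bullet> b)) \<in> borel_measurable (leb \<Omega>)"
        by (intro borel_measurable_times borel_measurable_inner L2_measurable[OF gv_L2[OF that(1)]] borel_measurable_const)
      have "(gv i x \<bullet> b) * (gv i x \<bullet> b) \<le> gv i x \<bullet> gv i x" for x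
        using power_mono[OF Basis_le_norm[OF that(2), of "gv i x"] abs_ge_zero, of 2]
        by (simp add: power2_eq_square flip: power2_norm_eq_inner)
      then show "AE x in leb \<Omega>. norm ((gv i x \<bullet> b) * (gv i x \<bullet> b)) \<le> norm (gv i x \<bullet> gv i x)"
        by simp
    qed
    then show ?thesis
      using L2_measurable[OF gv_L2[OF that(1)]] by (simp add: L2_iff borel_measurable_inner)
  qed
  have d: "has_weak_deriv (cyl \<Omega> T) (b, 0) f (\<lambda>z. tens a gv g z \<bullet> b)" if b: "b \<in> Basis" for b
  proof -
    have "has_weak_deriv (cyl \<Omega> T) (b, 0) (\<lambda>z. \<Sum>i\<in>I. a i * tp (v i) (g i) z)
        (\<lambda>z. \<Sum>i\<in>I. a i * tp (\<lambda>x. gv i x \<bullet> b) (g i) z)"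
      by (intro has_weak_deriv_sum open_cyl tp_has_weak_deriv_x open_\<Omega> bounded_\<Omega> v_L2 gvb b gv_deriv g)
    also have "(\<lambda>z. \<Sum>i\<in>I. a i * tp (\<lambda>x. gv i x \<bullet> b) (g i) z) = (\<lambda>z. tens a gv g z \<bullet> b)"
      by (simp add: tens_def[abs_def] inner_sum_left tp_def mult.assoc)
    finally show ?thesis
      by (rule has_weak_deriv_cong_AE[OF open_cyl _ f]) (use eq in eventually_elim, simp add: tens_def)
  qed
  have "AE z in leb (cyl \<Omega> T). \<forall>b\<in>Basis. weak_deriv (cyl \<Omega> T) (b, 0) f z = tens a gv g z \<bullet> b"
    using weak_deriv_AE[OF open_cyl d] by (simp add: AE_finite_all)
  then show "AE z in leb (cyl \<Omega> T). grad_x \<Omega> T f z = tens a gv g z"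
    by eventually_elim (simp add: grad_x_def euclidean_representation)
  show "grad_x \<Omega> T f \<in> borel_measurable (leb (cyl \<Omega> T))"
    unfolding grad_x_def[abs_def]
    by (intro borel_measurable_sum borel_measurable_scaleR borel_measurable_const weak_deriv_measurable[OF d])
qed

text \<open>The upper limit depends on the point. Writing the integral over the fixed interval (0,T)
  with the condition s < t makes it a parameter integral, measurable by Fubini.\<close>

lemma LT_measurable:
  assumes f: "dt \<Omega> T f \<in> borel_measurable (leb (cyl \<Omega> T))"
  shows "LT \<Omega> T f \<in> borel_measurable (leb (cyl \<Omega> T))"
proof -
  let ?I = "leb {0<..<T}"
  interpret pair_sigma_finite "leb \<Omega>" ?I by (rule pair_sigma_finite_leb) (simp_all add: borel_\<Omega>)
  have eq: "leb (cyl \<Omega> T) = leb \<Omega> \<Otimes>\<^sub>M ?I" by (rule leb_Times) (simp_all add: borel_\<Omega>)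
  have [measurable]: "dt \<Omega> T f \<in> borel_measurable (leb \<Omega> \<Otimes>\<^sub>M ?I)" using f by (simp add: eq)
  have [measurable]: "(\<lambda>t. t) \<in> borel_measurable ?I" by (rule measurable_restrict_space1) simp
  have "(\<lambda>z. \<integral>s. of_bool (s < snd z) * (exp (- s / T) * dt \<Omega> T f (fst z, s)) \<partial>?I)
      \<in> borel_measurable (leb \<Omega> \<Otimes>\<^sub>M ?I)"
    by measurable
  also have "?this \<longleftrightarrow> LT \<Omega> T f \<in> borel_measurable (leb \<Omega> \<Otimes>\<^sub>M ?I)"
  proof (rule measurable_cong)
    fix z assume "z \<in> space (leb \<Omega> \<Otimes>\<^sub>M ?I)"
    then have "snd z \<in> {0<..<T}" by (auto simp: space_pair_measure space_restrict_space)
    then have "(\<integral>s. of_bool (s < snd z) * (exp (- s / T) * dt \<Omega> T f (fst z, s)) \<partial>?I)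
        = (LBINT s:{0<..<snd z}. exp (- s / T) * dt \<Omega> T f (fst z, s))"
      unfolding leb_integral[of "{0<..<T}", simplified] set_lebesgue_integral_def
      by (intro Bochner_Integration.integral_cong) (auto simp: indicator_def)
    then show "(\<integral>s. of_bool (s < snd z) * (exp (- s / T) * dt \<Omega> T f (fst z, s)) \<partial>?I) = LT \<Omega> T f z"
      by (simp add: LT_def case_prod_unfold)
  qed
  finally show ?thesis by (simp add: eq)
qed

lemma tens_measurable:
  fixes f :: "'i \<Rightarrow> 'a \<Rightarrow> 'c::euclidean_space"
  assumes "\<And>i. i \<in> I \<Longrightarrow> f i \<in> L2 \<Omega>" "\<And>i. i \<in> I \<Longrightarrow> g i \<in> L2 {0<..<T}"
  shows "tens a f g \<in> borel_measurable (leb (cyl \<Omega> T))"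
  by (rule L2_measurable[OF tens_L2]) (use assms in auto)

text \<open>\<open>LT\<close> integrates the chosen representative of \<open>dt\<close> along time,
  point by point in space. For almost every x that slice is the explicit sum at almost every time,
  and then the integrals agree for every upper limit in (0,T).\<close>

lemma LT_tens:
  assumes f: "f \<in> borel_measurable (leb (cyl \<Omega> T))"
    and eq: "AE z in leb (cyl \<Omega> T). f z = tens a v w z"
  shows "AE z in leb (cyl \<Omega> T). LT \<Omega> T f z = tens a v w_exp z"
    and "LT \<Omega> T f \<in> borel_measurable (leb (cyl \<Omega> T))"
proof -
  let ?I = "leb {0<..<T}" and ?D = "dt \<Omega> T f"
  interpret pair_sigma_finite "leb \<Omega>" ?I by (rule pair_sigma_finite_leb) (simp_all add: borel_\<Omega>)
  have cyl: "leb (cyl \<Omega> T) = leb \<Omega> \<Otimes>\<^sub>M ?I" by (rule leb_Times) (simp_all add: borel_\<Omega>)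
  note D = dt_tens[OF w_indef r_L2 f eq]
  show LTm: "LT \<Omega> T f \<in> borel_measurable (leb (cyl \<Omega> T))" by (rule LT_measurable[OF D(2)])
  have "AE x in leb \<Omega>. AE t in ?I. ?D (x, t) = tens a v r (x, t)"
    using AE_pair[OF D(1)[unfolded cyl]] .
  then have "AE x in leb \<Omega>. AE t in ?I. LT \<Omega> T f (x, t) = tens a v w_exp (x, t)"
  proof (rule AE_mp, intro AE_I2[where M = "leb \<Omega>"] impI)
    fix x assume x: "x \<in> space (leb \<Omega>)" and ae: "AE t in ?I. ?D (x, t) = tens a v r (x, t)"
    have ae': "AE s in lborel. s \<in> {0<..<T} \<longrightarrow> ?D (x, s) = tens a v r (x, s)"
      using ae by (simp add: AE_restrict_space_iff)
    have Dx: "(\<lambda>s. ?D (x, s)) \<in> borel_measurable ?I"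
      using measurable_Pair2[OF D(2)[unfolded cyl] x] by simp
    have em: "(\<lambda>s. exp (- s / T)) \<in> borel_measurable ?I"
      by (rule continuous_imp_set_integrable(2)[OF exp_continuous])
    have "LT \<Omega> T f (x, t) = tens a v w_exp (x, t)" if t: "t \<in> {0<..<T}" for t
    proof -
      have "LT \<Omega> T f (x, t) = (LBINT s:{0<..<t}. (\<Sum>i\<in>I. a i * v i x * r_exp i s))"
        unfolding LT_def prod.case set_lebesgue_integral_def
      proof (rule integral_cong_AE)
        \<comment> \<open>Measurability of the slice is known on (0,T) only, so the indicator of
          (0,t) is introduced on top of that of (0,T).\<close>
        have "(\<lambda>s. exp (- s / T) * ?D (x, s)) \<in> borel_measurable ?I"
          by (rule borel_measurable_times[OF em Dx])
        then have "(\<lambda>s. indicator {0<..<T} s *\<^sub>R (exp (- s / T) * ?D (x, s))) \<in> borel_measurable lborel"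
          by (simp add: borel_measurable_restrict_space_iff)
        then have "(\<lambda>s. indicator {0<..<t} s *\<^sub>R (indicator {0<..<T} s *\<^sub>R (exp (- s / T) * ?D (x, s)))) \<in> borel_measurable lborel"
          by (rule borel_measurable_scaleR[rotated]) simp
        also have "(\<lambda>s. indicator {0<..<t} s *\<^sub>R (indicator {0<..<T} s *\<^sub>R (exp (- s / T) * ?D (x, s))))
            = (\<lambda>s. indicator {0<..<t} s *\<^sub>R (exp (- s / T) * ?D (x, s)))"
          using t by (auto simp: indicator_def fun_eq_iff)
        finally show "(\<lambda>s. indicator {0<..<t} s *\<^sub>R (exp (- s / T) * ?D (x, s))) \<in> borel_measurable lborel" .
        have "set_integrable lborel {0<..<t} (\<lambda>s. a i * v i x * r_exp i s)" if "i \<in> I" for i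
          using set_integrable_sub_Ioo[OF r_exp_integrable[OF that], of t] t by simp
        then show "(\<lambda>s. indicator {0<..<t} s *\<^sub>R (\<Sum>i\<in>I. a i * v i x * r_exp i s)) \<in> borel_measurable lborel"
          unfolding scaleR_sum_right by (intro borel_measurable_sum) (auto simp: set_integrable_def)
        show "AE s in lborel. indicator {0<..<t} s *\<^sub>R (exp (- s / T) * ?D (x, s))
            = indicator {0<..<t} s *\<^sub>R (\<Sum>i\<in>I. a i * v i x * r_exp i s)"
          using ae'
        proof eventually_elim
          case (elim s)
          show ?case
          proof (cases "s \<in> {0<..<t}")
            case True
            then have "?D (x, s) = tens a v r (x, s)" using elim t by auto
            then show ?thesis
              by (simp add: tens_def tp_def r_exp_def sum_distrib_left mult_ac)
          qed simp
        qed
      qed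
      also have "\<dots> = (\<Sum>i\<in>I. a i * v i x * w_exp i t)"
      proof -
        have "(LBINT s:{0<..<t}. (\<Sum>i\<in>I. a i * v i x * r_exp i s)) = (\<Sum>i\<in>I. (LBINT s:{0<..<t}. a i * v i x * r_exp i s))"
          unfolding set_lebesgue_integral_def scaleR_sum_right
        proof (rule Bochner_Integration.integral_sum)
          fix i assume "i \<in> I"
          from set_integrable_sub_Ioo[OF r_exp_integrable[OF this], of t] t
          have "set_integrable lborel {0<..<t} (\<lambda>s. a i * v i x * r_exp i s)" by simp
          then show "integrable lborel (\<lambda>s. indicator {0<..<t} s *\<^sub>R (a i * v i x * r_exp i s))"
            by (simp only: set_integrable_def)
        qed
        then show ?thesis by (simp add: w_exp_def)
      qed
      finally show ?thesis by (simp add: tens_def tp_def mult_ac)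
    qed
    then show "AE t in ?I. LT \<Omega> T f (x, t) = tens a v w_exp (x, t)"
      by (intro AE_I2) (simp add: space_restrict_space)
  qed
  moreover have "w_exp i \<in> L2 {0<..<T}" if "i \<in> I" for i
    by (intro continuous_L2 indef_continuous[OF w_exp_indef[OF that]])
  then have "tens a v w_exp \<in> borel_measurable (leb (cyl \<Omega> T))"
    by (intro tens_measurable v_L2)
  \<comment> \<open>The passage from an iterated to a joint almost everywhere statement needs the
    set of equality to be measurable.\<close>
  then have "{z \<in> space (leb \<Omega> \<Otimes>\<^sub>M ?I). LT \<Omega> T f z = tens a v w_exp z} \<in> sets (leb \<Omega> \<Otimes>\<^sub>M ?I)"
    using LTm unfolding cyl by (intro borel_measurable_eq)
  ultimately show "AE z in leb (cyl \<Omega> T). LT \<Omega> T f z = tens a v w_exp z"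
    unfolding cyl by (intro AE_pair_measure)
qed

text \<open>The explicit sum is a continuous curve in L2 and hence a valid witness for the trace;
  uniqueness then identifies the function picked by \<open>SOME\<close>.\<close>

lemma initial_trace_tens:
  assumes G: "\<And>i. i \<in> I \<Longrightarrow> continuous_on {0..T} (G i)"
    and eq: "AE z in leb (cyl \<Omega> T). f z = tens a v G z"
  shows "AE x in leb \<Omega>. initial_trace \<Omega> T f x = (\<Sum>i\<in>I. a i *\<^sub>R (G i 0 *\<^sub>R v i x))"
    and "initial_trace \<Omega> T f \<in> L2 \<Omega>"
proof -
  define u where "u t x = (\<Sum>i\<in>I. (a i * G i t) *\<^sub>R v i x)" for t x
  have uL: "u t \<in> L2 \<Omega>" for t unfolding u_def by (intro L2_sum v_L2)
  have "((\<lambda>s. l2_norm \<Omega> (\<lambda>x. u s x - u t x)) \<longlongrightarrow> 0) (at t within {0..T})" if t: "t \<in> {0..T}" for t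
  proof -
    \<comment> \<open>The squared distance is a quadratic form in the increments of the
      \<open>G i\<close> with fixed Gram coefficients, so continuity of finitely many scalar
      functions suffices.\<close>
    have "l2_norm \<Omega> (\<lambda>x. u s x - u t x) = sqrt (\<Sum>i\<in>I. \<Sum>j\<in>I. (a i * (G i s - G i t)) * (a j * (G j s - G j t)) * l2_inner \<Omega> (v i) (v j))" for s
      unfolding l2_norm_def u_def sum_subtractf[symmetric] scaleR_diff_left[symmetric] right_diff_distrib[symmetric]
      by (subst l2_inner_sum) (auto intro: v_L2)
    moreover have "((\<lambda>s. a i * (G i s - G i t)) \<longlongrightarrow> 0) (at t within {0..T})" if "i \<in> I" for i
    proof -
      have "(G i \<longlongrightarrow> G i t) (at t within {0..T})" using G[OF that] t by (simp add: continuous_on_def)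
      then have "((\<lambda>s. a i * (G i s - G i t)) \<longlongrightarrow> a i * (G i t - G i t)) (at t within {0..T})"
        by (intro tendsto_intros)
      then show ?thesis by simp
    qed
    then have "((\<lambda>s. sqrt (\<Sum>i\<in>I. \<Sum>j\<in>I. (a i * (G i s - G i t)) * (a j * (G j s - G j t)) * l2_inner \<Omega> (v i) (v j))) \<longlongrightarrow> sqrt 0)
        (at t within {0..T})"
      by (intro tendsto_real_sqrt tendsto_null_sum tendsto_mult_left_zero) (rule tendsto_mult_zero)
    ultimately show ?thesis by simp
  qed
  moreover have "AE (x, t) in leb (cyl \<Omega> T). f (x, t) = u t x"
    using eq by eventually_elim (auto simp: u_def tens_def tp_def mult_ac)
  ultimately have tr: "has_initial_trace \<Omega> T f (u 0)"
    unfolding has_initial_trace_def using uL by blast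
  then have tr': "has_initial_trace \<Omega> T f (initial_trace \<Omega> T f)"
    unfolding initial_trace_def by (rule someI[of "has_initial_trace \<Omega> T f"])
  from has_initial_trace_unique[OF borel_\<Omega> T_pos tr' tr]
  show "AE x in leb \<Omega>. initial_trace \<Omega> T f x = (\<Sum>i\<in>I. a i *\<^sub>R (G i 0 *\<^sub>R v i x))"
    by (simp add: u_def mult.assoc)
  show "initial_trace \<Omega> T f \<in> L2 \<Omega>"
    using tr' T_pos unfolding has_initial_trace_def by force
qed

end

section \<open>Galerkin matrix, coercivity and energy\<close>

context tensor_family
begin

lemma c_cyl_Linf: "(\<lambda>z. c (fst z)) \<in> Linf (cyl \<Omega> T)"
  by (rule Linf_fst[OF borel_\<Omega> _ c_Linf]) simp

lemma c_sq_cyl_Linf: "(\<lambda>z. (c (fst z))\<^sup>2) \<in> Linf (cyl \<Omega> T)"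
  using Linf_mult[OF c_cyl_Linf c_cyl_Linf] by (simp add: power2_eq_square)

text \<open>The form A(U, L_T W) for two elementary tensors, with the test function in second place.
  Its time derivative has the time factor \<open>r_exp j\<close>, whose value at 0 is
  \<open>r j 0\<close> because the weight is 1 there. The matrix is in general not
  symmetric.\<close>

definition stiffness :: "'i \<Rightarrow> 'i \<Rightarrow> real" where
  "stiffness i j = l2_inner (cyl \<Omega> T) (tp (v i) (h i)) (tp (v j) (r_exp j))
    + l2_inner \<Omega> (\<lambda>x. r i 0 *\<^sub>R v i x) (\<lambda>x. r j 0 *\<^sub>R v j x)
    + l2_inner (cyl \<Omega> T) (\<lambda>z. (c (fst z))\<^sup>2 *\<^sub>R tp (gv i) (w i) z) (tp (gv j) (r_exp j))"

lemma L2_tp_cyl: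
  fixes f :: "'a \<Rightarrow> 'c::euclidean_space"
  shows "f \<in> L2 \<Omega> \<Longrightarrow> g \<in> L2 {0<..<T} \<Longrightarrow> tp f g \<in> L2 (cyl \<Omega> T)"
  by (intro L2_tp borel_\<Omega>)

lemma c_sq_tens_eq: "(c (fst z))\<^sup>2 *\<^sub>R tens a gv w z = (\<Sum>i\<in>I. a i *\<^sub>R ((c (fst z))\<^sup>2 *\<^sub>R tp (gv i) (w i) z))"
  by (simp add: tens_def scaleR_sum_right mult.commute)

lemma stiffness_sum:
  "(\<Sum>i\<in>I. \<Sum>j\<in>I. a i * b j * stiffness i j)
    = l2_inner (cyl \<Omega> T) (tens a v h) (tens b v r_exp)
    + l2_inner \<Omega> (\<lambda>x. \<Sum>i\<in>I. a i *\<^sub>R (r i 0 *\<^sub>R v i x)) (\<lambda>x. \<Sum>i\<in>I. b i *\<^sub>R (r i 0 *\<^sub>R v i x))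
    + l2_inner (cyl \<Omega> T) (\<lambda>z. (c (fst z))\<^sup>2 *\<^sub>R tens a gv w z) (tens b gv r_exp)"
  unfolding stiffness_def c_sq_tens_eq unfolding tens_def[abs_def]
  apply (subst l2_inner_sum, (intro L2_tp_cyl v_L2 h_L2 r_exp_L2; assumption)+)
  apply (subst l2_inner_sum, (intro L2_scale v_L2; assumption)+)
  apply (subst l2_inner_sum, (intro L2_mult_Linf c_sq_cyl_Linf L2_tp_cyl gv_L2 w_L2 r_exp_L2; assumption)+)
  apply (simp add: sum.distrib distrib_left)
  done

lemma dt_tens_w:
  assumes f: "f \<in> borel_measurable (leb (cyl \<Omega> T))" and eq: "AE z in leb (cyl \<Omega> T). f z = tens a v w z"
  shows "AE z in leb (cyl \<Omega> T). dt \<Omega> T f z = tens a v r z" "dt \<Omega> T f \<in> borel_measurable (leb (cyl \<Omega> T))"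
  by (rule dt_tens[OF w_indef r_L2 f eq]; assumption)+

lemma dt_tens_r:
  assumes f: "f \<in> borel_measurable (leb (cyl \<Omega> T))" and eq: "AE z in leb (cyl \<Omega> T). f z = tens a v r z"
  shows "AE z in leb (cyl \<Omega> T). dt \<Omega> T f z = tens a v h z" "dt \<Omega> T f \<in> borel_measurable (leb (cyl \<Omega> T))"
  by (rule dt_tens[OF r_indef h_L2 f eq]; assumption)+

lemma grad_x_tens_w:
  assumes f: "f \<in> borel_measurable (leb (cyl \<Omega> T))" and eq: "AE z in leb (cyl \<Omega> T). f z = tens a v w z"
  shows "AE z in leb (cyl \<Omega> T). grad_x \<Omega> T f z = tens a gv w z" "grad_x \<Omega> T f \<in> borel_measurable (leb (cyl \<Omega> T))"
  by (rule grad_x_tens[OF w_L2 f eq]; assumption)+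

lemma grad_x_tens_r_exp:
  assumes f: "f \<in> borel_measurable (leb (cyl \<Omega> T))" and eq: "AE z in leb (cyl \<Omega> T). f z = tens a v r_exp z"
  shows "AE z in leb (cyl \<Omega> T). grad_x \<Omega> T f z = tens a gv r_exp z" "grad_x \<Omega> T f \<in> borel_measurable (leb (cyl \<Omega> T))"
  by (rule grad_x_tens[OF r_exp_L2 f eq]; assumption)+

lemma initial_trace_r:
  assumes eq: "AE z in leb (cyl \<Omega> T). f z = tens a v r z"
  shows "AE x in leb \<Omega>. initial_trace \<Omega> T f x = (\<Sum>i\<in>I. a i *\<^sub>R (r i 0 *\<^sub>R v i x))"
    "initial_trace \<Omega> T f \<in> L2 \<Omega>"
  by (rule initial_trace_tens[OF r_continuous eq]; assumption)+

lemma initial_trace_r_exp: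
  assumes eq: "AE z in leb (cyl \<Omega> T). f z = tens a v r_exp z"
  shows "AE x in leb \<Omega>. initial_trace \<Omega> T f x = (\<Sum>i\<in>I. a i *\<^sub>R (r i 0 *\<^sub>R v i x))"
    "initial_trace \<Omega> T f \<in> L2 \<Omega>"
  using initial_trace_tens[OF r_exp_continuous eq] by (simp_all add: r_exp_def)

lemma dt_LT:
  assumes W: "W \<in> borel_measurable (leb (cyl \<Omega> T))" and eq: "AE z in leb (cyl \<Omega> T). W z = tens b v w z"
  shows "AE z in leb (cyl \<Omega> T). dt \<Omega> T (LT \<Omega> T W) z = tens b v r_exp z"
    and "dt \<Omega> T (LT \<Omega> T W) \<in> borel_measurable (leb (cyl \<Omega> T))"
  using dt_tens[OF w_exp_indef r_exp_L2 LT_tens(2)[OF W eq] LT_tens(1)[OF W eq]] by auto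

text \<open>The representatives chosen inside \<open>bilin\<close> are replaced one after another by
  explicit sums, which does not change L2 inner products.\<close>

lemma bilin_eq_stiffness:
  assumes U: "U \<in> borel_measurable (leb (cyl \<Omega> T))" and Ueq: "AE z in leb (cyl \<Omega> T). U z = tens a v w z"
    and W: "W \<in> borel_measurable (leb (cyl \<Omega> T))" and Weq: "AE z in leb (cyl \<Omega> T). W z = tens b v w z"
  shows "bilin \<Omega> T c U (LT \<Omega> T W) = (\<Sum>i\<in>I. \<Sum>j\<in>I. a i * b j * stiffness i j)"
proof -
  note dU = dt_tens_w[OF U Ueq]
  note ddU = dt_tens_r[OF dU(2,1)]
  note dW = dt_LT[OF W Weq]
  note gU = grad_x_tens_w[OF U Ueq]
  note gW = grad_x_tens_r_exp[OF dW(2,1)]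
  note tU = initial_trace_r[OF dU(1)]
  note tW = initial_trace_r_exp[OF dW(1)]
  have cm: "(\<lambda>z. (c (fst z))\<^sup>2) \<in> borel_measurable (leb (cyl \<Omega> T))"
    using c_sq_cyl_Linf by (simp add: Linf_def)
  have tm: "(\<lambda>x. \<Sum>i\<in>I. a i *\<^sub>R (r i 0 *\<^sub>R v i x)) \<in> borel_measurable (leb \<Omega>)" for a
    by (intro L2_measurable L2_sum L2_scale v_L2)
  have 1: "l2_inner (cyl \<Omega> T) (dt \<Omega> T (dt \<Omega> T U)) (dt \<Omega> T (LT \<Omega> T W))
      = l2_inner (cyl \<Omega> T) (tens a v h) (tens b v r_exp)"
    by (rule l2_inner_cong_AE[OF ddU(2) _ dW(2) _ ddU(1) dW(1)])
      (rule tens_measurable; intro v_L2 h_L2 r_exp_L2; assumption)+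
  have 2: "l2_inner \<Omega> (initial_trace \<Omega> T (dt \<Omega> T U)) (initial_trace \<Omega> T (dt \<Omega> T (LT \<Omega> T W)))
      = l2_inner \<Omega> (\<lambda>x. \<Sum>i\<in>I. a i *\<^sub>R (r i 0 *\<^sub>R v i x)) (\<lambda>x. \<Sum>i\<in>I. b i *\<^sub>R (r i 0 *\<^sub>R v i x))"
    by (rule l2_inner_cong_AE[OF L2_measurable[OF tU(2)] tm L2_measurable[OF tW(2)] tm tU(1) tW(1)])
  have 3: "l2_inner (cyl \<Omega> T) (\<lambda>(x, t). (c x)\<^sup>2 *\<^sub>R grad_x \<Omega> T U (x, t)) (grad_x \<Omega> T (dt \<Omega> T (LT \<Omega> T W)))
      = l2_inner (cyl \<Omega> T) (\<lambda>z. (c (fst z))\<^sup>2 *\<^sub>R tens a gv w z) (tens b gv r_exp)"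
    unfolding case_prod_unfold prod.collapse
  proof (rule l2_inner_cong_AE[OF _ _ gW(2) _ _ gW(1)])
    show "(\<lambda>z. (c (fst z))\<^sup>2 *\<^sub>R grad_x \<Omega> T U z) \<in> borel_measurable (leb (cyl \<Omega> T))"
      by (rule borel_measurable_scaleR[OF cm gU(2)])
    show "(\<lambda>z. (c (fst z))\<^sup>2 *\<^sub>R tens a gv w z) \<in> borel_measurable (leb (cyl \<Omega> T))"
      by (intro borel_measurable_scaleR[OF cm] tens_measurable gv_L2 w_L2)
    show "tens b gv r_exp \<in> borel_measurable (leb (cyl \<Omega> T))"
      by (intro tens_measurable gv_L2 r_exp_L2)
    show "AE z in leb (cyl \<Omega> T). (c (fst z))\<^sup>2 *\<^sub>R grad_x \<Omega> T U z = (c (fst z))\<^sup>2 *\<^sub>R tens a gv w z"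
      using gU(1) by eventually_elim simp
  qed
  show ?thesis unfolding bilin_def 1 2 3 stiffness_sum ..
qed

lemma l2_inner_tens:
  assumes F: "F \<in> L2 (cyl \<Omega> T)"
  shows "l2_inner (cyl \<Omega> T) F (tens b v r_exp) = (\<Sum>j\<in>I. b j * l2_inner (cyl \<Omega> T) F (tp (v j) (r_exp j)))"
  using l2_inner_sum[of "{()}" "\<lambda>_. F" "cyl \<Omega> T" I "\<lambda>j. tp (v j) (r_exp j)" "\<lambda>_. 1" b] F
    L2_tp_cyl[OF v_L2 r_exp_L2] by (simp add: tens_def[abs_def])

lemma l2_inner_dt_LT:
  assumes F: "F \<in> L2 (cyl \<Omega> T)"
    and W: "W \<in> borel_measurable (leb (cyl \<Omega> T))" and Weq: "AE z in leb (cyl \<Omega> T). W z = tens b v w z"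
  shows "l2_inner (cyl \<Omega> T) F (dt \<Omega> T (LT \<Omega> T W)) = l2_inner (cyl \<Omega> T) F (tens b v r_exp)"
  using dt_LT[OF W Weq] L2_measurable[OF F]
  by (intro l2_inner_cong_AE tens_measurable v_L2 r_exp_L2) auto

text \<open>The square of the V-norm in terms of coefficients. It may vanish at a nonzero vector,
  because the family may be linearly dependent.\<close>

definition energy :: "('i \<Rightarrow> real) \<Rightarrow> real" where
  "energy a = (l2_norm (cyl \<Omega> T) (tens a v r))\<^sup>2
    + (l2_norm (cyl \<Omega> T) (\<lambda>z. c (fst z) *\<^sub>R tens a gv w z))\<^sup>2"

lemma V_norm_eq_energy:
  assumes U: "U \<in> borel_measurable (leb (cyl \<Omega> T))" and Ueq: "AE z in leb (cyl \<Omega> T). U z = tens a v w z"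
  shows "V_norm \<Omega> T c U = sqrt (energy a)"
proof -
  note dU = dt_tens_w[OF U Ueq]
  note gU = grad_x_tens_w[OF U Ueq]
  have cm: "(\<lambda>z. c (fst z)) \<in> borel_measurable (leb (cyl \<Omega> T))"
    using c_cyl_Linf by (simp add: Linf_def)
  have 1: "l2_norm (cyl \<Omega> T) (dt \<Omega> T U) = l2_norm (cyl \<Omega> T) (tens a v r)"
    by (rule l2_norm_cong_AE[OF dU(2) _ dU(1)]) (rule tens_measurable; intro v_L2 r_L2; assumption)
  have 2: "l2_norm (cyl \<Omega> T) (\<lambda>(x, t). c x *\<^sub>R grad_x \<Omega> T U (x, t))
      = l2_norm (cyl \<Omega> T) (\<lambda>z. c (fst z) *\<^sub>R tens a gv w z)"
    unfolding case_prod_unfold prod.collapse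
  proof (rule l2_norm_cong_AE)
    show "(\<lambda>z. c (fst z) *\<^sub>R grad_x \<Omega> T U z) \<in> borel_measurable (leb (cyl \<Omega> T))"
      by (rule borel_measurable_scaleR[OF cm gU(2)])
    show "(\<lambda>z. c (fst z) *\<^sub>R tens a gv w z) \<in> borel_measurable (leb (cyl \<Omega> T))"
      by (intro borel_measurable_scaleR[OF cm] tens_measurable gv_L2 w_L2)
    show "AE z in leb (cyl \<Omega> T). c (fst z) *\<^sub>R grad_x \<Omega> T U z = c (fst z) *\<^sub>R tens a gv w z"
      using gU(1) by eventually_elim simp
  qed
  show ?thesis unfolding V_norm_def energy_def 1 2 ..
qed

lemma tens_r_exp: "tens a f r_exp (x, t) = exp (- t / T) *\<^sub>R tens a f r (x, t)"
  by (simp add: tens_def tp_def r_exp_def scaleR_sum_right mult_ac)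

lemma tens_indef:
  assumes "\<And>i. i \<in> I \<Longrightarrow> indef T (G i) (g i)"
  shows "indef T (\<lambda>t. tens a v G (x, t)) (\<lambda>t. tens a v g (x, t))"
proof -
  have "indef T (\<lambda>t. \<Sum>i\<in>I. (a i * v i x) * G i t) (\<lambda>t. \<Sum>i\<in>I. (a i * v i x) * g i t)"
    by (intro indef_sum assms)
  then show ?thesis by (simp add: tens_def tp_def mult_ac)
qed

lemma tens_gv_indef: "indef T (\<lambda>t. tens a gv w (x, t) \<bullet> b) (\<lambda>t. tens a gv r (x, t) \<bullet> b)"
proof -
  have "indef T (\<lambda>t. \<Sum>i\<in>I. (a i * (gv i x \<bullet> b)) * w i t) (\<lambda>t. \<Sum>i\<in>I. (a i * (gv i x \<bullet> b)) * r i t)"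
    by (intro indef_sum w_indef)
  then show ?thesis by (simp add: tens_def tp_def inner_sum_left mult_ac)
qed

text \<open>Fact \<open>A\<close> is the estimate for the time derivative, \<open>B\<close> the one
  for the weighted gradient. Fact \<open>A\<close> consumes only half of the trace term of the form;
  the other half is nonnegative and is given away.\<close>

lemma coercive:
  "energy a / (2 * exp 1 * T) \<le> (\<Sum>i\<in>I. \<Sum>j\<in>I. a i * a j * stiffness i j)"
proof -
  let ?k = "2 * exp 1 * T"
  let ?R0 = "\<lambda>x. \<Sum>i\<in>I. a i *\<^sub>R (r i 0 *\<^sub>R v i x)"
  let ?I = "leb {0<..<T}"
  have R0: "?R0 \<in> L2 \<Omega>" by (intro L2_sum L2_scale v_L2)
  have L: "tens a v r \<in> L2 (cyl \<Omega> T)" "tens a v h \<in> L2 (cyl \<Omega> T)" "tens a v r_exp \<in> L2 (cyl \<Omega> T)"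
    "tens a gv w \<in> L2 (cyl \<Omega> T)" "tens a gv r_exp \<in> L2 (cyl \<Omega> T)"
    by (intro tens_L2 v_L2 gv_L2 r_L2 h_L2 r_exp_L2 w_L2; assumption)+
  have "(\<integral>z. (tens a v r z \<bullet> tens a v r z) / ?k \<partial>leb (cyl \<Omega> T))
      \<le> (\<integral>z. tens a v h z \<bullet> tens a v r_exp z \<partial>leb (cyl \<Omega> T)) + (\<integral>x. (?R0 x \<bullet> ?R0 x) / 2 \<partial>leb \<Omega>)"
  proof (rule leb_Times_integral_mono)
    show "integrable (leb (cyl \<Omega> T)) (\<lambda>z. tens a v r z \<bullet> tens a v r z / ?k)"
      using L2_integrable_inner[OF L(1,1)] by simp
    show "integrable (leb (cyl \<Omega> T)) (\<lambda>z. tens a v h z \<bullet> tens a v r_exp z)"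
      by (rule L2_integrable_inner[OF L(2,3)])
    show "integrable (leb \<Omega>) (\<lambda>x. ?R0 x \<bullet> ?R0 x / 2)"
      using L2_integrable_inner[OF R0 R0] by simp
    fix x
    have "(LBINT t:{0<..<T}. (tens a v r (x, t))\<^sup>2) / ?k
        \<le> (LBINT t:{0<..<T}. exp (- t / T) * (tens a v h (x, t) * tens a v r (x, t))) + (tens a v r (x, 0))\<^sup>2 / 2"
      by (rule exp_weight_energy[OF T_pos tens_indef[OF r_indef]])
    moreover have "tens a v r (x, 0) = ?R0 x" by (simp add: tens_def tp_def)
    ultimately show "(\<integral>t. tens a v r (x, t) \<bullet> tens a v r (x, t) / ?k \<partial>?I)
        \<le> (\<integral>t. tens a v h (x, t) \<bullet> tens a v r_exp (x, t) \<partial>?I) + ?R0 x \<bullet> ?R0 x / 2"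
      by (simp add: leb_integral tens_r_exp power2_eq_square mult.left_commute)
  qed (simp_all add: borel_\<Omega>)
  then have A: "l2_inner (cyl \<Omega> T) (tens a v r) (tens a v r) / ?k
      \<le> l2_inner (cyl \<Omega> T) (tens a v h) (tens a v r_exp) + l2_inner \<Omega> ?R0 ?R0 / 2"
    by (simp add: l2_inner_def)
  let ?C = "\<lambda>z. c (fst z) *\<^sub>R tens a gv w z" and ?C2 = "\<lambda>z. (c (fst z))\<^sup>2 *\<^sub>R tens a gv w z"
  have CL: "?C \<in> L2 (cyl \<Omega> T)" "?C2 \<in> L2 (cyl \<Omega> T)"
    using L2_mult_Linf[OF L(4)] c_cyl_Linf c_sq_cyl_Linf by auto
  have "(\<integral>z. (?C z \<bullet> ?C z) / ?k \<partial>leb (cyl \<Omega> T))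
      \<le> (\<integral>z. ?C2 z \<bullet> tens a gv r_exp z \<partial>leb (cyl \<Omega> T)) + (\<integral>x. 0 \<partial>leb \<Omega>)"
  proof (rule leb_Times_integral_mono)
    show "integrable (leb (cyl \<Omega> T)) (\<lambda>z. ?C z \<bullet> ?C z / ?k)"
      using L2_integrable_inner[OF CL(1,1)] by simp
    show "integrable (leb (cyl \<Omega> T)) (\<lambda>z. ?C2 z \<bullet> tens a gv r_exp z)"
      by (rule L2_integrable_inner[OF CL(2) L(5)])
    fix x
    let ?P = "\<lambda>t. tens a gv w (x, t)" and ?Q = "\<lambda>t. tens a gv r (x, t)"
    have "(LBINT t:{0<..<T}. ?P t \<bullet> ?P t) / ?k \<le> (LBINT t:{0<..<T}. exp (- t / T) * (?Q t \<bullet> ?P t))"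
      by (rule exp_weight_energy_vector[OF T_pos tens_gv_indef]) (simp add: tens_def tp_def w_0)
    \<comment> \<open>The coefficient does not depend on time, so its square can be multiplied in on
      each time slice.\<close>
    from mult_left_mono[OF this, of "(c x)\<^sup>2"]
    have "(LBINT t:{0<..<T}. (c x)\<^sup>2 * (?P t \<bullet> ?P t)) / ?k
        \<le> (LBINT t:{0<..<T}. (c x)\<^sup>2 * (exp (- t / T) * (?Q t \<bullet> ?P t)))"
      by simp
    then show "(\<integral>t. ?C (x, t) \<bullet> ?C (x, t) / ?k \<partial>?I) \<le> (\<integral>t. ?C2 (x, t) \<bullet> tens a gv r_exp (x, t) \<partial>?I) + 0"
      by (simp add: leb_integral tens_r_exp power2_eq_square inner_commute mult_ac)
  qed (simp_all add: borel_\<Omega>)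
  then have B: "l2_inner (cyl \<Omega> T) ?C ?C / ?k \<le> l2_inner (cyl \<Omega> T) ?C2 (tens a gv r_exp)"
    by (simp add: l2_inner_def)
  have "energy a / ?k = l2_inner (cyl \<Omega> T) (tens a v r) (tens a v r) / ?k + l2_inner (cyl \<Omega> T) ?C ?C / ?k"
    by (simp add: energy_def l2_norm_sq add_divide_distrib)
  then show ?thesis
    using A B l2_inner_self_nonneg[of \<Omega> ?R0] unfolding stiffness_sum by linarith
qed

text \<open>For t > 0 the weight is at most 1. Consequently the right-hand side of the scheme,
  tested with \<open>U\<close>, is bounded by the norm of \<open>F\<close> times the V-norm.\<close>

lemma tens_r_exp_norm_le: "l2_norm (cyl \<Omega> T) (tens a v r_exp) \<le> l2_norm (cyl \<Omega> T) (tens a v r)"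
proof -
  have L: "tens a v r \<in> L2 (cyl \<Omega> T)" "tens a v r_exp \<in> L2 (cyl \<Omega> T)"
    by (intro tens_L2 v_L2 r_L2 r_exp_L2; assumption)+
  have "l2_inner (cyl \<Omega> T) (tens a v r_exp) (tens a v r_exp) \<le> l2_inner (cyl \<Omega> T) (tens a v r) (tens a v r)"
    unfolding l2_inner_def
  proof (rule integral_mono[OF L2_integrable_inner[OF L(2,2)] L2_integrable_inner[OF L(1,1)]])
    fix z assume "z \<in> space (leb (cyl \<Omega> T))"
    then obtain x t where z: "z = (x, t)" "t > 0" by (auto simp: space_restrict_space)
    have "\<bar>exp (- t / T)\<bar> \<le> 1" using z(2) T_pos by simp
    then have "\<bar>tens a v r_exp z\<bar> \<le> \<bar>tens a v r z\<bar>"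
      unfolding z(1) tens_r_exp by (simp add: abs_mult mult_left_le_one_le)
    then show "tens a v r_exp z \<bullet> tens a v r_exp z \<le> tens a v r z \<bullet> tens a v r z"
      by (simp add: abs_le_square_iff flip: power2_eq_square)
  qed
  then show ?thesis by (simp add: l2_norm_def)
qed

lemma energy_bounds:
  "0 \<le> energy a" "l2_norm (cyl \<Omega> T) (tens a v r) \<le> sqrt (energy a)"
  by (simp_all add: energy_def real_le_rsqrt)

text \<open>The time derivative vanishes almost everywhere; integrating it from the zero initial
  value on almost every time line gives 0.\<close>

lemma tens_zero_if_energy_zero:
  assumes "energy a = 0"
  shows "AE z in leb (cyl \<Omega> T). tens a v w z = 0"
proof -
  let ?I = "leb {0<..<T}"
  interpret pair_sigma_finite "leb \<Omega>" ?I by (rule pair_sigma_finite_leb) (simp_all add: borel_\<Omega>)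
  have cyl: "leb (cyl \<Omega> T) = leb \<Omega> \<Otimes>\<^sub>M ?I" by (rule leb_Times) (simp_all add: borel_\<Omega>)
  have "l2_norm (cyl \<Omega> T) (tens a v r) = 0"
    using energy_bounds(2)[of a] l2_norm_nonneg[of "cyl \<Omega> T" "tens a v r"] assms by simp
  then have "AE z in leb (cyl \<Omega> T). tens a v r z = 0"
    by (intro l2_inner_self_eq_0 tens_L2 v_L2 r_L2) (simp_all flip: l2_norm_sq)
  from AE_pair[OF this[unfolded cyl]] have "AE x in leb \<Omega>. AE t in ?I. tens a v r (x, t) = 0" .
  then have "AE x in leb \<Omega>. AE t in ?I. tens a v w (x, t) = 0"
  proof (rule AE_mp, intro AE_I2[where M = "leb \<Omega>"] impI)
    fix x assume "AE t in ?I. tens a v r (x, t) = 0"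
    then have ae: "AE t in lborel. t \<in> {0<..<T} \<longrightarrow> tens a v r (x, t) = 0"
      by (simp add: AE_restrict_space_iff)
    have "tens a v w (x, t) = 0" if t: "t \<in> {0<..<T}" for t
    proof -
      have "indef T (\<lambda>t. tens a v w (x, t)) (\<lambda>t. tens a v r (x, t))"
        by (intro tens_indef w_indef)
      moreover have "t \<in> {0..T}" using t by simp
      ultimately have "tens a v w (x, t) = tens a v w (x, 0) + (LBINT s:{0<..<t}. tens a v r (x, s))"
        unfolding indef_def by blast
      also have "tens a v w (x, 0) = 0" by (simp add: tens_def tp_def w_0)
      also have "(LBINT s:{0<..<t}. tens a v r (x, s)) = 0"
        unfolding set_lebesgue_integral_def
        by (rule integral_eq_zero_AE) (use ae t in \<open>auto elim!: eventually_mono simp: indicator_def\<close>)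
      finally show ?thesis by simp
    qed
    then show "AE t in ?I. tens a v w (x, t) = 0"
      by (intro AE_I2) (simp add: space_restrict_space)
  qed
  moreover have "tens a v w \<in> borel_measurable (leb \<Omega> \<Otimes>\<^sub>M ?I)"
    unfolding cyl[symmetric] by (intro tens_measurable v_L2 w_L2)
  then have "{z \<in> space (leb \<Omega> \<Otimes>\<^sub>M ?I). tens a v w z = 0} \<in> sets (leb \<Omega> \<Otimes>\<^sub>M ?I)"
    by (intro borel_measurable_eq) simp_all
  ultimately show ?thesis unfolding cyl by (intro AE_pair_measure)
qed

end

section \<open>Finite dimensional solvability\<close>

text \<open>A functional vanishing on the common kernel of finitely many others is their
  combination. The subspace \<open>P\<close> is carried along so that the induction can restrict to
  the kernel of one functional at a time.\<close>

lemma functional_in_span: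
  fixes g :: "'j \<Rightarrow> ('i \<Rightarrow> real) \<Rightarrow> real"
  assumes "finite J"
    and "\<And>x y k. x \<in> P \<Longrightarrow> y \<in> P \<Longrightarrow> (\<lambda>i. x i + k * y i) \<in> P"
    and "\<And>x y k. f (\<lambda>i. x i + k * y i) = f x + k * f y"
    and "\<And>j x y k. g j (\<lambda>i. x i + k * y i) = g j x + k * g j y"
    and "\<And>x. x \<in> P \<Longrightarrow> (\<And>j. j \<in> J \<Longrightarrow> g j x = 0) \<Longrightarrow> f x = 0"
  shows "\<exists>b. \<forall>x\<in>P. f x = (\<Sum>j\<in>J. b j * g j x)"
  using assms
proof (induction J arbitrary: P rule: finite_induct)
  case empty
  then show ?case by simp
next
  case (insert k J)
  note lin = insert.prems(2,3)
  have "\<exists>b. \<forall>x\<in>{x \<in> P. g k x = 0}. f x = (\<Sum>j\<in>J. b j * g j x)"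
  proof (rule insert.IH[OF _ lin])
    show "(\<lambda>i. x i + q * y i) \<in> {x \<in> P. g k x = 0}"
      if "x \<in> {x \<in> P. g k x = 0}" "y \<in> {x \<in> P. g k x = 0}" for x y q
      using that insert.prems(1) by (simp add: lin)
    show "f x = 0" if "x \<in> {x \<in> P. g k x = 0}" "\<And>j. j \<in> J \<Longrightarrow> g j x = 0" for x
      using that by (intro insert.prems(4)) auto
  qed
  then obtain b where b: "\<And>x. x \<in> P \<Longrightarrow> g k x = 0 \<Longrightarrow> f x = (\<Sum>j\<in>J. b j * g j x)"
    by blast
  show ?case
  proof (cases "\<forall>x\<in>P. g k x = 0")
    case True
    then have "\<forall>x\<in>P. f x = (\<Sum>j\<in>insert k J. b j * g j x)"
      using insert.hyps b by simp
    then show ?thesis by blast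
  next
    case False
    then obtain y where y: "y \<in> P" "g k y \<noteq> 0" by blast
    \<comment> \<open>This value makes the claimed identity hold at \<open>y\<close>; every
      \<open>x\<close> in \<open>P\<close> differs from a multiple of \<open>y\<close> by an element
      of the kernel of \<open>g k\<close>, where \<open>b\<close> already works.\<close>
    define \<beta> where "\<beta> = (f y - (\<Sum>j\<in>J. b j * g j y)) / g k y"
    have "f x = (\<Sum>j\<in>insert k J. (b(k := \<beta>)) j * g j x)" if x: "x \<in> P" for x
    proof -
      let ?q = "- (g k x / g k y)"
      have "f (\<lambda>i. x i + ?q * y i) = (\<Sum>j\<in>J. b j * g j (\<lambda>i. x i + ?q * y i))"
      proof (rule b)
        show "(\<lambda>i. x i + ?q * y i) \<in> P" using insert.prems(1) x y(1) by blast
        show "g k (\<lambda>i. x i + ?q * y i) = 0" using y(2) by (simp only: lin) simp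
      qed
      then have "f x + ?q * f y = (\<Sum>j\<in>J. b j * g j x) + ?q * (\<Sum>j\<in>J. b j * g j y)"
        by (simp only: lin distrib_left sum.distrib sum_distrib_left mult.left_commute)
      then have "f x = (\<Sum>j\<in>J. b j * g j x) + \<beta> * g k x"
        using y(2) by (simp add: \<beta>_def field_simps)
      also have "(\<Sum>j\<in>J. b j * g j x) = (\<Sum>j\<in>J. (b(k := \<beta>)) j * g j x)"
        using insert.hyps by (intro sum.cong) auto
      finally show ?thesis using insert.hyps by simp
    qed
    then show ?thesis by blast
  qed
qed

text \<open>The Fredholm alternative for finitely many equations: \<open>l\<close> is attained as
  soon as it respects every linear relation among the functionals.\<close>

lemma functionals_solvable:
  fixes g :: "'j \<Rightarrow> ('i \<Rightarrow> real) \<Rightarrow> real"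
  assumes "finite J"
    and "\<And>j x y k. g j (\<lambda>i. x i + k * y i) = g j x + k * g j y"
    and "\<And>b. (\<And>x. (\<Sum>j\<in>J. b j * g j x) = 0) \<Longrightarrow> (\<Sum>j\<in>J. b j * l j) = 0"
  shows "\<exists>x. \<forall>j\<in>J. g j x = l j"
  using assms
proof (induction J rule: finite_induct)
  case empty
  then show ?case by simp
next
  case (insert k J)
  note lin = insert.prems(1)
  have upd: "(\<Sum>j\<in>insert k J. (b(k := \<beta>)) j * u j) = \<beta> * u k + (\<Sum>j\<in>J. b j * u j)"
    for b :: "'j \<Rightarrow> real" and \<beta> u
  proof -
    have "(\<Sum>j\<in>J. (b(k := \<beta>)) j * u j) = (\<Sum>j\<in>J. b j * u j)"
      using insert.hyps by (intro sum.cong) auto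
    then show ?thesis using insert.hyps by simp
  qed
  have "\<exists>x. \<forall>j\<in>J. g j x = l j"
  proof (rule insert.IH[OF lin])
    fix b :: "'j \<Rightarrow> real" assume "\<And>x. (\<Sum>j\<in>J. b j * g j x) = 0"
    then show "(\<Sum>j\<in>J. b j * l j) = 0"
      using insert.prems(2)[of "b(k := 0)"] unfolding upd by simp
  qed
  then obtain x where x: "\<And>j. j \<in> J \<Longrightarrow> g j x = l j" by blast
  show ?case
  proof (cases "\<exists>y. (\<forall>j\<in>J. g j y = 0) \<and> g k y \<noteq> 0")
    case True
    then obtain y where y: "\<And>j. j \<in> J \<Longrightarrow> g j y = 0" "g k y \<noteq> 0" by blast
    have "\<forall>j\<in>insert k J. g j (\<lambda>i. x i + (l k - g k x) / g k y * y i) = l j"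
      unfolding lin using x y by simp
    then show ?thesis by blast
  next
    case False
    \<comment> \<open>Here \<open>g k\<close> vanishes wherever the others do, so it is a
      combination of them. With coefficient -1 at \<open>k\<close> this is a relation that
      \<open>l\<close> respects, and the solution of the other equations already solves equation
      \<open>k\<close>.\<close>
    then have "\<exists>b. \<forall>x\<in>UNIV. g k x = (\<Sum>j\<in>J. b j * g j x)"
      by (intro functional_in_span insert.hyps lin) auto
    then obtain b where b: "\<And>x. g k x = (\<Sum>j\<in>J. b j * g j x)" by blast
    have "(\<Sum>j\<in>insert k J. (b(k := - 1)) j * l j) = 0"
      by (rule insert.prems(2)) (simp add: upd b del: sum.insert fun_upd_apply)
    then have "g k x = l k" unfolding upd using x b[of x] by simp
    with x show ?thesis by blast
  qed
qed

text \<open>A vector \<open>b\<close> that annihilates the range annihilates in particular the image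
  of \<open>b\<close> itself, so its quadratic form is 0 and \<open>null\<close> yields the
  compatibility condition. A singular \<open>K\<close> is allowed.\<close>

lemma matrix_equation_solvable:
  fixes K :: "'i \<Rightarrow> 'i \<Rightarrow> real" and l :: "'i \<Rightarrow> real"
  assumes I: "finite I"
    and null: "\<And>a. (\<Sum>i\<in>I. \<Sum>j\<in>I. a i * a j * K i j) = 0 \<Longrightarrow> (\<Sum>j\<in>I. a j * l j) = 0"
  shows "\<exists>a. \<forall>j\<in>I. (\<Sum>i\<in>I. a i * K i j) = l j"
proof (rule functionals_solvable[OF I])
  show "(\<Sum>i\<in>I. (x i + k * y i) * K i j) = (\<Sum>i\<in>I. x i * K i j) + k * (\<Sum>i\<in>I. y i * K i j)" for j x y k
    by (simp add: sum.distrib sum_distrib_left distrib_right mult.assoc)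
  fix b assume "\<And>x. (\<Sum>j\<in>I. b j * (\<Sum>i\<in>I. x i * K i j)) = 0"
  from this[of b] have "(\<Sum>j\<in>I. \<Sum>i\<in>I. b i * b j * K i j) = 0"
    by (simp add: sum_distrib_left mult_ac)
  then show "(\<Sum>j\<in>I. b j * l j) = 0"
    by (intro null) (subst sum.swap, simp)
qed

section \<open>From the tensor product space to a linear system for the coefficients\<close>

lemma AE_leb_Times_fst:
  assumes A: "A \<in> sets borel" and B: "B \<in> sets borel" and P: "AE x in leb A. P x"
  shows "AE z in leb (A \<times> B). P (fst z)"
proof -
  interpret pair_sigma_finite "leb A" "leb B" by (rule pair_sigma_finite_leb[OF A B])
  obtain N where N: "N \<in> null_sets (leb A)" "{x \<in> space (leb A). \<not> P x} \<subseteq> N"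
    using P unfolding eventually_ae_filter by blast
  have [measurable]: "N \<in> sets (leb A)" using N(1) by (simp add: null_sets_def)
  have "AE z in leb A \<Otimes>\<^sub>M leb B. fst z \<notin> N"
  proof (rule AE_pair_measure)
    show "{z \<in> space (leb A \<Otimes>\<^sub>M leb B). fst z \<notin> N} \<in> sets (leb A \<Otimes>\<^sub>M leb B)" by measurable
    show "AE x in leb A. AE y in leb B. fst (x, y) \<notin> N"
      using AE_not_in[OF N(1)] by eventually_elim simp
  qed
  then show ?thesis
    unfolding leb_Times[OF A B] using AE_space
    by eventually_elim (use N(2) in \<open>auto simp: space_pair_measure\<close>)
qed

lemma AE_leb_Times_snd:
  assumes A: "A \<in> sets borel" and B: "B \<in> sets borel" and P: "AE y in leb B. P y"
  shows "AE z in leb (A \<times> B). P (snd z)"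
proof -
  interpret pair_sigma_finite "leb A" "leb B" by (rule pair_sigma_finite_leb[OF A B])
  obtain N where N: "N \<in> null_sets (leb B)" "{x \<in> space (leb B). \<not> P x} \<subseteq> N"
    using P unfolding eventually_ae_filter by blast
  have [measurable]: "N \<in> sets (leb B)" using N(1) by (simp add: null_sets_def)
  have "AE z in leb A \<Otimes>\<^sub>M leb B. snd z \<notin> N"
  proof (rule AE_pair_measure)
    show "{z \<in> space (leb A \<Otimes>\<^sub>M leb B). snd z \<notin> N} \<in> sets (leb A \<Otimes>\<^sub>M leb B)" by measurable
    show "AE x in leb A. AE y in leb B. snd (x, y) \<notin> N"
      using AE_not_in[OF N(1)] by simp
  qed
  then show ?thesis
    unfolding leb_Times[OF A B] using AE_space
    by eventually_elim (use N(2) in \<open>auto simp: space_pair_measure\<close>)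
qed

context tensor_family
begin

text \<open>Existence is solvability of the coefficient system. Uniqueness concerns functions rather
  than coefficients: the difference of two solving vectors has zero energy and so represents 0
  almost everywhere.\<close>

lemma galerkin_solution_unique_stable:
  assumes F: "F \<in> L2 (cyl \<Omega> T)"
    and Q: "\<And>U. U \<in> Q \<longleftrightarrow> U \<in> borel_measurable (leb (cyl \<Omega> T)) \<and>
      (\<exists>a. AE z in leb (cyl \<Omega> T). U z = tens a v w z)"
  shows "\<exists>U. galerkin_solution \<Omega> T c Q F U \<and>
           (\<forall>U'. galerkin_solution \<Omega> T c Q F U' \<longrightarrow> (AE z in leb (cyl \<Omega> T). U' z = U z)) \<and>
           V_norm \<Omega> T c U \<le> 2 * exp 1 * T * l2_norm (cyl \<Omega> T) F"
proof -
  define l where "l j = l2_inner (cyl \<Omega> T) F (tp (v j) (r_exp j))" for j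
  let ?k = "2 * exp 1 * T"
  have k: "?k > 0" using T_pos by simp
  have l_le: "(\<Sum>j\<in>I. a j * l j) \<le> l2_norm (cyl \<Omega> T) F * sqrt (energy a)" for a
  proof -
    have "(\<Sum>j\<in>I. a j * l j) = l2_inner (cyl \<Omega> T) F (tens a v r_exp)"
      by (simp add: l2_inner_tens[OF F] l_def)
    also have "\<dots> \<le> l2_norm (cyl \<Omega> T) F * l2_norm (cyl \<Omega> T) (tens a v r_exp)"
      by (intro l2_inner_Cauchy_Schwarz F tens_L2 v_L2 r_exp_L2)
    also have "\<dots> \<le> l2_norm (cyl \<Omega> T) F * sqrt (energy a)"
      by (intro mult_left_mono l2_norm_nonneg order_trans[OF tens_r_exp_norm_le energy_bounds(2)])
    finally show ?thesis .
  qed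
  have energy_0: "energy a = 0" if "(\<Sum>i\<in>I. \<Sum>j\<in>I. a i * a j * stiffness i j) = 0" for a
    using coercive[of a] that energy_bounds(1)[of a] k by (simp add: divide_le_0_iff)
  have energy_minus: "energy (\<lambda>i. - a i) = energy a" for a
    by (simp add: energy_def tens_def[abs_def] sum_negf l2_norm_def l2_inner_def)
  have "\<exists>a. \<forall>j\<in>I. (\<Sum>i\<in>I. a i * stiffness i j) = l j"
  proof (rule matrix_equation_solvable[OF finite_I])
    fix a assume "(\<Sum>i\<in>I. \<Sum>j\<in>I. a i * a j * stiffness i j) = 0"
    then have "energy a = 0" by (rule energy_0)
    \<comment> \<open>The load is bounded above by 0 at both \<open>a\<close> and its
      negative.\<close>
    then show "(\<Sum>j\<in>I. a j * l j) = 0"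
      using l_le[of a] l_le[of "\<lambda>i. - a i"] by (simp add: energy_minus sum_negf)
  qed
  then obtain a where a: "\<And>j. j \<in> I \<Longrightarrow> (\<Sum>i\<in>I. a i * stiffness i j) = l j" by blast
  let ?U = "tens a v w"
  have sw: "(\<Sum>i\<in>I. \<Sum>j\<in>I. a i * b j * stiffness i j) = (\<Sum>j\<in>I. b j * (\<Sum>i\<in>I. a i * stiffness i j))" for a b
    by (subst sum.swap) (simp add: sum_distrib_left mult_ac)
  have a': "(\<Sum>i\<in>I. \<Sum>j\<in>I. a i * b j * stiffness i j) = (\<Sum>j\<in>I. b j * l j)" for b
    unfolding sw using a by simp
  have tm: "tens b v w \<in> borel_measurable (leb (cyl \<Omega> T))" for b
    by (intro tens_measurable v_L2 w_L2)
  have tQ: "tens b v w \<in> Q" for b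
    using tm by (auto simp: Q)
  have rhs: "l2_inner (cyl \<Omega> T) F (dt \<Omega> T (LT \<Omega> T W)) = (\<Sum>j\<in>I. b j * l j)"
    if "W \<in> borel_measurable (leb (cyl \<Omega> T))" "AE z in leb (cyl \<Omega> T). W z = tens b v w z" for W b
    using l2_inner_dt_LT[OF F that] by (simp add: l2_inner_tens[OF F] l_def)
  have sol: "galerkin_solution \<Omega> T c Q F ?U"
    unfolding galerkin_solution_def
  proof (intro conjI ballI tQ)
    fix W assume "W \<in> Q"
    then obtain b where W: "W \<in> borel_measurable (leb (cyl \<Omega> T))" "AE z in leb (cyl \<Omega> T). W z = tens b v w z"
      by (auto simp: Q)
    show "bilin \<Omega> T c ?U (LT \<Omega> T W) = l2_inner (cyl \<Omega> T) F (dt \<Omega> T (LT \<Omega> T W))"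
      using bilin_eq_stiffness[OF tm _ W, of a a] rhs[OF W] a' by simp
  qed
  have unique: "AE z in leb (cyl \<Omega> T). U' z = ?U z" if U': "galerkin_solution \<Omega> T c Q F U'" for U'
  proof -
    from U' have "U' \<in> Q" by (simp add: galerkin_solution_def)
    then obtain b where b: "U' \<in> borel_measurable (leb (cyl \<Omega> T))" "AE z in leb (cyl \<Omega> T). U' z = tens b v w z"
      by (auto simp: Q)
    have b': "(\<Sum>i\<in>I. \<Sum>j\<in>I. b i * d j * stiffness i j) = (\<Sum>j\<in>I. d j * l j)" for d
    proof -
      have "bilin \<Omega> T c U' (LT \<Omega> T (tens d v w)) = (\<Sum>j\<in>I. d j * l j)"
        using U' tQ[of d] rhs[OF tm, of d d] by (simp add: galerkin_solution_def)
      then show ?thesis using bilin_eq_stiffness[OF b tm, of d d] by simp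
    qed
    define d where "d i = b i - a i" for i
    have "(\<Sum>i\<in>I. \<Sum>j\<in>I. d i * d j * stiffness i j)
        = (\<Sum>i\<in>I. \<Sum>j\<in>I. b i * d j * stiffness i j) - (\<Sum>i\<in>I. \<Sum>j\<in>I. a i * d j * stiffness i j)"
      by (simp add: d_def left_diff_distrib sum_subtractf)
    also have "\<dots> = 0" by (simp add: a' b')
    finally have "energy d = 0" by (rule energy_0)
    from tens_zero_if_energy_zero[OF this] b(2) show ?thesis
      by eventually_elim (simp add: tens_def d_def left_diff_distrib sum_subtractf)
  qed
  have "V_norm \<Omega> T c ?U \<le> ?k * l2_norm (cyl \<Omega> T) F"
  proof -
    let ?s = "sqrt (energy a)"
    have V: "V_norm \<Omega> T c ?U = ?s" by (rule V_norm_eq_energy[OF tm]) simp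
    have "?s * ?s = energy a" using energy_bounds(1)[of a] by simp
    \<comment> \<open>Coercivity combined with the equation tested by the solution, that is,
      \<open>a'\<close> with \<open>b = a\<close>.\<close>
    also have "\<dots> \<le> ?k * (\<Sum>j\<in>I. a j * l j)"
      using coercive[of a] k by (simp add: a' divide_le_eq mult.commute)
    also have "\<dots> \<le> ?k * (l2_norm (cyl \<Omega> T) F * ?s)"
      using k by (intro mult_left_mono l_le) simp
    finally have *: "?s * ?s \<le> (?k * l2_norm (cyl \<Omega> T) F) * ?s" by (simp add: mult.assoc)
    show ?thesis
    proof (cases "?s = 0")
      case True
      then show ?thesis unfolding V using k l2_norm_nonneg[of "cyl \<Omega> T" F] by simp
    next
      case False
      then have "?s > 0" using energy_bounds(1)[of a] by simp
      then show ?thesis unfolding V using * by (rule mult_right_le_imp_le[rotated])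
    qed
  qed
  then show ?thesis using sol unique by blast
qed

end

text \<open>Sums of arbitrary length are reduced to one fixed finite family by expanding both
  factors in the spanning sets. The pairs of functions serve as their own indices.\<close>

lemma tensor_space_finite_span:
  assumes \<Omega>: "\<Omega> \<in> sets borel"
    and V: "fin_dim_subspace \<Omega> V" and BV: "finite BV" "BV \<subseteq> V"
      "\<And>f. f \<in> V \<Longrightarrow> \<exists>a. AE x in leb \<Omega>. f x = (\<Sum>p\<in>BV. a p * p x)"
    and BS: "finite BS" "BS \<subseteq> S"
      "\<And>f. f \<in> S \<Longrightarrow> \<exists>a. AE t in leb {0<..<T}. f t = (\<Sum>q\<in>BS. a q * q t)"
  shows "U \<in> tensor_space \<Omega> T V S \<longleftrightarrow> U \<in> borel_measurable (leb (cyl \<Omega> T)) \<and>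
    (\<exists>a. AE z in leb (cyl \<Omega> T). U z = (\<Sum>i\<in>BV \<times> BS. a i * (fst i (fst z) * snd i (snd z))))"
    (is "_ \<longleftrightarrow> _ \<and> ?R")
proof -
  have ?R if ex: "\<exists>(n::nat) v s. (\<forall>i<n. v i \<in> V \<and> s i \<in> S) \<and>
      (AE (x, t) in leb (cyl \<Omega> T). U (x, t) = (\<Sum>i<n. v i x * s i t))"
  proof -
    obtain n :: nat and v s where vs: "\<And>i. i < n \<Longrightarrow> v i \<in> V" "\<And>i. i < n \<Longrightarrow> s i \<in> S"
        "AE (x, t) in leb (cyl \<Omega> T). U (x, t) = (\<Sum>i<n. v i x * s i t)"
      using ex by blast
    define \<alpha> where "\<alpha> i = (SOME a. AE x in leb \<Omega>. v i x = (\<Sum>p\<in>BV. a p * p x))" for i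
    have \<alpha>: "AE x in leb \<Omega>. v i x = (\<Sum>p\<in>BV. \<alpha> i p * p x)" if "i < n" for i
      unfolding \<alpha>_def using BV(3)[OF vs(1)[OF that]] by (rule someI_ex)
    define \<beta> where "\<beta> i = (SOME a. AE t in leb {0<..<T}. s i t = (\<Sum>q\<in>BS. a q * q t))" for i
    have \<beta>: "AE t in leb {0<..<T}. s i t = (\<Sum>q\<in>BS. \<beta> i q * q t)" if "i < n" for i
      unfolding \<beta>_def using BS(3)[OF vs(2)[OF that]] by (rule someI_ex)
    have I: "{0<..<T} \<in> sets borel" by simp
    have "AE z in leb (cyl \<Omega> T). \<forall>i\<in>{..<n}. v i (fst z) = (\<Sum>p\<in>BV. \<alpha> i p * p (fst z))"
      using AE_leb_Times_fst[OF \<Omega> I \<alpha>] by (simp add: AE_finite_all)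
    moreover have "AE z in leb (cyl \<Omega> T). \<forall>i\<in>{..<n}. s i (snd z) = (\<Sum>q\<in>BS. \<beta> i q * q (snd z))"
      using AE_leb_Times_snd[OF \<Omega> I \<beta>] by (simp add: AE_finite_all)
    ultimately have "AE z in leb (cyl \<Omega> T). U z
        = (\<Sum>i\<in>BV \<times> BS. (\<Sum>k<n. \<alpha> k (fst i) * \<beta> k (snd i)) * (fst i (fst z) * snd i (snd z)))"
      using vs(3)
    proof eventually_elim
      case (elim z)
      have "U z = (\<Sum>k<n. v k (fst z) * s k (snd z))" using elim(3) by (cases z) simp
      also have "\<dots> = (\<Sum>k<n. (\<Sum>p\<in>BV. \<alpha> k p * p (fst z)) * (\<Sum>q\<in>BS. \<beta> k q * q (snd z)))"
        using elim(1,2) by (intro sum.cong) auto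
      also have "\<dots> = (\<Sum>k<n. \<Sum>i\<in>BV \<times> BS. (\<alpha> k (fst i) * \<beta> k (snd i)) * (fst i (fst z) * snd i (snd z)))"
        by (simp add: sum_product sum.cartesian_product case_prod_unfold mult_ac)
      also have "\<dots> = (\<Sum>i\<in>BV \<times> BS. (\<Sum>k<n. \<alpha> k (fst i) * \<beta> k (snd i)) * (fst i (fst z) * snd i (snd z)))"
        by (subst sum.swap) (simp add: sum_distrib_right)
      finally show ?case .
    qed
    then show ?R by (rule exI[where x = "\<lambda>i. \<Sum>k<n. \<alpha> k (fst i) * \<beta> k (snd i)"])
  qed
  moreover have "\<exists>(n::nat) v s. (\<forall>i<n. v i \<in> V \<and> s i \<in> S) \<and>
      (AE (x, t) in leb (cyl \<Omega> T). U (x, t) = (\<Sum>i<n. v i x * s i t))" if R: ?R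
  proof -
    obtain a where a: "AE z in leb (cyl \<Omega> T). U z = (\<Sum>i\<in>BV \<times> BS. a i * (fst i (fst z) * snd i (snd z)))"
      using R by blast
    \<comment> \<open>The enumeration supplies the indexing by numbers below \<open>n\<close> in
      \<open>tensor_space\<close>; the coefficient is absorbed into the space factor.\<close>
    obtain e where e: "bij_betw e {..<card (BV \<times> BS)} (BV \<times> BS)"
      using ex_bij_betw_nat_finite[of "BV \<times> BS"] BV(1) BS(1) by (auto simp: atLeast0LessThan)
    let ?n = "card (BV \<times> BS)"
    have mem: "e i \<in> BV \<times> BS" if "i < ?n" for i using e that by (auto dest: bij_betwE)
    have scale: "(\<lambda>x. k * f x) \<in> V" if "f \<in> V" for k f
      using V that unfolding fin_dim_subspace_def by blast
    have "(\<lambda>x. a (e i) * fst (e i) x) \<in> V" "snd (e i) \<in> S" if "i < ?n" for i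
      using mem[OF that] BV(2) BS(2) by (auto simp: mem_Times_iff intro!: scale)
    moreover have "AE (x, t) in leb (cyl \<Omega> T). U (x, t) = (\<Sum>i<?n. a (e i) * fst (e i) x * snd (e i) t)"
      using a
    proof eventually_elim
      case (elim z)
      have "(\<Sum>i<?n. a (e i) * fst (e i) (fst z) * snd (e i) (snd z))
          = (\<Sum>i\<in>BV \<times> BS. a i * fst i (fst z) * snd i (snd z))"
        by (rule sum.reindex_bij_betw[OF e])
      then show ?case using elim by (simp add: case_prod_unfold mult.assoc)
    qed
    ultimately show ?thesis
      by (intro exI[of _ ?n] exI[of _ "\<lambda>i x. a (e i) * fst (e i) x"] exI[of _ "\<lambda>i. snd (e i)"]) simp
  qed
  ultimately show ?thesis unfolding tensor_space_def by blast
qed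

theorem proposition5p1:
  fixes \<Omega> :: "'a::euclidean_space set" and T c\<^sub>0 :: real and c :: "'a \<Rightarrow> real"
    and V :: "('a \<Rightarrow> real) set" and S :: "(real \<Rightarrow> real) set"
    and F :: "'a \<times> real \<Rightarrow> real"
  assumes "DIM('a) \<in> {1, 2, 3}"
    and "T > 0"
    and "bounded \<Omega>" and "lipschitz_domain \<Omega>"
    and "c \<in> Linf \<Omega>" and "c\<^sub>0 > 0" and "AE x in leb \<Omega>. c x \<ge> c\<^sub>0"
    and "V \<subseteq> H10 \<Omega>" and "fin_dim_subspace \<Omega> V"
    and "S \<subseteq> H20 T" and "fin_dim_subspace {0<..<T} S"
    and "F \<in> L2 (cyl \<Omega> T)"
  shows "\<exists>U. galerkin_solution \<Omega> T c (tensor_space \<Omega> T V S) F U \<and>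
           (\<forall>U'. galerkin_solution \<Omega> T c (tensor_space \<Omega> T V S) F U' \<longrightarrow>
              (AE z in leb (cyl \<Omega> T). U' z = U z)) \<and>
           V_norm \<Omega> T c U \<le> 2 * exp 1 * T * l2_norm (cyl \<Omega> T) F"
proof -
  have open_\<Omega>: "open \<Omega>" using assms(4) by (simp add: lipschitz_domain_def)
  then have \<Omega>: "\<Omega> \<in> sets borel" by simp
  obtain BV where BV: "finite BV" "BV \<subseteq> V"
      "\<And>f. f \<in> V \<Longrightarrow> \<exists>a. AE x in leb \<Omega>. f x = (\<Sum>p\<in>BV. a p * p x)"
    using assms(9) unfolding fin_dim_subspace_def by blast
  obtain BS where BS: "finite BS" "BS \<subseteq> S"
      "\<And>f. f \<in> S \<Longrightarrow> \<exists>a. AE t in leb {0<..<T}. f t = (\<Sum>q\<in>BS. a q * q t)"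
    using assms(11) unfolding fin_dim_subspace_def by blast
  have H1: "p \<in> L2 \<Omega> \<and> (\<forall>b\<in>Basis. \<exists>g\<in>L2 \<Omega>. has_weak_deriv \<Omega> b p g)" if "p \<in> BV" for p
    using that BV(2) assms(8) by (auto simp: H10_def)
  define D where "D p b = (SOME g. g \<in> L2 \<Omega> \<and> has_weak_deriv \<Omega> b p g)" for p b
  have D: "D p b \<in> L2 \<Omega>" "has_weak_deriv \<Omega> b p (D p b)" if "p \<in> BV" "b \<in> Basis" for p b
  proof -
    have "\<exists>g. g \<in> L2 \<Omega> \<and> has_weak_deriv \<Omega> b p g" using H1[OF that(1)] that(2) by blast
    from someI_ex[OF this] show "D p b \<in> L2 \<Omega>" "has_weak_deriv \<Omega> b p (D p b)"
      unfolding D_def by blast+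
  qed
  \<comment> \<open>The factor 1 gives the sum the shape that \<open>L2_sum\<close>
    produces.\<close>
  define gv where "gv p x = (\<Sum>b\<in>Basis. 1 *\<^sub>R (D p b x *\<^sub>R b))" for p x
  have gv_inner: "(\<lambda>x. gv p x \<bullet> b) = D p b" if "b \<in> Basis" for p b
    using that by (simp add: gv_def inner_sum_left_Basis)
  have gv_L2: "gv p \<in> L2 \<Omega>" if "p \<in> BV" for p
  proof -
    have "(\<lambda>x. D p b x *\<^sub>R b) \<in> L2 \<Omega>" if "b \<in> Basis" for b
      using D(1)[OF \<open>p \<in> BV\<close> that] that
      by (auto simp: L2_iff inner_same_Basis intro: borel_measurable_scaleR)
    then show ?thesis unfolding gv_def[abs_def] by (rule L2_sum)
  qed
  let ?R = "\<lambda>q (w, r, h). indef T w r \<and> indef T r h \<and> w 0 = 0 \<and> h \<in> L2 {0<..<T} \<and>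
      (AE t in leb {0<..<T}. q t = w t)"
  have "\<forall>q\<in>BS. \<exists>x. ?R q x"
  proof
    fix q assume "q \<in> BS"
    then have "q \<in> H20 T" using BS(2) assms(10) by blast
    from assms(2) this obtain w r h where "?R q (w, r, h)"
      by (rule H20_representation) simp
    then show "\<exists>x. ?R q x" by (rule exI)
  qed
  then obtain R where R: "\<forall>q\<in>BS. ?R q (R q)" by (rule bchoice[THEN exE])
  define w where "w q = fst (R q)" for q
  define r where "r q = fst (snd (R q))" for q
  define h where "h q = snd (snd (R q))" for q
  have wrh: "indef T (w q) (r q)" "indef T (r q) (h q)" "w q 0 = 0" "h q \<in> L2 {0<..<T}"
    "AE t in leb {0<..<T}. q t = w q t" if "q \<in> BS" for q
    using R that by (simp_all add: w_def r_def h_def case_prod_unfold)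
  \<comment> \<open>The space factor of a pair is kept as it is, while the time factor is replaced
    by its twice integrated representative.\<close>
  interpret tensor_family \<Omega> T c "BV \<times> BS" fst "\<lambda>i. gv (fst i)"
    "\<lambda>i. w (snd i)" "\<lambda>i. r (snd i)" "\<lambda>i. h (snd i)"
  proof
    show "open \<Omega>" "bounded \<Omega>" "T > 0" "c \<in> Linf \<Omega>" by (fact open_\<Omega> assms)+
    show "finite (BV \<times> BS)" using BV(1) BS(1) by (rule finite_cartesian_product)
    fix i assume "i \<in> BV \<times> BS"
    then have i: "fst i \<in> BV" "snd i \<in> BS" by auto
    show "fst i \<in> L2 \<Omega>" using H1[OF i(1)] by (rule conjunct1)
    show "gv (fst i) \<in> L2 \<Omega>" by (rule gv_L2[OF i(1)])
    show "indef T (w (snd i)) (r (snd i))" "indef T (r (snd i)) (h (snd i))" "w (snd i) 0 = 0"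
      "h (snd i) \<in> L2 {0<..<T}"
      by (rule wrh[OF i(2)])+
    show "has_weak_deriv \<Omega> b (fst i) (\<lambda>x. gv (fst i) x \<bullet> b)" if "b \<in> Basis" for b
      unfolding gv_inner[OF that] by (rule D(2)[OF i(1) that])
  qed
  show ?thesis
  proof (rule galerkin_solution_unique_stable[OF assms(12)])
    fix U
    \<comment> \<open>As \<open>BS\<close> is finite, exchanging all time factors for their
      representatives changes the sums only on a null set, so the two descriptions of the tensor
      space coincide.\<close>
    have "AE z in leb (cyl \<Omega> T). \<forall>q\<in>BS. q (snd z) = w q (snd z)"
    proof -
      have "AE z in leb (cyl \<Omega> T). q (snd z) = w q (snd z)" if "q \<in> BS" for q
        by (intro AE_leb_Times_snd \<Omega> wrh(5)[OF that]) simp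
      then show ?thesis using BS(1) by (simp add: AE_finite_all)
    qed
    then have eq: "AE z in leb (cyl \<Omega> T). (\<Sum>i\<in>BV \<times> BS. a i * (fst i (fst z) * snd i (snd z)))
        = tens a fst (\<lambda>i. w (snd i)) z" for a
      by eventually_elim (auto simp: tens_def tp_def mem_Times_iff mult_ac intro!: sum.cong)
    have "(AE z in leb (cyl \<Omega> T). U z = (\<Sum>i\<in>BV \<times> BS. a i * (fst i (fst z) * snd i (snd z))))
        \<longleftrightarrow> (AE z in leb (cyl \<Omega> T). U z = tens a fst (\<lambda>i. w (snd i)) z)" for a
      using eq[of a] by (auto elim: AE_mp intro: AE_I2)
    then show "U \<in> tensor_space \<Omega> T V S \<longleftrightarrow> U \<in> borel_measurable (leb (cyl \<Omega> T)) \<and>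
        (\<exists>a. AE z in leb (cyl \<Omega> T). U z = tens a fst (\<lambda>i. w (snd i)) z)"
      using tensor_space_finite_span[OF \<Omega> assms(9) BV BS] by simp
  qed
qed

end
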